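(* There is a unique quadratic transformation of $\mathrm{Hl}$, up to pre- and post-composition with Möbius and F-homotopic transformations of $\mathrm{Hl}$. It is $$\mathrm{Hl}(a,q;\,2\alpha,\gamma;\,\gamma,2\alpha-\gamma+1;\,x)=(1-x)^{-\alpha}\,\mathrm{Hl}\bigl(a',A(q-\gamma\alpha a);\,\alpha,\gamma-\alpha;\,\gamma,\tfrac12;\,R(x)\bigr),$$ where $a,a'\in\mathbb{P}^1\setminus\{0,1,\infty\}$ are related by $$a^2(1-a')^2-16(1-a)a'=0,$$ and the quadratic map $R$ and the multiplier $A$ are defined by $$R(x)=A\,\frac{x(a-x)}{1-x},\qquad A=A(a,a')=\frac{1+a'}{2(2-a)}.$$ This equality holds on a neighborhood of $x=0$.
   Context: The Heun equation (HE) with complex parameters $a\ (\neq0,1),q;\alpha,\beta;\gamma,\delta,\epsilon$, where $\epsilon=\alpha+\beta-\gamma-\delta+1$, is $$F''+\Bigl[\frac{\gamma}{x}+\frac{\delta}{x-1}+\frac{\epsilon}{x-a}\Bigr]F'+\frac{\alpha\beta x-q}{x(x-1)(x-a)}F=0 .$$ It is Fuchsian with singular points $0,1,a,\infty$ and respective characteristic exponents $0,1-\gamma$; $0,1-\delta$; $0,1-\epsilon$; $\alpha,\beta$. It is assumed throughout that $\gamma$ is not a nonpositive integer; $\mathrm{Hl}(a,q;\alpha,\beta;\gamma,\delta;x)$ then denotes the solution that is analytic at $x=0$ and equals $1$ there. It is invariant under $\alpha\leftrightarrow\beta$, and this interchange is disregarded when listing transformations. Quadratic transformations. If $R:\mathbb{P}^1_x\to\mathbb{P}^1_{x'}$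 is a rational map and $\mathcal{L}u=0$ is an HE on $\mathbb{P}^1_{x'}$ with singular points $0,1,a',\infty$, the change of variable $x'=R(x)$ lifts it to a Fuchsian equation $(R^*\mathcal{L})v=0$ on $\mathbb{P}^1_x$. If $R^*\mathcal{L}$ has only four singular points, the lifted equation is an HE in its own right (up to multiplying the dependent variable by powers of linear factors, to make one exponent zero at each finite singular point); such a lifting is called a degree-$(\deg R)$ transformation of the HE. If moreover $R(0)=0$, there results a formula relating a local solution of the form $\mathrm{Hl}(x)$ to one of the form $\mathrm{Hl}(R(x))$. When $\deg R=2$ this is a quadratic transformation of $\mathrm{Hl}$. To avoid degenerate cases, it is assumed that each critical value of $R$ on $\mathbb{P}^1_{x'}$ is one of the HE singular points $0,1,a',\infty$. The Möbius and F-homotopic transformations of $\mathrm{Hl}$ are the elements of the group of transformations of $\mathrm{Hl}(a,q;\alpha,\beta;\gamma,\delta;x)$ (of order 24, disregarding $\alpha\leftrightarrow\beta$) generated under composition by the Möbius transformations $$\mathrm{Hl}(a,q;\alpha,\beta;\gamma,\delta;x)=(1-x)^{-\alpha}\mathrm{Hl}\bigl(\tfrac{a}{a-1},\tfrac{-q+\gamma\alpha a}{a-1};\alpha,\alpha-\delta+1;\gamma,\alpha-\beta+1;\tfrac{x}{x-1}\bigr),$$ $$\mathrm{Hl}(a,q;\alpha,\beta;\gamma,\delta;x)=\mathrm{Hl}\bigl(\tfrac1a,\tfrac qa;\alpha,\beta;\gamma,\alpha+\beta-\gamma-\delta+1;\tfrac xa\bigr),$$ and the F-homotopic transformation $$\mathrm{Hl}(a,q;\alpha,\beta;\gamma,\delta;x)=(1-x)^{1-\delta}\mathrm{Hl}\bigl(a,q-(\delta-1)\gamma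 a;\beta-\delta+1,\alpha-\delta+1;\gamma,2-\delta;x\bigr).$$ Pre- and post-composition means applying such transformations to the left-hand and right-hand $\mathrm{Hl}$ of an identity.
   Formalization: At a=2 (then a'=-1), where A=(1+a')/(2(2-a)) is 0/0, A is taken to be either limit i/2 or -i/2; in the uniqueness claim the right-hand HE must have four singular points not removable by multiplying the dependent variable by powers of linear factors. *)

theory Defs
  imports
    "HOL-Analysis.Analysis"
    "HOL-Computational_Algebra.Computational_Algebra"
    "HOL-Library.Nonpos_Ints"
begin

text \<open>
  The Riemann sphere. The pair \<open>(N, D)\<close> of coprime polynomials stands for the rational map
  \<open>N / D\<close>, of degree \<open>max (degree N) (degree D)\<close>.
\<close>

datatype cpoint = Fin complex | Infty

text \<open>
  \<open>fibre_mult N D v z\<close> is the multiplicity with which \<open>N / D\<close> takes the value \<open>v\<close> at \<open>z\<close>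
  (\<open>0\<close> if it does not take this value there). At \<open>z = Infty\<close> it is the degree drop of the
  polynomial \<open>N - v D\<close> (or \<open>D\<close>, for \<open>v = Infty\<close>) whose zeros form the finite part of the fibre.
\<close>

definition fibre_poly :: "complex poly \<Rightarrow> complex poly \<Rightarrow> cpoint \<Rightarrow> complex poly" where
  "fibre_poly N D v = (case v of Fin w \<Rightarrow> N - smult w D | Infty \<Rightarrow> D)"

definition fibre_mult :: "complex poly \<Rightarrow> complex poly \<Rightarrow> cpoint \<Rightarrow> cpoint \<Rightarrow> nat" where
  "fibre_mult N D v z = (case z of
      Fin u \<Rightarrow> order u (fibre_poly N D v)
    | Infty \<Rightarrow> max (degree N) (degree D) - degree (fibre_poly N D v))"

definition critical_values :: "complex poly \<Rightarrow> complex poly \<Rightarrow> cpoint set" where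
  "critical_values N D = {v. \<exists>z. fibre_mult N D v z \<ge> 2}"

text \<open>
  The pair \<open>(P, Q)\<close> stands for the equation \<open>u'' + P u' + Q u = 0\<close>. The coefficients are rational
  functions, so their values at finitely many points carry no meaning.
\<close>

type_synonym ode2 = "(complex \<Rightarrow> complex) \<times> (complex \<Rightarrow> complex)"

definition ode_eq :: "ode2 \<Rightarrow> ode2 \<Rightarrow> bool" where
  "ode_eq E1 E2 \<longleftrightarrow> (\<forall>\<^sub>F x in cofinite. fst E1 x = fst E2 x \<and> snd E1 x = snd E2 x)"

text \<open>The equation satisfied by \<open>v = u \<circ> R\<close> whenever \<open>u\<close> satisfies \<open>E\<close>.\<close>

definition pullback :: "(complex \<Rightarrow> complex) \<Rightarrow> ode2 \<Rightarrow> ode2" where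
  "pullback R E =
     (\<lambda>x. fst E (R x) * deriv R x - deriv (deriv R) x / deriv R x,
      \<lambda>x. snd E (R x) * (deriv R x)\<^sup>2)"

text \<open>The equation satisfied by \<open>w = h u\<close> whenever \<open>u\<close> satisfies \<open>E\<close>, where \<open>L = h' / h\<close>.\<close>

definition twist :: "(complex \<Rightarrow> complex) \<Rightarrow> ode2 \<Rightarrow> ode2" where
  "twist L E =
     (\<lambda>x. fst E x - 2 * L x,
      \<lambda>x. snd E x - fst E x * L x - deriv L x + (L x)\<^sup>2)"

definition ordinary_at :: "ode2 \<Rightarrow> complex \<Rightarrow> bool" where
  "ordinary_at E z \<longleftrightarrow> (\<exists>P Q. P analytic_on {z} \<and> Q analytic_on {z} \<and>
     (\<forall>\<^sub>F x in at z. fst E x = P x \<and> snd E x = Q x))"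

text \<open>
  Multiplying the dependent variable by a power of a linear factor shifts both exponents at a
  point. A point is counted as singular here only if no such multiplication turns it into an
  ordinary point, so that the set of singular points does not depend on the normalization of the
  exponents. For instance, exponents \<open>0, -1/2\<close> lifted through a simple critical point become
  \<open>0, -1\<close>, and the lifted point does not count as singular.
  The point at infinity is treated in the coordinate \<open>1/x\<close>.
\<close>

definition sing_pts :: "ode2 \<Rightarrow> cpoint set" where
  "sing_pts E =
     Fin ` {z. \<forall>c. \<not> ordinary_at (twist (\<lambda>x. c / (x - z)) E) z} \<union>
     {z. z = Infty \<and> (\<forall>c. \<not> ordinary_at (twist (\<lambda>t. c / t) (pullback inverse E)) 0)}"

text \<open>The parameters \<open>a, q; \<alpha>, \<beta>; \<gamma>, \<delta>\<close>, in this order; \<open>\<epsilon>\<close> is determined by them.\<close>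

datatype heun =
  Heun (h_a: complex) (h_q: complex) (h_al: complex) (h_be: complex) (h_ga: complex) (h_de: complex)

definition h_ep :: "heun \<Rightarrow> complex" where
  "h_ep p = h_al p + h_be p - h_ga p - h_de p + 1"

definition heun_ok :: "heun \<Rightarrow> bool" where
  "heun_ok p \<longleftrightarrow> h_a p \<noteq> 0 \<and> h_a p \<noteq> 1 \<and> h_ga p \<notin> \<int>\<^sub>\<le>\<^sub>0"

definition heun_ode :: "heun \<Rightarrow> ode2" where
  "heun_ode p =
     (\<lambda>x. h_ga p / x + h_de p / (x - 1) + h_ep p / (x - h_a p),
      \<lambda>x. (h_al p * h_be p * x - h_q p) / (x * (x - 1) * (x - h_a p)))"

definition is_Hl :: "heun \<Rightarrow> (complex \<Rightarrow> complex) \<Rightarrow> bool" where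
  "is_Hl p f \<longleftrightarrow> f analytic_on {0} \<and> f 0 = 1 \<and>
     (\<forall>\<^sub>F x in at 0. deriv (deriv f) x + fst (heun_ode p) x * deriv f x
                     + snd (heun_ode p) x * f x = 0)"

text \<open>
  The germ at \<open>0\<close> is unique if \<open>heun_ok p\<close>; only the values near \<open>0\<close> are meaningful.
\<close>

definition Hl :: "heun \<Rightarrow> complex \<Rightarrow> complex" where
  "Hl p = (SOME f. is_Hl p f)"

text \<open>
  \<open>HlTr p h p' R\<close> stands for a relation \<open>Hl p x = h x * Hl p' (R x)\<close> near \<open>x = 0\<close>.
  The functions \<open>h\<close> and \<open>R\<close> matter as germs at \<open>0\<close> only; \<open>h 0 = 1\<close> and \<open>R 0 = 0\<close> in all uses.
\<close>

datatype hl_transf =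
  HlTr (lhs: heun) (pref: "complex \<Rightarrow> complex") (rhs: heun) (arg: "complex \<Rightarrow> complex")

definition hl_eq :: "hl_transf \<Rightarrow> hl_transf \<Rightarrow> bool" where
  "hl_eq T U \<longleftrightarrow> lhs T = lhs U \<and> rhs T = rhs U \<and>
     (\<forall>\<^sub>F x in nhds 0. pref T x = pref U x \<and> arg T x = arg U x)"

text \<open>Apply \<open>U\<close> to the right-hand \<open>Hl\<close> of \<open>T\<close>; this is meaningful if \<open>rhs T = lhs U\<close>.\<close>

definition hl_comp :: "hl_transf \<Rightarrow> hl_transf \<Rightarrow> hl_transf" where
  "hl_comp T U = HlTr (lhs T) (\<lambda>x. pref T x * pref U (arg T x)) (rhs U) (\<lambda>x. arg U (arg T x))"

text \<open>
  The Moebius and F-homotopic transformations. The rule \<open>swap\<close> implements that the interchange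
  of \<open>\<alpha>\<close> and \<open>\<beta>\<close> is disregarded. The generators are involutions, as germs, so closing them under
  composition also provides the inverses.
\<close>

inductive moebius_F :: "hl_transf \<Rightarrow> bool" where
  ident: "heun_ok p \<Longrightarrow> moebius_F (HlTr p (\<lambda>x. 1) p (\<lambda>x. x))"
| swap: "heun_ok (Heun a q \<alpha> \<beta> \<gamma> \<delta>) \<Longrightarrow>
    moebius_F (HlTr (Heun a q \<alpha> \<beta> \<gamma> \<delta>) (\<lambda>x. 1) (Heun a q \<beta> \<alpha> \<gamma> \<delta>) (\<lambda>x. x))"
| moebius1: "heun_ok (Heun a q \<alpha> \<beta> \<gamma> \<delta>) \<Longrightarrow>
    moebius_F (HlTr (Heun a q \<alpha> \<beta> \<gamma> \<delta>)
      (\<lambda>x. (1 - x) powr (- \<alpha>))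
      (Heun (a / (a - 1)) ((- q + \<gamma> * \<alpha> * a) / (a - 1)) \<alpha> (\<alpha> - \<delta> + 1) \<gamma> (\<alpha> - \<beta> + 1))
      (\<lambda>x. x / (x - 1)))"
| moebius2: "heun_ok (Heun a q \<alpha> \<beta> \<gamma> \<delta>) \<Longrightarrow>
    moebius_F (HlTr (Heun a q \<alpha> \<beta> \<gamma> \<delta>)
      (\<lambda>x. 1)
      (Heun (1 / a) (q / a) \<alpha> \<beta> \<gamma> (\<alpha> + \<beta> - \<gamma> - \<delta> + 1))
      (\<lambda>x. x / a))"
| F_homotopic: "heun_ok (Heun a q \<alpha> \<beta> \<gamma> \<delta>) \<Longrightarrow>
    moebius_F (HlTr (Heun a q \<alpha> \<beta> \<gamma> \<delta>)
      (\<lambda>x. (1 - x) powr (1 - \<delta>))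
      (Heun a (q - (\<delta> - 1) * \<gamma> * a) (\<beta> - \<delta> + 1) (\<alpha> - \<delta> + 1) \<gamma> (2 - \<delta>))
      (\<lambda>x. x))"
| comp: "moebius_F T \<Longrightarrow> moebius_F U \<Longrightarrow> rhs T = lhs U \<Longrightarrow> moebius_F (hl_comp T U)"

definition four_singular :: "heun \<Rightarrow> bool" where
  "four_singular p \<longleftrightarrow> sing_pts (heun_ode p) = {Fin 0, Fin 1, Fin (h_a p), Infty}"

text \<open>
  \<open>S\<close> and \<open>c\<close> describe the product of powers of linear factors by which the dependent variable
  of the lifted equation is multiplied. The factors are normalized to \<open>1\<close> at \<open>x = 0\<close>; a factor
  vanishing at \<open>x = 0\<close> is impossible, as both local solutions equal \<open>1\<close> there.
\<close>

definition quadratic_transformation :: "hl_transf \<Rightarrow> bool" where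
  "quadratic_transformation T \<longleftrightarrow>
     heun_ok (lhs T) \<and> heun_ok (rhs T) \<and> four_singular (rhs T) \<and>
     (\<exists>N D S c. let R = (\<lambda>x. poly N x / poly D x); E = pullback R (heun_ode (rhs T)) in
        coprime N D \<and> max (degree N) (degree D) = 2 \<and> poly N 0 = 0 \<and>
        critical_values N D \<subseteq> {Fin 0, Fin 1, Fin (h_a (rhs T)), Infty} \<and>
        card (sing_pts E) = 4 \<and>
        finite S \<and> 0 \<notin> S \<and>
        ode_eq (twist (\<lambda>x. \<Sum>z\<in>S. c z / (x - z)) E) (heun_ode (lhs T)) \<and>
        (\<forall>\<^sub>F x in nhds 0. arg T x = R x \<and> pref T x = (\<Prod>z\<in>S. (1 - x / z) powr c z)))"

text \<open>
  The pairs \<open>(a, a')\<close> form a curve on which \<open>a\<^sup>2 A\<^sup>2 = a'\<close> for \<open>A = (1 + a') / (2 (2 - a))\<close>.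
  This formula for \<open>A\<close> degenerates to \<open>0/0\<close> exactly at the node \<open>(2, -1)\<close> of the curve. There \<open>A\<close> is
  taken to be its limit along either of the two branches, i.e. \<open>\<i>/2\<close> or \<open>-\<i>/2\<close>.
\<close>

definition quad_params :: "complex \<Rightarrow> complex \<Rightarrow> complex \<Rightarrow> bool" where
  "quad_params a a' A \<longleftrightarrow> a \<notin> {0, 1} \<and> a' \<notin> {0, 1} \<and>
     a\<^sup>2 * (1 - a')\<^sup>2 - 16 * (1 - a) * a' = 0 \<and>
     (if a = 2 then A = \<i> / 2 \<or> A = - \<i> / 2 else A = (1 + a') / (2 * (2 - a)))"

definition quad_hl ::
  "complex \<Rightarrow> complex \<Rightarrow> complex \<Rightarrow> complex \<Rightarrow> complex \<Rightarrow> complex \<Rightarrow> hl_transf" where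
  "quad_hl a a' A q \<alpha> \<gamma> =
     HlTr (Heun a q (2 * \<alpha>) \<gamma> \<gamma> (2 * \<alpha> - \<gamma> + 1))
       (\<lambda>x. (1 - x) powr (- \<alpha>))
       (Heun a' (A * (q - \<gamma> * \<alpha> * a)) \<alpha> (\<gamma> - \<alpha>) \<gamma> (1 / 2))
       (\<lambda>x. A * (x * (a - x) / (1 - x)))"

end

theory Submission
  imports Defs "HOL-Complex_Analysis.Complex_Analysis"
begin

text \<open>
  Everything is expressed through germs at \<open>x = 0\<close>. A relation
  \<open>Hl p x = h x * Hl p' (R x)\<close> is encoded by the statement that the equation of \<open>p'\<close>, pulled back along
  \<open>R\<close> and then gauged by \<open>h\<close>, is the equation of \<open>p\<close> (\<open>local_lift\<close>). Such lifts compose, each Moebius or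
  F-homotopic generator is one, and a lift is determined by its two equations and its change of
  variable, because the coefficient of the first derivative prescribes \<open>h' / h\<close> (\<open>local_lift_unique\<close>).
  So prefactors never have to be multiplied out: only maps and equations are compared. As the
  germ \<open>Hl\<close> exists and is unique (three-term recurrence for its Taylor coefficients), a lift implies
  the identity between the functions, and the stated identity reduces to a computation with rational
  functions in the locale \<open>quad_map\<close>.

  The computation rests on the two critical points \<open>e, f\<close> of \<open>R x = A x (a - x) / (1 - x)\<close>. They satisfy
  \<open>e + f = 2\<close> and \<open>e f = a\<close>, their values are \<open>1\<close> and \<open>a'\<close>, and \<open>R - 1\<close>, \<open>R - a'\<close> are squares up to a
  constant and the denominator \<open>1 - x\<close>. Over a critical value of exponents \<open>0, 1/2\<close> the lifted exponents are
  \<open>0, 1\<close>, and no logarithm arises, so that \<open>e\<close> and \<open>f\<close> are ordinary points of the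
  lift, and what remains singular is the preimage \<open>{0, a, 1, \<infinity>}\<close> of \<open>{0, \<infinity>}\<close>.

  For the uniqueness, being a singular point in the sense of \<open>sing_pts\<close> is preserved by a local
  biholomorphism (\<open>removable_pullback\<close>). Hence each singular value of the equation that is not a
  critical value has two singular preimages. A degree-two map has exactly two critical values, there are
  four singular values and four singular points, and therefore exactly two singular values are critical;
  the preimages of the other two, which are \<open>0\<close> and some \<open>w\<close>, are the points \<open>0, 1, a, \<infinity>\<close>
  (\<open>quadratic_map_structure\<close>). A Moebius transformation on the right moves \<open>w\<close> to \<open>\<infinity>\<close>, one on the
  left moves the second zero of \<open>R\<close> to the third finite singular point and the poles to \<open>1\<close> and \<open>\<infinity>\<close>.
  Then \<open>R\<close> is \<open>A x (a - x) / (1 - x)\<close>, and the condition that \<open>1\<close> and \<open>a'\<close> are its critical values is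
  the relation between \<open>a\<close>, \<open>a'\<close> and \<open>A\<close> (\<open>normalize_target\<close>, \<open>normalize_source\<close>).

  A critical point is ordinary for the lift, up to a gauge change, only if the exponent
  difference at its value is \<open>1/2\<close> up to sign (\<open>exponents_at_critical_values\<close>); F-homotopic
  transformations make both of these exponent pairs equal to \<open>0, 1/2\<close>. The right-hand equation is then the one of
  \<open>quad_hl\<close>. The left-hand equation is gauge equivalent to that of \<open>quad_hl\<close> with the same
  singular points, and two such Heun equations differ by F-homotopic transformations only
  (\<open>gauge_equivalent_heun\<close>).
\<close>

section \<open>Gauge changes and changes of variable\<close>

text \<open>
  The local form of \<open>ode_eq\<close>. The punctured neighbourhood is what makes gauge changes with a pole
  at \<open>z\<close> and pullbacks with a ramification point at \<open>z\<close> compatible with it.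
\<close>

definition ode_eq_at :: "complex \<Rightarrow> ode2 \<Rightarrow> ode2 \<Rightarrow> bool" where
  "ode_eq_at z E1 E2 \<longleftrightarrow> (\<forall>\<^sub>F x in at z. fst E1 x = fst E2 x \<and> snd E1 x = snd E2 x)"

lemma ode_eq_at_refl [simp]: "ode_eq_at z E E"
  by (simp add: ode_eq_at_def)

lemma ode_eq_at_sym: "ode_eq_at z E F \<Longrightarrow> ode_eq_at z F E"
  unfolding ode_eq_at_def by (auto elim: eventually_mono)

lemma ode_eq_at_trans [trans]:
  assumes "ode_eq_at z E F" "ode_eq_at z F G"
  shows "ode_eq_at z E G"
  using assms unfolding ode_eq_at_def by eventually_elim simp

lemma eventually_cofinite_imp_at:
  assumes "eventually P cofinite"
  shows "eventually P (at (z :: complex))"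
proof -
  have "\<forall>\<^sub>F x in at z. x \<notin> S" if "finite S" for S
    using that by (induction S) (auto intro: eventually_conj eventually_neq_at_within)
  from this[of "{x. \<not> P x}"] show ?thesis
    using assms by (simp add: eventually_cofinite)
qed

lemma ode_eq_imp_ode_eq_at: "ode_eq E F \<Longrightarrow> ode_eq_at z E F"
  unfolding ode_eq_def ode_eq_at_def by (rule eventually_cofinite_imp_at)

lemma eventually_at_nhds:
  fixes z :: complex
  assumes "eventually P (at z)"
  shows "\<forall>\<^sub>F x in at z. eventually P (nhds x)"
proof -
  obtain S where S: "open S" "z \<in> S" "\<And>x. x \<in> S \<Longrightarrow> x \<noteq> z \<Longrightarrow> P x"
    using assms unfolding eventually_at_topological by auto
  show ?thesis
    unfolding eventually_at_topological
  proof (intro exI[of _ S] conjI ballI impI S)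
    fix x assume "x \<in> S" "x \<noteq> z"
    thus "eventually P (nhds x)"
      using S by (intro eventually_nhds_in_open[of "S - {z}" x, THEN eventually_mono]) auto
  qed
qed

text \<open>
  The coefficients of pullbacks and gauge changes involve derivatives of data that are known only near
  a point, and a punctured neighbourhood of the point is open.
\<close>

lemma eventually_deriv_eq:
  fixes f g :: "complex \<Rightarrow> complex"
  assumes "\<forall>\<^sub>F x in at z. f x = g x"
  shows "\<forall>\<^sub>F x in at z. f x = g x \<and> deriv f x = deriv g x \<and> deriv (deriv f) x = deriv (deriv g) x"
proof -
  have 1: "\<forall>\<^sub>F x in at z. deriv f x = deriv g x" if "\<forall>\<^sub>F x in at z. f x = g x" for f g :: "complex \<Rightarrow> complex"
    using eventually_at_nhds[OF that] by eventually_elim (auto intro: deriv_cong_ev)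
  from assms 1[OF assms] 1[OF 1[OF assms]] show ?thesis by eventually_elim auto
qed

lemma twist_cong:
  assumes "ode_eq_at z E F" "\<forall>\<^sub>F x in at z. L x = M x"
  shows "ode_eq_at z (twist L E) (twist M F)"
  using assms(1) eventually_deriv_eq[OF assms(2)] unfolding ode_eq_at_def twist_def
  by eventually_elim simp

lemma pullback_cong:
  assumes "ode_eq_at v E F" "\<forall>\<^sub>F x in at z. f x = g x" "filterlim f (at v) (at z)"
  shows "ode_eq_at z (pullback f E) (pullback g F)"
proof -
  have "\<forall>\<^sub>F x in at z. fst E (f x) = fst F (f x) \<and> snd E (f x) = snd F (f x)"
    using assms(1,3) unfolding ode_eq_at_def filterlim_iff by blast
  with eventually_deriv_eq[OF assms(2)] show ?thesis
    unfolding ode_eq_at_def pullback_def by eventually_elim simp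
qed

lemma analytic_at_eventually:
  assumes "f analytic_on {z :: complex}"
  shows "\<forall>\<^sub>F x in nhds z. f analytic_on {x}"
proof -
  obtain S where "open S" "z \<in> S" "f holomorphic_on S"
    using assms analytic_at by blast
  thus ?thesis
    by (intro eventually_nhds_in_open[of S z, THEN eventually_mono]) (auto simp: analytic_at)
qed

lemma analytic_at_has_deriv:
  "f analytic_on {z :: complex} \<Longrightarrow> (f has_field_derivative deriv f z) (at z)"
  using analytic_on_imp_differentiable_at[of f "{z}" z] DERIV_deriv_iff_field_differentiable by auto

lemma deriv_compose_analytic:
  assumes g: "g analytic_on {x :: complex}" and f: "f analytic_on {g x}"
  shows "\<forall>\<^sub>F y in nhds x. deriv (\<lambda>x. f (g x)) y = deriv f (g y) * deriv g y"
    and "deriv (deriv (\<lambda>x. f (g x))) x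
           = deriv (deriv f) (g x) * (deriv g x)\<^sup>2 + deriv f (g x) * deriv (deriv g) x"
proof -
  have lim: "filterlim g (nhds (g x)) (nhds x)"
    using analytic_at_imp_isCont[OF g] by (simp add: isCont_def tendsto_at_iff_tendsto_nhds)
  show *: "\<forall>\<^sub>F y in nhds x. deriv (\<lambda>x. f (g x)) y = deriv f (g y) * deriv g y"
    using analytic_at_eventually[OF g] 
      eventually_compose_filterlim[OF analytic_at_eventually[OF f] lim]
  proof eventually_elim
    case (elim y)
    from DERIV_chain2[OF analytic_at_has_deriv[OF elim(2)] analytic_at_has_deriv[OF elim(1)]]
    show ?case by (rule DERIV_imp_deriv)
  qed
  have df: "deriv f analytic_on {g x}" and dg: "deriv g analytic_on {x}"
    using f g analytic_deriv by blast+
  have "((\<lambda>y. deriv f (g y) * deriv g y) has_field_derivative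
      deriv (deriv f) (g x) * deriv g x * deriv g x + deriv (deriv g) x * deriv f (g x)) (at x)"
    by (intro DERIV_mult DERIV_chain2[of "deriv f" _ g] analytic_at_has_deriv df g dg)
  moreover have "deriv (deriv (\<lambda>x. f (g x))) x = deriv (\<lambda>y. deriv f (g y) * deriv g y) x"
    by (rule deriv_cong_ev[OF *]) simp
  ultimately show "deriv (deriv (\<lambda>x. f (g x))) x
           = deriv (deriv f) (g x) * (deriv g x)\<^sup>2 + deriv f (g x) * deriv (deriv g) x"
    by (simp add: DERIV_imp_deriv power2_eq_square mult_ac)
qed

text \<open>
  Pullback is functorial. This is what allows inserting the coordinate changes at \<open>\<infinity>\<close> on either side of a
  map, and the local inverse of a biholomorphism.
\<close>

lemma pullback_compose:
  assumes "g analytic_on {x :: complex}" "f analytic_on {g x}" "deriv g x \<noteq> 0" "deriv f (g x) \<noteq> 0"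
  shows "fst (pullback g (pullback f E)) x = fst (pullback (\<lambda>x. f (g x)) E) x \<and>
         snd (pullback g (pullback f E)) x = snd (pullback (\<lambda>x. f (g x)) E) x"
  using deriv_compose_analytic[OF assms(1,2)] assms(3,4)
  by (auto simp: pullback_def field_simps power2_eq_square dest!: eventually_nhds_x_imp_x)

text \<open>
  A gauge change by \<open>h\<close> becomes a gauge change by \<open>h \<circ> f\<close>, and \<open>L\<close> is the logarithmic derivative of \<open>h\<close>.
\<close>

lemma pullback_twist:
  assumes "f analytic_on {x :: complex}" "deriv f x \<noteq> 0" "L field_differentiable (at (f x))"
  shows "fst (pullback f (twist L E)) x = fst (twist (\<lambda>x. L (f x) * deriv f x) (pullback f E)) x \<and>
         snd (pullback f (twist L E)) x = snd (twist (\<lambda>x. L (f x) * deriv f x) (pullback f E)) x"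
proof -
  have df: "deriv f analytic_on {x}" using assms(1) analytic_deriv by blast
  have "((\<lambda>x. L (f x) * deriv f x) has_field_derivative
          deriv L (f x) * deriv f x * deriv f x + deriv (deriv f) x * L (f x)) (at x)"
    using assms df DERIV_deriv_iff_field_differentiable[of L "f x"]
    by (intro DERIV_mult DERIV_chain2[of L _ f] analytic_at_has_deriv[of f]
              analytic_at_has_deriv[of "deriv f"]) auto
  hence "deriv (\<lambda>x. L (f x) * deriv f x) x
      = deriv L (f x) * deriv f x * deriv f x + deriv (deriv f) x * L (f x)"
    by (rule DERIV_imp_deriv)
  thus ?thesis using assms(2)
    by (simp add: pullback_def twist_def field_simps power2_eq_square)
qed

lemma twist_twist:
  assumes "L field_differentiable (at x)" "M field_differentiable (at x)"
  shows "fst (twist L (twist M E)) x = fst (twist (\<lambda>x. L x + M x) E) x \<and>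
         snd (twist L (twist M E)) x = snd (twist (\<lambda>x. L x + M x) E) x"
proof -
  have "deriv (\<lambda>x. L x + M x) x = deriv L x + deriv M x"
    using assms by (simp add: deriv_add)
  thus ?thesis by (simp add: twist_def algebra_simps power2_eq_square)
qed

lemma analytic_at_filterlim_at:
  assumes "f analytic_on {z :: complex}" "deriv f z \<noteq> 0"
  shows "filterlim f (at (f z)) (at z)"
proof -
  have "\<forall>\<^sub>F x in at z. f x \<noteq> f z"
  proof -
    have "((\<lambda>x. (f x - f z) / (x - z)) \<longlongrightarrow> deriv f z) (at z)"
      using analytic_at_has_deriv[OF assms(1)] by (simp add: has_field_derivative_iff)
    from tendsto_imp_eventually_ne[OF this assms(2)] show ?thesis
      by eventually_elim auto
  qed
  thus ?thesis using analytic_at_imp_isCont[OF assms(1)]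
    by (auto simp: filterlim_at isCont_def)
qed

lemma eventually_deriv_nonzero:
  assumes "f analytic_on {z :: complex}" "deriv f z \<noteq> 0"
  shows "\<forall>\<^sub>F x in nhds z. deriv f x \<noteq> 0"
proof -
  have "isCont (deriv f) z"
    using analytic_at_imp_isCont analytic_deriv assms(1) by blast
  thus ?thesis using assms(2)
    by (simp add: isCont_def tendsto_at_iff_tendsto_nhds tendsto_imp_eventually_ne)
qed

section \<open>Removable singular points\<close>

text \<open>
  The negation of the condition by which \<open>sing_pts\<close> declares a finite point singular: some power of
  \<open>x - z\<close> turns \<open>z\<close> into an ordinary point.
\<close>

definition removable :: "ode2 \<Rightarrow> complex \<Rightarrow> bool" where
  "removable E z \<longleftrightarrow> (\<exists>c. ordinary_at (twist (\<lambda>x. c / (x - z)) E) z)"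

lemma sing_pts_iff:
  "Fin z \<in> sing_pts E \<longleftrightarrow> \<not> removable E z"
  "Infty \<in> sing_pts E \<longleftrightarrow> \<not> removable (pullback inverse E) 0"
  by (auto simp: sing_pts_def removable_def)

lemma ordinary_at_cong: "ode_eq_at z E F \<Longrightarrow> ordinary_at E z \<Longrightarrow> ordinary_at F z"
proof -
  assume a: "ode_eq_at z E F" "ordinary_at E z"
  then obtain P Q where "P analytic_on {z}" "Q analytic_on {z}" 
    and ev: "\<forall>\<^sub>F x in at z. fst E x = P x \<and> snd E x = Q x"
    unfolding ordinary_at_def by blast
  moreover have "\<forall>\<^sub>F x in at z. fst F x = P x \<and> snd F x = Q x"
    using a(1) ev unfolding ode_eq_at_def by eventually_elim auto
  ultimately show ?thesis unfolding ordinary_at_def by blast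
qed

lemma removable_cong: "ode_eq_at z E F \<Longrightarrow> removable E z \<longleftrightarrow> removable F z"
proof -
  have "removable F z" if EF: "ode_eq_at z E F" and E: "removable E z" for E F
  proof -
    obtain c where "ordinary_at (twist (\<lambda>x. c / (x - z)) E) z"
      using E unfolding removable_def by blast
    moreover have "ode_eq_at z (twist (\<lambda>x. c / (x - z)) E) (twist (\<lambda>x. c / (x - z)) F)"
      by (rule twist_cong[OF EF]) simp
    ultimately show ?thesis
      unfolding removable_def using ordinary_at_cong by blast
  qed
  thus "ode_eq_at z E F \<Longrightarrow> removable E z \<longleftrightarrow> removable F z"
    using ode_eq_at_sym by blast
qed

lemma ordinary_at_imp_removable: "ordinary_at E z \<Longrightarrow> removable E z"
  unfolding removable_def by (rule exI[of _ 0]) (simp add: twist_def)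

lemma ordinary_at_twist:
  assumes "g analytic_on {z}" "ordinary_at E z"
  shows "ordinary_at (twist g E) z"
proof -
  obtain P Q where PQ: "P analytic_on {z}" "Q analytic_on {z}" 
    and ev: "\<forall>\<^sub>F x in at z. fst E x = P x \<and> snd E x = Q x"
    using assms unfolding ordinary_at_def by blast
  have "deriv g analytic_on {z}" using assms analytic_deriv by blast
  hence "(\<lambda>x. P x - 2 * g x) analytic_on {z}"
    "(\<lambda>x. Q x - P x * g x - deriv g x + (g x)\<^sup>2) analytic_on {z}"
    using assms PQ by (auto intro!: analytic_intros)
  moreover have "\<forall>\<^sub>F x in at z. fst (twist g E) x = P x - 2 * g x \<and>
      snd (twist g E) x = Q x - P x * g x - deriv g x + (g x)\<^sup>2"
    using ev by eventually_elim (simp add: twist_def)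
  ultimately show ?thesis unfolding ordinary_at_def by blast
qed

lemma ordinary_at_pullback:
  assumes f: "f analytic_on {z}" "deriv f z \<noteq> 0" and E: "ordinary_at E (f z)"
  shows "ordinary_at (pullback f E) z"
proof -
  obtain P Q where PQ: "P analytic_on {f z}" "Q analytic_on {f z}" 
    and ev: "\<forall>\<^sub>F x in at (f z). fst E x = P x \<and> snd E x = Q x"
    using E unfolding ordinary_at_def by blast
  have d: "deriv f analytic_on {z}" "deriv (deriv f) analytic_on {z}"
    using f analytic_deriv by blast+
  have c: "(\<lambda>x. P (f x)) analytic_on {z}" "(\<lambda>x. Q (f x)) analytic_on {z}"
    using analytic_on_compose_gen[OF f(1) PQ(1)] analytic_on_compose_gen[OF f(1) PQ(2)]
    by (auto simp: o_def)
  have "(\<lambda>x. P (f x) * deriv f x - deriv (deriv f) x / deriv f x) analytic_on {z}"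
    "(\<lambda>x. Q (f x) * (deriv f x)\<^sup>2) analytic_on {z}"
    using d c f by (auto intro!: analytic_intros)
  moreover have "\<forall>\<^sub>F x in at z. fst E (f x) = P (f x) \<and> snd E (f x) = Q (f x)"
    using eventually_compose_filterlim[OF ev analytic_at_filterlim_at[OF f]] .
  hence "\<forall>\<^sub>F x in at z. fst (pullback f E) x = P (f x) * deriv f x - deriv (deriv f) x / deriv f x \<and>
      snd (pullback f E) x = Q (f x) * (deriv f x)\<^sup>2"
    by eventually_elim (simp add: pullback_def)
  ultimately show ?thesis unfolding ordinary_at_def by blast
qed

lemma eventually_differentiable_pole:
  assumes "g analytic_on {z :: complex}"
  shows "\<forall>\<^sub>F x in at z. (\<lambda>x. c / (x - z) + g x) field_differentiable (at x)"
proof -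
  have "\<forall>\<^sub>F x in at z. g analytic_on {x}"
    using analytic_at_eventually[OF assms] by (simp add: eventually_nhds_conv_at)
  thus ?thesis using eventually_neq_at_within[of z z UNIV]
  proof eventually_elim
    case (elim x)
    hence "(\<lambda>x. c / (x - z) + g x) analytic_on {x}" by (auto intro!: analytic_intros)
    thus ?case using analytic_on_imp_differentiable_at by blast
  qed
qed

lemma twist_twist_at:
  assumes "\<forall>\<^sub>F x in at z. L field_differentiable (at x)" "\<forall>\<^sub>F x in at z. M field_differentiable (at x)"
  shows "ode_eq_at z (twist L (twist M E)) (twist (\<lambda>x. L x + M x) E)"
  using assms unfolding ode_eq_at_def by eventually_elim (rule twist_twist)

text \<open>
  A gauge change whose logarithmic derivative has at most a simple pole at \<open>z\<close> multiplies the
  dependent variable by a power of \<open>x - z\<close>, which is absorbed in the definition, and by an analytic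
  unit, which keeps ordinary points ordinary.
\<close>

lemma removable_twist:
  assumes g: "g analytic_on {z}" and E: "removable E z"
  shows "removable (twist (\<lambda>x. c / (x - z) + g x) E) z"
proof -
  obtain k where k: "ordinary_at (twist (\<lambda>x. k / (x - z)) E) z"
    using E unfolding removable_def by blast
  note dp = eventually_differentiable_pole
  have "ode_eq_at z (twist g (twist (\<lambda>x. k / (x - z)) E)) (twist (\<lambda>x. g x + k / (x - z)) E)"
    using dp[OF g, of 0] dp[of "\<lambda>_. 0" z k] by (intro twist_twist_at) auto
  also have "(\<lambda>x. g x + k / (x - z)) = (\<lambda>x. (k - c) / (x - z) + (c / (x - z) + g x))"
    by (simp add: fun_eq_iff diff_divide_distrib)
  also have "ode_eq_at z (twist \<dots> E)
     (twist (\<lambda>x. (k - c) / (x - z)) (twist (\<lambda>x. c / (x - z) + g x) E))"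
    using dp[OF g, of c] dp[of "\<lambda>_. 0" z "k - c"] 
    by (intro ode_eq_at_sym[OF twist_twist_at]) auto
  finally have "ode_eq_at z (twist g (twist (\<lambda>x. k / (x - z)) E))
      (twist (\<lambda>x. (k - c) / (x - z)) (twist (\<lambda>x. c / (x - z) + g x) E))" .
  from ordinary_at_cong[OF this ordinary_at_twist[OF g k]] show ?thesis 
    unfolding removable_def by (rule exI)
qed

text \<open>
  Write \<open>f x - f z = (x - z) h x\<close> with \<open>h z \<noteq> 0\<close>; then \<open>g = h' / h\<close>.
\<close>

lemma log_deriv_split:
  assumes f: "f analytic_on {z :: complex}" "deriv f z \<noteq> 0"
  obtains g where "g analytic_on {z}" 
    "\<forall>\<^sub>F x in at z. deriv f x / (f x - f z) = 1 / (x - z) + g x"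
proof -
  obtain S where S: "open S" "z \<in> S" "f holomorphic_on S"
    using f analytic_at by blast
  define h where "h x = (if x = z then deriv f z else (f x - f z) / (x - z))" for x
  have h: "h holomorphic_on S"
    unfolding h_def using pole_lemma_open[OF S(3,1), of z] by simp
  have feq: "f x = f z + (x - z) * h x" for x
    by (simp add: h_def)
  have "h analytic_on {z}" using h S analytic_at by blast
  moreover have "h z \<noteq> 0" using f by (simp add: h_def)
  ultimately have "(\<lambda>x. deriv h x / h x) analytic_on {z}"
    using analytic_deriv by (auto intro!: analytic_intros)
  moreover have "\<forall>\<^sub>F x in at z. h x \<noteq> 0"
    using \<open>h analytic_on {z}\<close> \<open>h z \<noteq> 0\<close> by (rule analytic_at_neq_imp_eventually_neq)
  hence "\<forall>\<^sub>F x in at z. deriv f x / (f x - f z) = 1 / (x - z) + deriv h x / h x"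
    using eventually_at_in_open[OF S(1,2)]
  proof eventually_elim
    case (elim x)
    hence "(h has_field_derivative deriv h x) (at x)"
      using holomorphic_derivI[OF h S(1), of x] by auto
    hence "((\<lambda>x. f z + (x - z) * h x) has_field_derivative h x + (x - z) * deriv h x) (at x)"
      by (auto intro!: derivative_eq_intros)
    hence "deriv f x = h x + (x - z) * deriv h x"
      using feq by (metis (no_types, lifting) DERIV_imp_deriv ext)
    moreover have "f x - f z = (x - z) * h x" using feq[of x] by simp
    ultimately show ?case using elim by (simp only:) (simp add: divide_simps)
  qed
  ultimately show thesis using that by blast
qed

text \<open>
  The power of \<open>y - f z\<close> that removes the singularity downstairs pulls back to a power of
  \<open>x - z\<close> times an analytic unit.
\<close>

lemma removable_pullback_imp:
  assumes f: "f analytic_on {z}" "deriv f z \<noteq> 0" and E: "removable E (f z)"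
  shows "removable (pullback f E) z"
proof -
  obtain c where c: "ordinary_at (twist (\<lambda>y. c / (y - f z)) E) (f z)"
    using E unfolding removable_def by blast
  obtain g where g: "g analytic_on {z}" 
    "\<forall>\<^sub>F x in at z. deriv f x / (f x - f z) = 1 / (x - z) + g x"
    using log_deriv_split[OF f] .
  let ?L = "\<lambda>y. c / (y - f z)"
  have lim: "filterlim f (at (f z)) (at z)" by (rule analytic_at_filterlim_at[OF f])
  have fx: "\<forall>\<^sub>F x in at z. f analytic_on {x}" "\<forall>\<^sub>F x in at z. deriv f x \<noteq> 0"
    using analytic_at_eventually[OF f(1)] eventually_deriv_nonzero[OF f]
    by (simp_all add: eventually_nhds_conv_at)
  have "\<forall>\<^sub>F x in at z. ?L field_differentiable (at (f x))"
    using eventually_compose_filterlim[OF 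
        eventually_differentiable_pole[of "\<lambda>_. 0" "f z" c] lim] by simp
  with fx have "ode_eq_at z (pullback f (twist ?L E)) (twist (\<lambda>x. ?L (f x) * deriv f x) (pullback f E))"
    unfolding ode_eq_at_def by eventually_elim (rule pullback_twist)
  also have "ode_eq_at z \<dots> (twist (\<lambda>x. c / (x - z) + c * g x) (pullback f E))"
  proof (rule twist_cong[OF ode_eq_at_refl], use g(2) in eventually_elim)
    case (elim x)
    have "?L (f x) * deriv f x = c * (deriv f x / (f x - f z))" by simp
    thus ?case unfolding elim by (simp add: distrib_left)
  qed
  finally have "ordinary_at (twist (\<lambda>x. c / (x - z) + c * g x) (pullback f E)) z"
    using ordinary_at_cong ordinary_at_pullback[OF f c] by blast
  hence "removable (twist (\<lambda>x. c / (x - z) + c * g x) (pullback f E)) z"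
    by (rule ordinary_at_imp_removable)
  hence "removable (twist (\<lambda>x. - c / (x - z) + - c * g x)
           (twist (\<lambda>x. c / (x - z) + c * g x) (pullback f E))) z"
    using g(1) by (intro removable_twist[of "\<lambda>x. - c * g x"] analytic_intros)
  moreover have "ode_eq_at z (twist (\<lambda>x. - c / (x - z) + - c * g x)
           (twist (\<lambda>x. c / (x - z) + c * g x) (pullback f E)))
       (twist (\<lambda>x. (- c / (x - z) + - c * g x) + (c / (x - z) + c * g x)) (pullback f E))"
    using g(1) by (intro twist_twist_at eventually_differentiable_pole analytic_intros)
  moreover have "twist (\<lambda>x. (- c / (x - z) + - c * g x) + (c / (x - z) + c * g x)) (pullback f E)
      = pullback f E"
    by (simp add: twist_def)
  ultimately show ?thesis using removable_cong by metis
qed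

text \<open>
  The converse of the previous lemma is that lemma for the local inverse of \<open>f\<close>.
\<close>

lemma removable_pullback:
  assumes f: "f analytic_on {z}" "deriv f z \<noteq> 0"
  shows "removable (pullback f E) z \<longleftrightarrow> removable E (f z)"
proof
  assume rem: "removable (pullback f E) z"
  obtain S where S: "open S" "z \<in> S" "f holomorphic_on S"
    using f analytic_at by blast
  \<comment> \<open>\<open>g\<close> is the local inverse of \<open>f\<close>; pulling back along \<open>f\<close> and then along \<open>g\<close> changes nothing.\<close>
  obtain r where r: "r > 0" "ball z r \<subseteq> S" "open (f ` ball z r)" "inj_on f (ball z r)"
    using has_complex_derivative_locally_invertible[OF S(3,2,1) f(2)] .
  obtain g where g: "g holomorphic_on (f ` ball z r)" 
     "\<And>x. x \<in> ball z r \<Longrightarrow> deriv f x * deriv g (f x) = 1"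
     "\<And>x. x \<in> ball z r \<Longrightarrow> g (f x) = x"
    using holomorphic_has_inverse[OF holomorphic_on_subset[OF S(3) r(2)] open_ball r(4)] by blast
  have gz: "g (f z) = z" "f z \<in> f ` ball z r" using r g by auto
  have ga: "g analytic_on {f z}" "deriv g (f z) \<noteq> 0"
    using g(1) r(3) gz(2) analytic_at[of g "f z"] g(2)[of z] r(1) by fastforce+
  have "removable (pullback g (pullback f E)) (f z)"
    using removable_pullback_imp[OF ga, of "pullback f E"] rem gz by simp
  moreover have "ode_eq_at (f z) (pullback g (pullback f E)) (pullback (\<lambda>y. f (g y)) E)"
    unfolding ode_eq_at_def using eventually_at_in_open[OF r(3) gz(2)]
  proof eventually_elim
    case (elim y)
    then obtain x where x: "x \<in> ball z r" "y = f x" by auto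
    have "g analytic_on {y}" using g(1) r(3) elim analytic_at by blast
    moreover have "f analytic_on {g y}" using x g(3)[OF x(1)] S(1,3) r(2) analytic_at[of f x] by auto
    ultimately show ?case using g(2)[OF x(1)] g(3)[OF x(1)] x
      by (intro pullback_compose) auto
  qed
  moreover have "ode_eq_at (f z) (pullback (\<lambda>y. f (g y)) E) (pullback (\<lambda>y. y) E)"
  proof (rule pullback_cong[OF ode_eq_at_refl])
    show *: "\<forall>\<^sub>F y in at (f z). f (g y) = y"
      using eventually_at_in_open[OF r(3) gz(2)] by eventually_elim (use g(3) in auto)
    show "filterlim (\<lambda>y. f (g y)) (at (f z)) (at (f z))"
      using filterlim_cong[OF refl refl *, of "at (f z)"] by (simp add: filterlim_ident)
  qed
  moreover have "pullback (\<lambda>y. y) E = E"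
    by (simp add: pullback_def)
  ultimately show "removable E (f z)" using removable_cong by metis
qed (rule removable_pullback_imp[OF f])

section \<open>Lifts of Heun equations as germs at the origin\<close>

definition solves :: "ode2 \<Rightarrow> (complex \<Rightarrow> complex) \<Rightarrow> complex \<Rightarrow> bool" where
  "solves E u x \<longleftrightarrow> deriv (deriv u) x + fst E x * deriv u x + snd E x * u x = 0"

text \<open>
  This and \<open>solves_twist\<close> justify the formulas by which \<open>pullback\<close> and \<open>twist\<close> are defined.
\<close>

lemma solves_pullback:
  assumes "f analytic_on {x}" "deriv f x \<noteq> 0" "u analytic_on {f x}" "solves E u (f x)"
  shows "solves (pullback f E) (\<lambda>x. u (f x)) x"
proof -
  have 1: "deriv (\<lambda>x. u (f x)) x = deriv u (f x) * deriv f x"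
    using deriv_compose_analytic(1)[OF assms(1,3)] by (rule eventually_nhds_x_imp_x)
  have 2: "deriv (deriv u) (f x) = - fst E (f x) * deriv u (f x) - snd E (f x) * u (f x)"
    using assms(4) unfolding solves_def by algebra
  thus ?thesis using assms(2)
    unfolding solves_def pullback_def deriv_compose_analytic(2)[OF assms(1,3)] 1 2 fst_conv snd_conv
    by (simp add: field_simps power2_eq_square)
qed

lemma deriv_log_deriv:
  assumes "h analytic_on {x :: complex}" "h x \<noteq> 0"
  shows "deriv (\<lambda>x. deriv h x / h x) x = deriv (deriv h) x / h x - (deriv h x / h x)\<^sup>2"
proof -
  have "deriv h analytic_on {x}" using assms analytic_deriv by blast
  from DERIV_divide[OF analytic_at_has_deriv[OF this] analytic_at_has_deriv[OF assms(1)] assms(2)]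
  show ?thesis using assms(2)
    by (simp add: DERIV_imp_deriv field_simps power2_eq_square)
qed

lemma solves_twist:
  assumes h: "h analytic_on {x}" "h x \<noteq> 0" and u: "u analytic_on {x}" and s: "solves E u x"
  shows "solves (twist (\<lambda>x. deriv h x / h x) E) (\<lambda>x. h x * u x) x"
proof -
  have d: "deriv h analytic_on {x}" "deriv u analytic_on {x}" using h u analytic_deriv by blast+
  have *: "\<forall>\<^sub>F y in nhds x. deriv (\<lambda>x. h x * u x) y = h y * deriv u y + deriv h y * u y"
    using analytic_at_eventually[OF h(1)] analytic_at_eventually[OF u]
    by eventually_elim (auto intro!: deriv_mult analytic_on_imp_differentiable_at)
  have "deriv (deriv (\<lambda>x. h x * u x)) x = deriv (\<lambda>y. h y * deriv u y + deriv h y * u y) x"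
    by (rule deriv_cong_ev[OF *]) simp
  also have "\<dots> = h x * deriv (deriv u) x + 2 * (deriv h x * deriv u x) + deriv (deriv h) x * u x"
    by (rule DERIV_imp_deriv) 
       (auto intro!: derivative_eq_intros analytic_at_has_deriv h u d simp: algebra_simps)
  finally have 2: "deriv (deriv (\<lambda>x. h x * u x)) x
      = h x * deriv (deriv u) x + 2 * (deriv h x * deriv u x) + deriv (deriv h) x * u x" .
  have 1: "deriv (\<lambda>x. h x * u x) x = h x * deriv u x + deriv h x * u x"
    using * by (rule eventually_nhds_x_imp_x)
  have s': "deriv (deriv u) x = - fst E x * deriv u x - snd E x * u x"
    using s unfolding solves_def by algebra
  show ?thesis using h(2)
    unfolding solves_def twist_def 1 2 fst_conv snd_conv deriv_log_deriv[OF h] s'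
    by (simp add: field_simps power2_eq_square)
qed

text \<open>
  The gauge \<open>pref T\<close> is normalized at \<open>0\<close>, and the change of variable is a local coordinate at \<open>0\<close>, so
  that analytic solutions equal to \<open>1\<close> at the origin correspond to each other.
\<close>

definition local_lift :: "hl_transf \<Rightarrow> bool" where
  "local_lift T \<longleftrightarrow> arg T analytic_on {0} \<and> arg T 0 = 0 \<and> deriv (arg T) 0 \<noteq> 0 \<and>
     pref T analytic_on {0} \<and> pref T 0 = 1 \<and>
     ode_eq_at 0 (twist (\<lambda>x. deriv (pref T) x / pref T x) (pullback (arg T) (heun_ode (rhs T))))
       (heun_ode (lhs T))"

lemma local_lift_filterlim:
  assumes "local_lift T"
  shows "filterlim (arg T) (at 0) (at 0)" "filterlim (arg T) (nhds 0) (nhds 0)"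
proof -
  show "filterlim (arg T) (at 0) (at 0)"
    using analytic_at_filterlim_at[of "arg T" 0] assms by (simp add: local_lift_def)
  show "filterlim (arg T) (nhds 0) (nhds 0)"
    using analytic_at_imp_isCont[of "arg T" 0] assms 
    by (simp add: local_lift_def isCont_def tendsto_at_iff_tendsto_nhds)
qed

lemma eventually_analytic_nonzero:
  assumes "h analytic_on {z :: complex}" "h z \<noteq> 0"
  shows "\<forall>\<^sub>F x in nhds z. h analytic_on {x} \<and> h x \<noteq> 0"
proof -
  have "\<forall>\<^sub>F x in nhds z. h x \<noteq> 0"
    using analytic_at_neq_imp_eventually_neq[OF assms] assms(2) eventually_nhds_conv_at by blast
  with analytic_at_eventually[OF assms(1)] show ?thesis by eventually_elim auto
qed

text \<open>
  The logarithmic derivatives of the two prefactors add up after the chain rule.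
\<close>

lemma local_lift_comp:
  assumes T: "local_lift T" and U: "local_lift U" and TU: "rhs T = lhs U"
  shows "local_lift (hl_comp T U)"
proof -
  define f g h k where "f = arg T" "g = arg U" "h = pref T" "k = pref U"
  note fghk = this
  define E where "E = heun_ode (rhs U)"
  let ?LT = "\<lambda>x. deriv h x / h x" and ?LU = "\<lambda>x. deriv k x / k x"
  have t: "f analytic_on {0}" "f 0 = 0" "deriv f 0 \<noteq> 0" "h analytic_on {0}" "h 0 = 1"
     "ode_eq_at 0 (twist ?LT (pullback f (heun_ode (lhs U)))) (heun_ode (lhs T))"
    using T by (auto simp: local_lift_def fghk TU)
  have u: "g analytic_on {0}" "g 0 = 0" "deriv g 0 \<noteq> 0" "k analytic_on {0}" "k 0 = 1"
     "ode_eq_at 0 (twist ?LU (pullback g E)) (heun_ode (lhs U))"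
    using U by (auto simp: local_lift_def fghk E_def)
  note lim = local_lift_filterlim(1)[OF T, folded fghk]
  note lim' = local_lift_filterlim(2)[OF T, folded fghk]
  have gf: "(\<lambda>x. g (f x)) analytic_on {0}" and kf: "(\<lambda>x. k (f x)) analytic_on {0}"
    using analytic_on_compose_gen[OF t(1)] u t by (auto simp: o_def)
  have evf: "\<forall>\<^sub>F x in nhds 0. f analytic_on {x} \<and> deriv f x \<noteq> 0"
    using analytic_at_eventually[OF t(1)] eventually_deriv_nonzero[OF t(1,3)] by eventually_elim auto
  have evg: "\<forall>\<^sub>F x in nhds 0. g analytic_on {f x} \<and> deriv g (f x) \<noteq> 0"
    using eventually_compose_filterlim[OF analytic_at_eventually[OF u(1)] lim']
      eventually_compose_filterlim[OF eventually_deriv_nonzero[OF u(1,3)] lim'] by eventually_elim auto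
  have evh: "\<forall>\<^sub>F x in nhds 0. h analytic_on {x} \<and> h x \<noteq> 0"
    using eventually_analytic_nonzero t by simp
  have evk: "\<forall>\<^sub>F x in nhds 0. k analytic_on {f x} \<and> k (f x) \<noteq> 0"
    using eventually_compose_filterlim[OF eventually_analytic_nonzero lim'] u by simp
  note ev = evf evg evh evk
  note ev' = ev[unfolded eventually_nhds_conv_at, THEN conjunct1]
  have Ldiff: "(\<lambda>x. deriv h x / h x) field_differentiable (at x)" 
    if "h analytic_on {x} \<and> h x \<noteq> 0" for h and x :: complex
    using that analytic_deriv[of h "{x}"] 
    by (intro analytic_on_imp_differentiable_at[of _ "{x}"] analytic_intros) auto
  have "ode_eq_at 0 (pullback f (heun_ode (lhs U))) (pullback f (twist ?LU (pullback g E)))"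
    using t(2) lim by (intro pullback_cong[OF ode_eq_at_sym[OF u(6)]]) auto
  also have "ode_eq_at 0 \<dots> (twist (\<lambda>x. ?LU (f x) * deriv f x) (pullback f (pullback g E)))"
    unfolding ode_eq_at_def using ev'
    by eventually_elim (intro pullback_twist Ldiff, auto)
  also have "ode_eq_at 0 \<dots> (twist (\<lambda>x. ?LU (f x) * deriv f x) (pullback (\<lambda>x. g (f x)) E))"
  proof (rule twist_cong)
    show "ode_eq_at 0 (pullback f (pullback g E)) (pullback (\<lambda>x. g (f x)) E)"
      unfolding ode_eq_at_def using ev' by eventually_elim (intro pullback_compose, auto)
  qed auto
  finally have "ode_eq_at 0 (twist ?LT (pullback f (heun_ode (lhs U))))
      (twist ?LT (twist (\<lambda>x. ?LU (f x) * deriv f x) (pullback (\<lambda>x. g (f x)) E)))"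
    by (intro twist_cong) auto
  also have "ode_eq_at 0 \<dots> (twist (\<lambda>x. ?LT x + ?LU (f x) * deriv f x) (pullback (\<lambda>x. g (f x)) E))"
    unfolding ode_eq_at_def using ev'
  proof eventually_elim
    case (elim x)
    have "?LU analytic_on {f x}"
      using elim analytic_deriv[of k "{f x}"] by (intro analytic_intros) auto
    hence "(\<lambda>x. ?LU (f x)) analytic_on {x}"
      using elim analytic_on_compose_gen[of f "{x}" "?LU" "{f x}"] by (simp add: o_def)
    hence "(\<lambda>x. ?LU (f x) * deriv f x) analytic_on {x}"
      using elim analytic_deriv[of f "{x}"] by (intro analytic_on_mult) auto
    thus ?case using elim
      by (intro twist_twist Ldiff analytic_on_imp_differentiable_at[of _ "{x}"]) auto
  qed
  also have "ode_eq_at 0 \<dots> (twist (\<lambda>x. deriv (\<lambda>x. h x * k (f x)) x / (h x * k (f x))) (pullback (\<lambda>x. g (f x)) E))"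
  proof (rule twist_cong)
    show "\<forall>\<^sub>F x in at 0. ?LT x + ?LU (f x) * deriv f x = deriv (\<lambda>x. h x * k (f x)) x / (h x * k (f x))"
      using ev'
    proof eventually_elim
      case (elim x)
      have "deriv (\<lambda>x. h x * k (f x)) x = h x * (deriv k (f x) * deriv f x) + deriv h x * k (f x)"
        using elim by (intro DERIV_imp_deriv DERIV_mult' DERIV_chain2[of k _ f] analytic_at_has_deriv) auto
      thus ?case using elim by (simp add: field_simps)
    qed
  qed auto
  finally have eq: "ode_eq_at 0 (heun_ode (lhs T)) (twist (\<lambda>x. deriv (\<lambda>x. h x * k (f x)) x / (h x * k (f x))) (pullback (\<lambda>x. g (f x)) E))"
    using t(6) ode_eq_at_sym ode_eq_at_trans by blast
  have "deriv (\<lambda>x. g (f x)) 0 = deriv g (f 0) * deriv f 0"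
    using u(1) t(1,2) by (intro DERIV_imp_deriv DERIV_chain2[of g _ f] analytic_at_has_deriv) auto
  thus ?thesis
    using t u gf kf ode_eq_at_sym[OF eq] unfolding local_lift_def hl_comp_def
    by (auto simp flip: fghk E_def intro!: analytic_intros)
qed

lemma is_Hl_lift:
  assumes T: "local_lift T" and u: "is_Hl (rhs T) u"
  shows "is_Hl (lhs T) (\<lambda>x. pref T x * u (arg T x))"
proof -
  define f h where "f = arg T" "h = pref T"
  note fh = this
  have t: "f analytic_on {0}" "f 0 = 0" "deriv f 0 \<noteq> 0" "h analytic_on {0}" "h 0 = 1"
     "ode_eq_at 0 (twist (\<lambda>x. deriv h x / h x) (pullback f (heun_ode (rhs T)))) (heun_ode (lhs T))"
    using T by (auto simp: local_lift_def fh)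
  note lim = local_lift_filterlim(1)[OF T, folded fh]
  note lim' = local_lift_filterlim(2)[OF T, folded fh]
  have u': "u analytic_on {0}" "u 0 = 1" "\<forall>\<^sub>F x in at 0. solves (heun_ode (rhs T)) u x"
    using u by (auto simp: is_Hl_def solves_def)
  have "\<forall>\<^sub>F x in nhds 0. f analytic_on {x}" "\<forall>\<^sub>F x in nhds 0. deriv f x \<noteq> 0"
    "\<forall>\<^sub>F x in nhds 0. u analytic_on {f x}" "\<forall>\<^sub>F x in nhds 0. h analytic_on {x} \<and> h x \<noteq> 0"
    using analytic_at_eventually[OF t(1)] eventually_deriv_nonzero[OF t(1,3)]
      eventually_compose_filterlim[OF analytic_at_eventually[OF u'(1)] lim']
      eventually_analytic_nonzero[OF t(4)] t(5) by simp_all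
  note ev = this[unfolded eventually_nhds_conv_at, THEN conjunct1]
  have "\<forall>\<^sub>F x in at 0. solves (heun_ode (lhs T)) (\<lambda>x. h x * u (f x)) x"
    using eventually_compose_filterlim[OF u'(3) lim] t(6)[unfolded ode_eq_at_def] ev
  proof eventually_elim
    case (elim x)
    have "(\<lambda>x. u (f x)) analytic_on {x}"
      using elim analytic_on_compose_gen[of f "{x}" u "{f x}"] by (auto simp: o_def)
    hence "solves (twist (\<lambda>x. deriv h x / h x) (pullback f (heun_ode (rhs T)))) (\<lambda>x. h x * u (f x)) x"
      using elim by (intro solves_twist solves_pullback) auto
    thus ?case using elim by (simp add: solves_def)
  qed
  moreover have "(\<lambda>x. u (f x)) analytic_on {0}"
    using analytic_on_compose_gen[OF t(1) u'(1)] t by (auto simp: o_def)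
  ultimately show ?thesis using t u'
    by (auto simp: is_Hl_def solves_def fh intro!: analytic_intros)
qed

text \<open>
  The coefficient of the first derivative of a lifted equation determines the logarithmic derivative of
  the prefactor, hence the prefactor, which is \<open>1\<close> at the origin.
\<close>

lemma local_lift_unique:
  assumes T: "local_lift T" and U: "local_lift U" 
    and eq: "lhs T = lhs U" "rhs T = rhs U" "\<forall>\<^sub>F x in nhds 0. arg T x = arg U x"
  shows "hl_eq T U"
proof -
  define h k where "h = pref T" "k = pref U"
  note hk = this
  have hk0: "h analytic_on {0}" "h 0 = 1" "k analytic_on {0}" "k 0 = 1"
    using T U by (auto simp: local_lift_def hk)
  define ET where "ET = pullback (arg T) (heun_ode (rhs T))"
  define EU where "EU = pullback (arg U) (heun_ode (rhs U))"
  have "ode_eq_at 0 ET EU"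
    unfolding ET_def EU_def eq(2)
    using eq(3) eventually_nhds_conv_at local_lift_filterlim(1)[OF T]
    by (intro pullback_cong[OF ode_eq_at_refl]) auto
  moreover have "ode_eq_at 0 (twist (\<lambda>x. deriv h x / h x) ET) (twist (\<lambda>x. deriv k x / k x) EU)"
    using T U eq ode_eq_at_sym ode_eq_at_trans unfolding local_lift_def ET_def EU_def hk by metis
  ultimately have L: "\<forall>\<^sub>F x in at 0. deriv h x / h x = deriv k x / k x"
    unfolding ode_eq_at_def by eventually_elim (simp add: twist_def, metis mult_cancel_left times_divide_eq_right zero_neq_numeral)
  have "\<forall>\<^sub>F x in nhds 0. h analytic_on {x} \<and> h x \<noteq> 0" "\<forall>\<^sub>F x in nhds 0. k analytic_on {x} \<and> k x \<noteq> 0"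
    using eventually_analytic_nonzero hk0 by auto
  hence "\<forall>\<^sub>F x in nhds 0. h analytic_on {x} \<and> h x \<noteq> 0 \<and> k analytic_on {x} \<and> k x \<noteq> 0 \<and> 
      (x \<noteq> 0 \<longrightarrow> deriv h x / h x = deriv k x / k x)"
    using L[unfolded eventually_at_filter] by eventually_elim auto
  then obtain r where r: "r > 0" "\<And>x. dist x 0 < r \<Longrightarrow> h analytic_on {x} \<and> h x \<noteq> 0 \<and> k analytic_on {x} \<and> k x \<noteq> 0 \<and> 
      (x \<noteq> 0 \<longrightarrow> deriv h x / h x = deriv k x / k x)"
    unfolding eventually_nhds_metric by blast
  \<comment> \<open>The Wronskian of the two prefactors vanishes off the origin, hence by continuity also there.\<close>
  define W where "W x = deriv h x * k x - h x * deriv k x" for x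
  have "W analytic_on {0}"
    unfolding W_def using hk0 analytic_deriv by (auto intro!: analytic_intros)
  hence "(W \<longlongrightarrow> W 0) (at 0)" using analytic_at_imp_isCont isCont_def by blast
  moreover have W: "W x = 0" if "x \<noteq> 0" "dist x 0 < r" for x
    using r(2)[OF that(2)] that(1) by (auto simp: W_def field_simps)
  have "\<forall>\<^sub>F x in at 0. 0 = W x"
    using W r(1) unfolding eventually_at by (metis UNIV_I)
  hence "(W \<longlongrightarrow> 0) (at 0)" by (rule tendsto_eventually[OF eventually_mono]) simp
  ultimately have "W 0 = 0" using tendsto_unique by (metis trivial_limit_at)
  with W have W: "W x = 0" if "dist x 0 < r" for x using that by metis
  have "h x / k x = 1" if "x \<in> ball 0 r" for x
  proof -
    have "(\<lambda>x. h x / k x) constant_on (ball 0 r)"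
    proof (rule has_field_derivative_0_imp_constant_on)
      fix z :: complex assume "z \<in> ball 0 r"
      note rz = r(2)[of z]
      have z: "dist z 0 < r" using \<open>z \<in> ball 0 r\<close> by (simp add: dist_commute)
      have "((\<lambda>x. h x / k x) has_field_derivative (deriv h z * k z - h z * deriv k z) / (k z * k z)) (at z)"
        using rz[OF z] by (intro DERIV_divide analytic_at_has_deriv) auto
      thus "((\<lambda>x. h x / k x) has_field_derivative 0) (at z)"
        using W[OF z] by (simp add: W_def mult_ac)
    qed auto
    thus ?thesis using r(1) that hk0 unfolding constant_on_def 
      by (metis centre_in_ball div_by_1)
  qed
  moreover have "\<forall>\<^sub>F x in nhds 0. x \<in> ball (0 :: complex) r"
    using r(1) by (intro eventually_nhds_in_open) auto
  ultimately have "\<forall>\<^sub>F x in nhds 0. h x = k x"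
    using r(2) by (elim eventually_mono) (auto simp: dist_commute)
  with eq show ?thesis unfolding hl_eq_def hk by (auto intro: eventually_conj)
qed

section \<open>The local Heun solution\<close>

text \<open>
  After multiplication by \<open>x (x - 1) (x - a)\<close> the Heun equation has polynomial coefficients, and
  \<open>- heun_t p\<close> is the coefficient of \<open>x\<close> in the factor of the first derivative. Comparing coefficients
  of \<open>x ^ n\<close> gives the recurrence \<open>w\<^sub>n c\<^sub>n\<^sub>+\<^sub>1 = u\<^sub>n c\<^sub>n - v\<^sub>n c\<^sub>n\<^sub>-\<^sub>1\<close> with \<open>c\<^sub>-\<^sub>1 = 0\<close> for a power series solution, in which
  \<open>w\<^sub>n\<close> never vanishes because \<open>\<gamma>\<close> is not a nonpositive integer.
\<close>

definition heun_t :: "heun \<Rightarrow> complex" where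
  "heun_t p = h_ga p * (1 + h_a p) + h_de p * h_a p + h_ep p"
definition heun_u :: "heun \<Rightarrow> nat \<Rightarrow> complex" where
  "heun_u p n = (1 + h_a p) * of_nat n * (of_nat n - 1) + heun_t p * of_nat n + h_q p"
definition heun_v :: "heun \<Rightarrow> nat \<Rightarrow> complex" where
  "heun_v p n = (of_nat n - 1 + h_al p) * (of_nat n - 1 + h_be p)"
definition heun_w :: "heun \<Rightarrow> nat \<Rightarrow> complex" where
  "heun_w p n = h_a p * (of_nat n + 1) * (of_nat n + h_ga p)"

fun heun_coeff :: "heun \<Rightarrow> nat \<Rightarrow> complex" where
  "heun_coeff p 0 = 1"
| "heun_coeff p (Suc 0) = heun_u p 0 / heun_w p 0"
| "heun_coeff p (Suc (Suc n)) =
     (heun_u p (Suc n) * heun_coeff p (Suc n) - heun_v p (Suc n) * heun_coeff p n) / heun_w p (Suc n)"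

lemma nonpos_Ints_plus_nat: "(g :: complex) \<notin> \<int>\<^sub>\<le>\<^sub>0 \<Longrightarrow> of_nat n + g \<noteq> 0"
  using plus_of_nat_eq_0_imp[of g n] by (auto simp: add.commute)

lemma heun_w_nonzero: "heun_ok p \<Longrightarrow> heun_w p n \<noteq> 0"
  using nonpos_Ints_plus_nat[of "h_ga p" n] of_nat_neq_0[of n, where 'a = complex]
  by (auto simp: heun_w_def heun_ok_def add.commute)

text \<open>
  The polynomial form of the Heun operator, acting on formal power series.
\<close>

definition heun_op :: "heun \<Rightarrow> complex fps \<Rightarrow> complex fps" where
  "heun_op p F =
     fps_X * (fps_X * (fps_X * fps_deriv (fps_deriv F)))
     - fps_const (1 + h_a p) * (fps_X * (fps_X * fps_deriv (fps_deriv F)))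
     + fps_const (h_a p) * (fps_X * fps_deriv (fps_deriv F))
     + fps_const (h_al p + h_be p + 1) * (fps_X * (fps_X * fps_deriv F))
     - fps_const (heun_t p) * (fps_X * fps_deriv F)
     + fps_const (h_ga p * h_a p) * fps_deriv F
     + fps_const (h_al p * h_be p) * (fps_X * F)
     - fps_const (h_q p) * F"

lemma heun_op_nth:
  "fps_nth (heun_op p F) 0 = heun_w p 0 * fps_nth F (Suc 0) - heun_u p 0 * fps_nth F 0"
  "fps_nth (heun_op p F) (Suc n) = heun_w p (Suc n) * fps_nth F (Suc (Suc n))
      - heun_u p (Suc n) * fps_nth F (Suc n) + heun_v p (Suc n) * fps_nth F n"
proof -
  show "fps_nth (heun_op p F) 0 = heun_w p 0 * fps_nth F (Suc 0) - heun_u p 0 * fps_nth F 0"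
    by (simp add: heun_op_def heun_w_def heun_u_def)
  show "fps_nth (heun_op p F) (Suc n) = heun_w p (Suc n) * fps_nth F (Suc (Suc n))
      - heun_u p (Suc n) * fps_nth F (Suc n) + heun_v p (Suc n) * fps_nth F n"
  proof (cases n)
    case 0
    show ?thesis unfolding 0
      by (simp add: heun_op_def) (simp add: heun_w_def heun_u_def heun_v_def algebra_simps)
  next
    case (Suc m)
    show ?thesis unfolding Suc
      by (cases m; simp add: heun_op_def)
         (simp_all add: heun_w_def heun_u_def heun_v_def algebra_simps)
  qed
qed

lemma heun_op_eq_0_iff:
  assumes "heun_ok p" "fps_nth F 0 = 1"
  shows "heun_op p F = 0 \<longleftrightarrow> F = Abs_fps (heun_coeff p)"
proof
  assume F: "F = Abs_fps (heun_coeff p)"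
  have "fps_nth (heun_op p F) n = 0" for n
    using heun_w_nonzero[OF assms(1)] unfolding F
    by (cases n) (simp_all add: heun_op_nth del: heun_coeff.simps(3), 
        simp_all add: field_simps)
  thus "heun_op p F = 0" by (simp add: fps_eq_iff)
next
  assume *: "heun_op p F = 0"
  note w = heun_w_nonzero[OF assms(1)]
  have "fps_nth F n = heun_coeff p n \<and> fps_nth F (Suc n) = heun_coeff p (Suc n)" for n
  proof (induction n)
    case 0
    thus ?case using assms(2) * heun_op_nth(1)[of p F] w[of 0] by (simp add: field_simps)
  next
    case (Suc n)
    have "heun_w p (Suc n) * fps_nth F (Suc (Suc n))
        = heun_u p (Suc n) * fps_nth F (Suc n) - heun_v p (Suc n) * fps_nth F n"
      using heun_op_nth(2)[of p F n] * by (simp add: algebra_simps)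
    thus ?case using Suc w[of "Suc n"] by (simp add: nonzero_eq_divide_eq mult.commute)
  qed
  thus "F = Abs_fps (heun_coeff p)" by (simp add: fps_eq_iff)
qed

text \<open>
  \<open>u\<^sub>n\<close> and \<open>v\<^sub>n\<close> grow at most quadratically, and \<open>w\<^sub>n\<close> grows quadratically without vanishing; so
  both ratios \<open>u\<^sub>n / w\<^sub>n\<close> and \<open>v\<^sub>n / w\<^sub>n\<close> are bounded by some \<open>C\<close>, and \<open>M = 1 + 2 C\<close> works.
\<close>

lemma heun_coeff_bound:
  assumes "heun_ok p"
  shows "\<exists>M\<ge>1. \<forall>n. norm (heun_coeff p n) \<le> M ^ n"
proof -
  define A where "A = norm (1 + h_a p) + norm (heun_t p) + norm (h_q p)"
  define B where "B = (1 + norm (h_al p)) * (1 + norm (h_be p))"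
  \<comment> \<open>This quotient is \<open>(n + 1) / (n + \<gamma>)\<close>, so \<open>n + \<gamma>\<close> is bounded below by a multiple of \<open>n + 1\<close>.\<close>
  have "(\<lambda>n. 1 + (1 - h_ga p) / (of_nat n + h_ga p)) \<longlonglongrightarrow> 1 + 0"
    by (intro tendsto_intros tendsto_divide_0[OF tendsto_const]
        tendsto_add_filterlim_at_infinity'[OF tendsto_of_nat tendsto_const])
  hence "Bseq (\<lambda>n. 1 + (1 - h_ga p) / (of_nat n + h_ga p))"
    by (rule convergent_imp_Bseq[OF convergentI])
  then obtain K where K: "K > 0" "\<And>n. norm (1 + (1 - h_ga p) / (of_nat n + h_ga p)) \<le> K"
    unfolding Bseq_def by blast
  have Kn: "real n + 1 \<le> K * norm (of_nat n + h_ga p)" for n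
  proof -
    have nz: "of_nat n + h_ga p \<noteq> 0" 
      using assms nonpos_Ints_plus_nat by (simp add: heun_ok_def)
    hence "1 + (1 - h_ga p) / (of_nat n + h_ga p) = (of_nat n + 1) / (of_nat n + h_ga p)"
      by (simp add: field_simps)
    hence "norm ((of_nat n + 1) / (of_nat n + h_ga p)) \<le> K" using K(2)[of n] by simp
    moreover have "norm (of_nat n + 1 :: complex) = real n + 1"
      by (metis Suc_eq_plus1 norm_of_nat of_nat_Suc add.commute)
    ultimately show ?thesis using nz by (simp add: norm_divide field_simps)
  qed
  have a0: "norm (h_a p) > 0" using assms by (simp add: heun_ok_def)
  have w: "(real n + 1)\<^sup>2 * norm (h_a p) \<le> K * norm (heun_w p n)" for n
  proof -
    have "norm (of_nat n + 1 :: complex) = real n + 1"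
      by (metis Suc_eq_plus1 norm_of_nat of_nat_Suc add.commute)
    hence "K * norm (heun_w p n) = (real n + 1) * norm (h_a p) * (K * norm (of_nat n + h_ga p))"
      by (simp add: heun_w_def norm_mult)
    also have "\<dots> \<ge> (real n + 1) * norm (h_a p) * (real n + 1)"
      using Kn[of n] by (intro mult_left_mono) auto
    finally show ?thesis by (simp add: power2_eq_square mult_ac)
  qed
  have u: "norm (heun_u p n) \<le> A * (real n + 1)\<^sup>2" for n
  proof -
    have 1: "norm (of_nat n - 1 :: complex) \<le> real n + 1"
      using norm_triangle_ineq4[of "of_nat n :: complex" 1] by simp
    have 2: "1 \<le> (real n + 1)\<^sup>2" "real n \<le> (real n + 1)\<^sup>2" by (simp_all add: power2_eq_square algebra_simps)
    have "norm (heun_u p n) \<le> norm (1 + h_a p) * (real n * norm (of_nat n - 1 :: complex)) + norm (heun_t p) * real n + norm (h_q p) * 1"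
      unfolding heun_u_def by (intro order_trans[OF norm_triangle_ineq] add_mono) (simp_all add: norm_mult)
    also have "\<dots> \<le> norm (1 + h_a p) * ((real n + 1) * (real n + 1)) + norm (heun_t p) * (real n + 1)\<^sup>2 + norm (h_q p) * (real n + 1)\<^sup>2"
      using 1 2 by (intro add_mono mult_left_mono mult_mono) auto
    finally show ?thesis by (simp add: A_def power2_eq_square algebra_simps)
  qed
  have v: "norm (heun_v p n) \<le> B * (real n + 1)\<^sup>2" for n
  proof -
    have "norm (of_nat n - 1 + c) \<le> (1 + norm c) * (real n + 1)" for c :: complex
    proof -
      have "norm (of_nat n - 1 + c) \<le> real n + 1 + norm c"
        using norm_triangle_ineq[of "of_nat n - 1" c] norm_triangle_ineq4[of "of_nat n :: complex" 1] by simp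
      also have "\<dots> \<le> (1 + norm c) * (real n + 1)" by (simp add: algebra_simps)
      finally show ?thesis .
    qed
    hence "norm (heun_v p n) \<le> ((1 + norm (h_al p)) * (real n + 1)) * ((1 + norm (h_be p)) * (real n + 1))"
      unfolding heun_v_def norm_mult by (intro mult_mono) auto
    thus ?thesis by (simp add: B_def power2_eq_square mult_ac)
  qed
  define C where "C = (A + B) * K / norm (h_a p)"
  have AB: "A \<ge> 0" "B \<ge> 0" by (auto simp: A_def B_def)
  have C: "norm (heun_u p n) \<le> C * norm (heun_w p n)" "norm (heun_v p n) \<le> C * norm (heun_w p n)" for n
  proof -
    have "(A + B) * (real n + 1)\<^sup>2 \<le> C * norm (heun_w p n)"
      using mult_left_mono[OF w, of "A + B" n] AB a0 by (simp add: C_def field_simps)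
    moreover have "A * (real n + 1)\<^sup>2 \<le> (A + B) * (real n + 1)\<^sup>2" "B * (real n + 1)\<^sup>2 \<le> (A + B) * (real n + 1)\<^sup>2"
      using AB by (auto intro!: mult_right_mono)
    ultimately show "norm (heun_u p n) \<le> C * norm (heun_w p n)" "norm (heun_v p n) \<le> C * norm (heun_w p n)"
      using u[of n] v[of n] by linarith+
  qed
  have C0: "C \<ge> 0" using AB K by (simp add: C_def)
  define M where "M = 1 + 2 * C"
  have w0: "norm (heun_w p n) > 0" for n using heun_w_nonzero[OF assms] by simp
  have "norm (heun_coeff p n) \<le> M ^ n \<and> norm (heun_coeff p (Suc n)) \<le> M ^ Suc n" for n
  proof (induction n)
    case 0
    have "C * norm (heun_w p 0) \<le> M * norm (heun_w p 0)"
      using C0 by (intro mult_right_mono) (auto simp: M_def)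
    with C(1)[of 0] have "norm (heun_u p 0) \<le> M * norm (heun_w p 0)" by linarith
    thus ?case using w0[of 0] by (simp add: norm_divide pos_divide_le_eq)
  next
    case (Suc n)
    have M1: "M \<ge> 1" using C0 by (simp add: M_def)
    hence mono: "M ^ n \<le> M ^ Suc n" by (intro power_increasing) auto
    have "norm (heun_coeff p (Suc (Suc n))) * norm (heun_w p (Suc n))
        = norm (heun_u p (Suc n) * heun_coeff p (Suc n) - heun_v p (Suc n) * heun_coeff p n)"
      using w0[of "Suc n"] by (simp add: norm_divide)
    also have "\<dots> \<le> norm (heun_u p (Suc n)) * norm (heun_coeff p (Suc n)) + norm (heun_v p (Suc n)) * norm (heun_coeff p n)"
      by (intro order_trans[OF norm_triangle_ineq4]) (simp add: norm_mult)
    also have "\<dots> \<le> (C * norm (heun_w p (Suc n))) * M ^ Suc n + (C * norm (heun_w p (Suc n))) * M ^ Suc n"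
      using Suc C mono C0 by (intro add_mono mult_mono) (auto intro: order_trans)
    also have "\<dots> = (2 * C * M ^ Suc n) * norm (heun_w p (Suc n))" by (simp add: algebra_simps)
    finally have "norm (heun_coeff p (Suc (Suc n))) \<le> 2 * C * M ^ Suc n"
      using w0[of "Suc n"] by (simp only: mult_le_cancel_right_pos)
    also have "\<dots> \<le> M * M ^ Suc n" using M1 by (intro mult_right_mono) (auto simp: M_def)
    finally show ?case using Suc by simp
  qed
  thus ?thesis using C0 by (intro exI[of _ M]) (auto simp: M_def)
qed

lemma heun_conv_radius:
  assumes "heun_ok p"
  shows "fps_conv_radius (Abs_fps (heun_coeff p)) > 0"
proof -
  obtain M where M: "M \<ge> 1" "norm (heun_coeff p n) \<le> M ^ n" for n
    using heun_coeff_bound[OF assms] by blast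
  have "summable (\<lambda>n. heun_coeff p n * complex_of_real (1 / (2 * M)) ^ n)"
  proof (rule summable_comparison_test'[of "\<lambda>n. (1 / 2) ^ n"])
    fix n :: nat
    have "norm (heun_coeff p n * complex_of_real (1 / (2 * M)) ^ n) \<le> M ^ n * (1 / (2 * M)) ^ n"
    proof -
      have "norm (complex_of_real (1 / (2 * M))) = 1 / (2 * M)"
        unfolding norm_of_real using M(1) by simp
      thus ?thesis
        unfolding norm_mult norm_power using M(1) by (simp only:) (rule mult_right_mono[OF M(2)], simp)
    qed
    also have "\<dots> = (1 / 2) ^ n" using M(1) by (simp flip: power_mult_distrib)
    finally show "norm (heun_coeff p n * complex_of_real (1 / (2 * M)) ^ n) \<le> (1 / 2) ^ n" .
  qed (auto intro: summable_geometric)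
  from conv_radius_geI[OF this] M(1) show ?thesis
    unfolding fps_conv_radius_def by (auto intro: less_le_trans[rotated])
qed

lemma heun_ode_polynomial:
  assumes "heun_ok p" "x \<noteq> 0" "x \<noteq> 1" "x \<noteq> h_a p"
  shows "D2 + fst (heun_ode p) x * D1 + snd (heun_ode p) x * D0 = 0 \<longleftrightarrow>
     x * (x * (x * D2)) - (1 + h_a p) * (x * (x * D2)) + h_a p * (x * D2)
     + (h_al p + h_be p + 1) * (x * (x * D1)) - heun_t p * (x * D1) + (h_ga p * h_a p) * D1
     + (h_al p * h_be p) * (x * D0) - h_q p * D0 = 0" (is "?l = 0 \<longleftrightarrow> ?r = 0")
proof -
  have nz: "x - 1 \<noteq> 0" "x - h_a p \<noteq> 0" using assms by auto
  have "x * (x - 1) * (x - h_a p) * fst (heun_ode p) x =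
      h_ga p * ((x - 1) * (x - h_a p)) + h_de p * (x * (x - h_a p)) + h_ep p * (x * (x - 1))"
    using assms(2) nz by (simp add: heun_ode_def distrib_left)
  moreover have "x * (x - 1) * (x - h_a p) * snd (heun_ode p) x = h_al p * h_be p * x - h_q p"
    using assms(2) nz by (simp add: heun_ode_def)
  ultimately have "?r = (x * (x - 1) * (x - h_a p)) * ?l"
    unfolding heun_t_def h_ep_def by algebra
  thus ?thesis using assms(2) nz by simp
qed

text \<open>
  Cleared of denominators, the equation holds for an analytic germ if and only if its Taylor series satisfies
  it, and the recurrence has only one solution starting with \<open>1\<close>. Uniqueness of the local solution is
  then immediate, and existence is the convergence of this series.
\<close>

lemma is_Hl_iff_expansion:
  assumes "heun_ok p"
  shows "is_Hl p f \<longleftrightarrow> f has_fps_expansion Abs_fps (heun_coeff p)"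
proof -
  have *: "(\<forall>\<^sub>F x in at 0. deriv (deriv f) x + fst (heun_ode p) x * deriv f x + snd (heun_ode p) x * f x = 0)
     \<longleftrightarrow> heun_op p F = 0" if F: "f has_fps_expansion F" for F
  proof -
    define g where "g = (\<lambda>x. x * (x * (x * deriv (deriv f) x)) - (1 + h_a p) * (x * (x * deriv (deriv f) x)) + h_a p * (x * deriv (deriv f) x)
     + (h_al p + h_be p + 1) * (x * (x * deriv f x)) - heun_t p * (x * deriv f x) + (h_ga p * h_a p) * deriv f x
     + (h_al p * h_be p) * (x * f x) - h_q p * f x)"
    have g: "g has_fps_expansion heun_op p F"
      unfolding g_def heun_op_def by (intro fps_expansion_intros F)
    have "\<forall>\<^sub>F x in at 0. x \<noteq> 0 \<and> x \<noteq> 1 \<and> x \<noteq> h_a p"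
      using assms by (intro eventually_conj eventually_neq_at_within)
    hence "\<forall>\<^sub>F x in at 0. (deriv (deriv f) x + fst (heun_ode p) x * deriv f x + snd (heun_ode p) x * f x = 0) \<longleftrightarrow> g x = 0"
      by eventually_elim (unfold g_def, rule heun_ode_polynomial[OF assms], auto)
    hence "(\<forall>\<^sub>F x in at 0. deriv (deriv f) x + fst (heun_ode p) x * deriv f x + snd (heun_ode p) x * f x = 0)
      \<longleftrightarrow> (\<forall>\<^sub>F x in at 0. g x = 0)"
      by (rule eventually_subst)
    also have "\<dots> \<longleftrightarrow> (\<forall>\<^sub>F x in nhds 0. g x = 0)"
    proof
      assume ev: "\<forall>\<^sub>F x in at 0. g x = 0"
      have "(g \<longlongrightarrow> g 0) (at 0)"
        using has_fps_expansion_imp_continuous[OF g, of UNIV] by (simp add: continuous_within)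
      moreover have "(g \<longlongrightarrow> 0) (at 0)" using ev by (rule tendsto_eventually)
      ultimately have "g 0 = 0" using tendsto_unique by (metis trivial_limit_at)
      with ev show "\<forall>\<^sub>F x in nhds 0. g x = 0" by (simp add: eventually_nhds_conv_at)
    qed (simp add: eventually_nhds_conv_at)
    also have "\<dots> \<longleftrightarrow> heun_op p F = 0"
      using g has_fps_expansion_0_iff[of g] fps_expansion_unique_complex[OF g, of 0] by metis
    finally show ?thesis .
  qed
  show ?thesis
  proof
    assume f: "is_Hl p f"
    then obtain F where F: "f has_fps_expansion F"
      using analytic_at_imp_has_fps_expansion_0 unfolding is_Hl_def by blast
    have "fps_nth F 0 = 1" using f has_fps_expansion_imp_0_eq_fps_nth_0[OF F] by (simp add: is_Hl_def)
    moreover have "heun_op p F = 0" using *[OF F] f by (simp add: is_Hl_def)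
    ultimately show "f has_fps_expansion Abs_fps (heun_coeff p)"
      using heun_op_eq_0_iff[OF assms] F by simp
  next
    assume F: "f has_fps_expansion Abs_fps (heun_coeff p)"
    thus "is_Hl p f" unfolding is_Hl_def *[OF F]
      using has_fps_expansion_imp_0_eq_fps_nth_0[OF F] has_fps_expansion_imp_analytic_0[OF F]
        heun_op_eq_0_iff[OF assms] by simp
  qed
qed

lemma is_Hl_Hl:
  assumes "heun_ok p"
  shows "is_Hl p (Hl p)"
proof -
  have "eval_fps (Abs_fps (heun_coeff p)) has_fps_expansion Abs_fps (heun_coeff p)"
    using eval_fps_has_fps_expansion heun_conv_radius[OF assms] by blast
  thus ?thesis unfolding Hl_def using is_Hl_iff_expansion[OF assms] by (metis someI)
qed

lemma is_Hl_unique: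
  assumes "heun_ok p" "is_Hl p f" "is_Hl p g"
  shows "\<forall>\<^sub>F x in nhds 0. f x = g x"
proof -
  have "(\<lambda>x. f x - g x) has_fps_expansion Abs_fps (heun_coeff p) - Abs_fps (heun_coeff p)"
    using assms(2,3) unfolding is_Hl_iff_expansion[OF assms(1)] by (rule has_fps_expansion_diff)
  thus ?thesis by (simp add: has_fps_expansion_0_iff)
qed

section \<open>The Moebius and F-homotopic transformations as lifts\<close>

text \<open>
  Verifies a lift from explicit derivatives: \<open>L\<close> is the logarithmic derivative of \<open>h\<close>. The last
  assumption equates the coefficients of the pullback with those of the equation of \<open>p\<close>, gauged back.
\<close>

lemma local_liftI:
  assumes f0: "f 0 = 0" "f1 0 \<noteq> 0" and h0: "h 0 = 1"
    and der: "\<forall>\<^sub>F x in nhds 0. (f has_field_derivative f1 x) (at x) \<and> (f1 has_field_derivative f2 x) (at x) \<and>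
       (h has_field_derivative L x * h x) (at x) \<and> (L has_field_derivative L1 x) (at x) \<and> h x \<noteq> 0"
    and ode: "\<forall>\<^sub>F x in at 0.
       fst (heun_ode q) (f x) * f1 x = fst (heun_ode p) x + f2 x / f1 x + 2 * L x \<and>
       snd (heun_ode q) (f x) * (f1 x)\<^sup>2 = snd (heun_ode p) x + fst (heun_ode p) x * L x + L1 x + (L x)\<^sup>2"
  shows "local_lift (HlTr p h q f)"
proof -
  obtain S where S: "open S" "0 \<in> S" and
    derS: "\<And>x. x \<in> S \<Longrightarrow> (f has_field_derivative f1 x) (at x) \<and> (f1 has_field_derivative f2 x) (at x) \<and>
       (h has_field_derivative L x * h x) (at x) \<and> (L has_field_derivative L1 x) (at x) \<and> h x \<noteq> 0"
    using der unfolding eventually_nhds by blast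
  have "f holomorphic_on S" "h holomorphic_on S"
    using derS by (auto simp: holomorphic_on_open[OF S(1)])
  hence an: "f analytic_on {0}" "h analytic_on {0}" using S analytic_at by blast+
  have dS: "deriv f x = f1 x" "deriv h x / h x = L x" if "x \<in> S" for x
    using derS[OF that] by (auto simp: DERIV_imp_deriv)
  have ddS: "deriv (deriv f) x = f2 x \<and> deriv (\<lambda>x. deriv h x / h x) x = L1 x" if "x \<in> S" for x
  proof
    have ev: "\<forall>\<^sub>F y in nhds x. y \<in> S" using S(1) that by (rule eventually_nhds_in_open)
    have "deriv (deriv f) x = deriv f1 x"
      using ev by (intro deriv_cong_ev, elim eventually_mono) (auto simp: dS)
    thus "deriv (deriv f) x = f2 x" using derS[OF that] by (auto simp: DERIV_imp_deriv)
    have "deriv (\<lambda>x. deriv h x / h x) x = deriv L x"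
      using ev by (intro deriv_cong_ev, elim eventually_mono) (auto simp: dS)
    thus "deriv (\<lambda>x. deriv h x / h x) x = L1 x" using derS[OF that] by (auto simp: DERIV_imp_deriv)
  qed
  have "\<forall>\<^sub>F x in at 0. x \<in> S" using eventually_at_in_open[OF S] by eventually_elim simp
  with ode have "ode_eq_at 0 (twist (\<lambda>x. deriv h x / h x) (pullback f (heun_ode q))) (heun_ode p)"
    unfolding ode_eq_at_def
  proof eventually_elim
    case (elim x)
    note d = dS[OF elim(2)] ddS[OF elim(2), THEN conjunct1] ddS[OF elim(2), THEN conjunct2]
    have P: "fst (heun_ode q) (f x) * f1 x - f2 x / f1 x = fst (heun_ode p) x + 2 * L x"
      using elim(1) by simp
    show ?case
      unfolding twist_def pullback_def fst_conv snd_conv d P using elim(1)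
      by (simp add: algebra_simps power2_eq_square)
  qed
  thus ?thesis using f0 h0 an dS(1)[OF S(2)] by (simp add: local_lift_def)
qed

text \<open>
  For \<open>\<bar>x\<bar> < \<bar>z\<bar>\<close> the base stays in the right half-plane, so the principal branch is analytic.
\<close>

lemma has_field_derivative_linear_factor_powr:
  fixes x z c :: complex
  assumes "norm x < norm z"
  shows "((\<lambda>x. (1 - x / z) powr c) has_field_derivative c / (x - z) * (1 - x / z) powr c) (at x)"
proof -
  have z: "z \<noteq> 0" "x \<noteq> z" using assms by auto
  have "norm (x / z) < 1" using assms z by (simp add: norm_divide)
  hence "Re (x / z) < 1" using complex_Re_le_cmod[of "x / z"] by linarith
  hence nn: "1 - x / z \<notin> \<real>\<^sub>\<le>\<^sub>0" by (auto simp: complex_nonpos_Reals_iff)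
  have "((\<lambda>x. (1 - x / z) powr c) has_field_derivative (c * (1 - x / z) powr (c - 1)) * (- (1 / z))) (at x)"
    using nn z by (auto intro!: derivative_eq_intros simp: divide_inverse)
  also have "(1 - x / z) powr (c - 1) = (1 - x / z) powr c / (1 - x / z)"
    using nn by (subst powr_diff) auto
  also have "c * ((1 - x / z) powr c / (1 - x / z)) * (- (1 / z)) = c / (x - z) * (1 - x / z) powr c"
    using z by (simp add: divide_simps) (simp add: algebra_simps)
  finally show ?thesis .
qed

lemma eventually_norm_less: "r > 0 \<Longrightarrow> \<forall>\<^sub>F x in nhds 0. norm (x :: complex) < r"
  using eventually_nhds_in_open[of "ball 0 r" "0 :: complex"] by simp

lemma eventually_at_0_generic:
  assumes "a \<noteq> (0 :: complex)"
  shows "\<forall>\<^sub>F x in at 0. x \<noteq> 0 \<and> x \<noteq> 1 \<and> x \<noteq> a"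
  using assms by (intro eventually_conj eventually_neq_at_within)

lemma local_lift_ident: "local_lift (HlTr p (\<lambda>x. 1) p (\<lambda>x. x))"
  by (rule local_liftI[of _ "\<lambda>_. 1" _ "\<lambda>_. 0" "\<lambda>_. 0" "\<lambda>_. 0"]) auto

lemma local_lift_swap: "local_lift (HlTr (Heun a q \<alpha> \<beta> \<gamma> \<delta>) (\<lambda>x. 1) (Heun a q \<beta> \<alpha> \<gamma> \<delta>) (\<lambda>x. x))"
  by (rule local_liftI[of _ "\<lambda>_. 1" _ "\<lambda>_. 0" "\<lambda>_. 0" "\<lambda>_. 0"]) (auto simp: heun_ode_def h_ep_def mult_ac add_ac)

lemma local_lift_moebius1:
  assumes "heun_ok (Heun a q \<alpha> \<beta> \<gamma> \<delta>)"
  shows "local_lift (HlTr (Heun a q \<alpha> \<beta> \<gamma> \<delta>) (\<lambda>x. (1 - x) powr (- \<alpha>))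
      (Heun (a / (a - 1)) ((- q + \<gamma> * \<alpha> * a) / (a - 1)) \<alpha> (\<alpha> - \<delta> + 1) \<gamma> (\<alpha> - \<beta> + 1))
      (\<lambda>x. x / (x - 1)))"
proof (rule local_liftI[of _ "\<lambda>x. - 1 / (x - 1)\<^sup>2" _ "\<lambda>x. 2 / (x - 1) ^ 3" "\<lambda>x. - \<alpha> / (x - 1)" "\<lambda>x. \<alpha> / (x - 1)\<^sup>2"])
  have a: "a \<noteq> 0" "a - 1 \<noteq> 0" using assms by (auto simp: heun_ok_def)
  show "\<forall>\<^sub>F x in nhds 0. ((\<lambda>x. x / (x - 1)) has_field_derivative - 1 / (x - 1)\<^sup>2) (at x) \<and>
    ((\<lambda>x. - 1 / (x - 1)\<^sup>2) has_field_derivative 2 / (x - 1) ^ 3) (at x) \<and>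
    ((\<lambda>x. (1 - x) powr (- \<alpha>)) has_field_derivative - \<alpha> / (x - 1) * (1 - x) powr (- \<alpha>)) (at x) \<and>
    ((\<lambda>x. - \<alpha> / (x - 1)) has_field_derivative \<alpha> / (x - 1)\<^sup>2) (at x) \<and> (1 - x) powr (- \<alpha>) \<noteq> 0"
    using eventually_norm_less[OF zero_less_one]
  proof eventually_elim
    case (elim x)
    hence nz: "x - 1 \<noteq> 0" "1 - x \<noteq> 0" by auto
    have cube: "(0 * y\<^sup>2 - - 1 * (2 * y)) / (y\<^sup>2 * y\<^sup>2) = 2 / y ^ 3" if "y \<noteq> 0" for y :: complex
      using that by (simp add: power2_eq_square power3_eq_cube)
    have "((\<lambda>x. - 1 / (x - 1)\<^sup>2) has_field_derivative
        (0 * (x - 1)\<^sup>2 - - 1 * (2 * (x - 1))) / ((x - 1)\<^sup>2 * (x - 1)\<^sup>2)) (at x)"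
      using nz by (intro DERIV_divide) (auto intro!: derivative_eq_intros)
    also have "(0 * (x - 1)\<^sup>2 - - 1 * (2 * (x - 1))) / ((x - 1)\<^sup>2 * (x - 1)\<^sup>2) = 2 / (x - 1) ^ 3"
      using cube[OF nz(1)] .
    finally have "((\<lambda>x. - 1 / (x - 1)\<^sup>2) has_field_derivative 2 / (x - 1) ^ 3) (at x)" .
    moreover have "((\<lambda>x. x / (x - 1)) has_field_derivative - 1 / (x - 1)\<^sup>2) (at x)"
      "((\<lambda>x. - \<alpha> / (x - 1)) has_field_derivative \<alpha> / (x - 1)\<^sup>2) (at x)"
      using nz by (auto intro!: derivative_eq_intros simp: power2_eq_square)
    ultimately show ?case using has_field_derivative_linear_factor_powr[of x 1 "- \<alpha>"] elim nz
      by simp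
  qed
  show "\<forall>\<^sub>F x in at 0. fst (heun_ode (Heun (a / (a - 1)) ((- q + \<gamma> * \<alpha> * a) / (a - 1)) \<alpha> (\<alpha> - \<delta> + 1) \<gamma> (\<alpha> - \<beta> + 1))) (x / (x - 1)) * (- 1 / (x - 1)\<^sup>2)
      = fst (heun_ode (Heun a q \<alpha> \<beta> \<gamma> \<delta>)) x + 2 / (x - 1) ^ 3 / (- 1 / (x - 1)\<^sup>2) + 2 * (- \<alpha> / (x - 1)) \<and>
    snd (heun_ode (Heun (a / (a - 1)) ((- q + \<gamma> * \<alpha> * a) / (a - 1)) \<alpha> (\<alpha> - \<delta> + 1) \<gamma> (\<alpha> - \<beta> + 1))) (x / (x - 1)) * (- 1 / (x - 1)\<^sup>2)\<^sup>2
      = snd (heun_ode (Heun a q \<alpha> \<beta> \<gamma> \<delta>)) x + fst (heun_ode (Heun a q \<alpha> \<beta> \<gamma> \<delta>)) x * (- \<alpha> / (x - 1)) + \<alpha> / (x - 1)\<^sup>2 + (- \<alpha> / (x - 1))\<^sup>2"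
    using eventually_at_0_generic[OF a(1)]
  proof eventually_elim
    case (elim x)
    define y where "y = x - 1"
    have y: "x = y + 1" "y \<noteq> 0" "y + 1 \<noteq> 0" "y + 1 - a \<noteq> 0" using elim by (auto simp: y_def)
    have 1: "x / (x - 1) - 1 = 1 / y" using y by (simp add: field_simps)
    have 2: "x / (x - 1) - a / (a - 1) = - (y + 1 - a) / (y * (a - 1))"
      using y a by (simp add: field_simps)
    show ?case
      unfolding heun_ode_def h_ep_def heun.sel fst_conv snd_conv 1 2
      unfolding y(1) using y(2-) a
      by (simp add: divide_simps) (intro conjI impI; algebra)
  qed
qed (use assms in auto)

lemma local_lift_moebius2:
  assumes "heun_ok (Heun a q \<alpha> \<beta> \<gamma> \<delta>)"
  shows "local_lift (HlTr (Heun a q \<alpha> \<beta> \<gamma> \<delta>) (\<lambda>x. 1)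
      (Heun (1 / a) (q / a) \<alpha> \<beta> \<gamma> (\<alpha> + \<beta> - \<gamma> - \<delta> + 1)) (\<lambda>x. x / a))"
proof (rule local_liftI[of _ "\<lambda>x. 1 / a" _ "\<lambda>x. 0" "\<lambda>x. 0" "\<lambda>x. 0"])
  have a: "a \<noteq> 0" using assms by (auto simp: heun_ok_def)
  thus "\<forall>\<^sub>F x in nhds 0. ((\<lambda>x. x / a) has_field_derivative 1 / a) (at x) \<and>
    ((\<lambda>x. 1 / a) has_field_derivative 0) (at x) \<and>
    ((\<lambda>x. 1) has_field_derivative 0 * 1) (at x) \<and> ((\<lambda>x. 0) has_field_derivative 0) (at x) \<and> (1 :: complex) \<noteq> 0"
    by (intro always_eventually) (auto intro!: derivative_eq_intros)
  show "\<forall>\<^sub>F x in at 0. fst (heun_ode (Heun (1 / a) (q / a) \<alpha> \<beta> \<gamma> (\<alpha> + \<beta> - \<gamma> - \<delta> + 1))) (x / a) * (1 / a)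
      = fst (heun_ode (Heun a q \<alpha> \<beta> \<gamma> \<delta>)) x + 0 / (1 / a) + 2 * 0 \<and>
    snd (heun_ode (Heun (1 / a) (q / a) \<alpha> \<beta> \<gamma> (\<alpha> + \<beta> - \<gamma> - \<delta> + 1))) (x / a) * (1 / a)\<^sup>2
      = snd (heun_ode (Heun a q \<alpha> \<beta> \<gamma> \<delta>)) x + fst (heun_ode (Heun a q \<alpha> \<beta> \<gamma> \<delta>)) x * 0 + 0 + 0\<^sup>2"
    using eventually_at_0_generic[OF a(1)]
  proof eventually_elim
    case (elim x)
    have 1: "x / a - 1 = (x - a) / a" "x / a - 1 / a = (x - 1) / a" using a by (simp_all add: field_simps)
    have nz: "x - 1 \<noteq> 0" "x - a \<noteq> 0" "x \<noteq> 0" using elim by auto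
    show ?case
      unfolding heun_ode_def h_ep_def heun.sel fst_conv snd_conv 1
      using nz a
      by (simp add: divide_simps) (intro conjI impI; algebra)
  qed
qed (use assms in \<open>auto simp: heun_ok_def\<close>)

lemma local_lift_F_homotopic:
  assumes "heun_ok (Heun a q \<alpha> \<beta> \<gamma> \<delta>)"
  shows "local_lift (HlTr (Heun a q \<alpha> \<beta> \<gamma> \<delta>) (\<lambda>x. (1 - x) powr (1 - \<delta>))
      (Heun a (q - (\<delta> - 1) * \<gamma> * a) (\<beta> - \<delta> + 1) (\<alpha> - \<delta> + 1) \<gamma> (2 - \<delta>)) (\<lambda>x. x))"
proof (rule local_liftI[of _ "\<lambda>x. 1" _ "\<lambda>x. 0" "\<lambda>x. (1 - \<delta>) / (x - 1)" "\<lambda>x. (\<delta> - 1) / (x - 1)\<^sup>2"])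
  have a: "a \<noteq> 0" "a \<noteq> 1" using assms by (auto simp: heun_ok_def)
  show "\<forall>\<^sub>F x in nhds 0. ((\<lambda>x. x) has_field_derivative 1) (at x) \<and>
    ((\<lambda>x. 1) has_field_derivative 0) (at x) \<and>
    ((\<lambda>x. (1 - x) powr (1 - \<delta>)) has_field_derivative (1 - \<delta>) / (x - 1) * (1 - x) powr (1 - \<delta>)) (at x) \<and>
    ((\<lambda>x. (1 - \<delta>) / (x - 1)) has_field_derivative (\<delta> - 1) / (x - 1)\<^sup>2) (at x) \<and> (1 - x) powr (1 - \<delta>) \<noteq> 0"
    using eventually_norm_less[OF zero_less_one]
  proof eventually_elim
    case (elim x)
    hence "x - 1 \<noteq> 0" "1 - x \<noteq> 0" by auto
    thus ?case using has_field_derivative_linear_factor_powr[of x 1 "1 - \<delta>"] elim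
      by (auto intro!: derivative_eq_intros simp: field_simps power2_eq_square)
  qed
  show "\<forall>\<^sub>F x in at 0. fst (heun_ode (Heun a (q - (\<delta> - 1) * \<gamma> * a) (\<beta> - \<delta> + 1) (\<alpha> - \<delta> + 1) \<gamma> (2 - \<delta>))) x * 1
      = fst (heun_ode (Heun a q \<alpha> \<beta> \<gamma> \<delta>)) x + 0 / 1 + 2 * ((1 - \<delta>) / (x - 1)) \<and>
    snd (heun_ode (Heun a (q - (\<delta> - 1) * \<gamma> * a) (\<beta> - \<delta> + 1) (\<alpha> - \<delta> + 1) \<gamma> (2 - \<delta>))) x * 1\<^sup>2
      = snd (heun_ode (Heun a q \<alpha> \<beta> \<gamma> \<delta>)) x + fst (heun_ode (Heun a q \<alpha> \<beta> \<gamma> \<delta>)) x * ((1 - \<delta>) / (x - 1)) + (\<delta> - 1) / (x - 1)\<^sup>2 + ((1 - \<delta>) / (x - 1))\<^sup>2"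
    using eventually_at_0_generic[OF a(1)]
  proof eventually_elim
    case (elim x)
    have nz: "x - 1 \<noteq> 0" "x - a \<noteq> 0" "x \<noteq> 0" using elim by auto
    show ?case
      unfolding heun_ode_def h_ep_def heun.sel fst_conv snd_conv
      using nz a
      by (simp add: divide_simps) (intro conjI impI; algebra)
  qed
qed (use assms in auto)

lemma local_lift_moebius_F: "moebius_F T \<Longrightarrow> local_lift T"
proof (induction rule: moebius_F.induct)
  case (moebius1 a q \<alpha> \<beta> \<gamma> \<delta>)
  thus ?case by (rule local_lift_moebius1)
next
  case (moebius2 a q \<alpha> \<beta> \<gamma> \<delta>)
  thus ?case by (rule local_lift_moebius2)
next
  case (F_homotopic a q \<alpha> \<beta> \<gamma> \<delta>)
  thus ?case by (rule local_lift_F_homotopic)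
qed (rule local_lift_ident local_lift_swap local_lift_comp; assumption)+

lemma moebius_F_heun_ok: "moebius_F T \<Longrightarrow> heun_ok (lhs T) \<and> heun_ok (rhs T)"
  by (induction rule: moebius_F.induct) (auto simp: heun_ok_def hl_comp_def field_simps)

text \<open>
  The transported solution is again analytic at the origin, normalized there, and a solution, so the
  uniqueness of such germs identifies it.
\<close>

lemma Hl_local_lift:
  assumes "local_lift T" "heun_ok (lhs T)" "heun_ok (rhs T)"
  shows "\<forall>\<^sub>F x in nhds 0. Hl (lhs T) x = pref T x * Hl (rhs T) (arg T x)"
  by (rule is_Hl_unique[OF assms(2) is_Hl_Hl[OF assms(2)] is_Hl_lift[OF assms(1) is_Hl_Hl[OF assms(3)]]])

section \<open>The quadratic map\<close>

text \<open>
  Identities between rational functions are known near the origin only, and are needed at the critical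
  points; the complement of finitely many poles is connected.
\<close>

lemma analytic_continuation_cofinite:
  assumes B: "finite B" and g: "g holomorphic_on - B" and ev: "\<forall>\<^sub>F x in at 0. g x = 0" and z: "z \<notin> B"
  shows "g z = 0"
proof -
  have "\<forall>\<^sub>F x in at 0. x \<notin> B"
    using B by (intro eventually_cofinite_imp_at) (simp add: eventually_cofinite)
  with ev have "\<forall>\<^sub>F x in at 0. g x = 0 \<and> x \<notin> B" by eventually_elim simp
  then obtain U where U: "open U" "0 \<in> U" "\<And>x. x \<in> U \<Longrightarrow> x \<noteq> 0 \<Longrightarrow> g x = 0 \<and> x \<notin> B"
    unfolding eventually_at_topological by auto
  have "\<forall>\<^sub>F x in at 0. x \<in> U - {0}" using eventually_at_in_open[OF U(1,2)] by simp
  then obtain x where x: "x \<in> U - {0}" using eventually_happens by (metis trivial_limit_at)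
  have "open (U - {0})" using U(1) by (simp add: open_delete)
  hence "x islimpt (U - {0})" using x interior_limit_point interior_open by metis
  moreover have "connected (- B)"
    using path_connected_complement_countable[of B] B by (simp add: countable_finite path_connected_imp_connected)
  moreover have "open (- B)" using B by (simp add: finite_imp_closed open_Compl)
  ultimately show ?thesis
    using U(3) x z by (intro analytic_continuation[OF g, of "U - {0}" x z]) auto
qed

lemma entire_eventually_zero:
  fixes g :: "complex \<Rightarrow> complex"
  assumes "g holomorphic_on UNIV" "\<forall>\<^sub>F x in at 0. g x = 0"
  shows "g z = 0"
  using analytic_continuation_cofinite[of "{}" g z] assms by simp

text \<open>
  The polynomial form of the relation between the parameters. It says that \<open>v\<^sup>2 - 2 (2 - a) A v + A\<^sup>2 a\<^sup>2\<close>, the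
  discriminant in \<open>x\<close> of \<open>A x (a - x) - v (1 - x)\<close>, has the roots \<open>1\<close> and \<open>a'\<close>, that is, that \<open>1\<close> and \<open>a'\<close> are the
  critical values of the quadratic map. It is uniform in \<open>a\<close>: at the node \<open>a = 2\<close> it gives
  \<open>4 A\<^sup>2 = -1\<close>, whose solutions are the two values prescribed there.
\<close>

lemma quad_params_iff:
  "quad_params a a' A \<longleftrightarrow> a \<notin> {0, 1} \<and> a' \<notin> {0, 1} \<and> a' = A\<^sup>2 * a\<^sup>2 \<and> 1 + a' = 2 * (2 - a) * A"
proof (cases "a = 2")
  case True
  have i: "(A = \<i> / 2 \<or> A = - \<i> / 2) \<longleftrightarrow> 4 * A\<^sup>2 = - 1"
  proof -
    have "4 * A\<^sup>2 = - 1 \<longleftrightarrow> 4 * A\<^sup>2 + 1 = 0" by (simp add: eq_neg_iff_add_eq_0)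
    also have "4 * A\<^sup>2 + 1 = 4 * ((A - \<i> / 2) * (A - - \<i> / 2))"
      by (simp add: algebra_simps power2_eq_square)
    also have "\<dots> = 0 \<longleftrightarrow> (A - \<i> / 2) * (A - - \<i> / 2) = 0"
      by (rule mult_eq_0_iff[THEN trans]) simp
    finally show ?thesis by (simp only: mult_eq_0_iff right_minus_eq)
  qed
  have "(2 :: complex)\<^sup>2 * (1 - a')\<^sup>2 - 16 * (1 - 2) * a' = 4 * (a' + 1)\<^sup>2" by algebra
  moreover have "4 * (a' + 1)\<^sup>2 = 0 \<longleftrightarrow> a' = - 1" "1 + a' = 2 * (2 - 2) * A \<longleftrightarrow> a' = - 1"
    by (simp_all add: eq_neg_iff_add_eq_0 add.commute)
  moreover have "4 * A\<^sup>2 = - 1 \<longleftrightarrow> - 1 = A\<^sup>2 * 2\<^sup>2"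
    by (simp add: mult.commute[of _ 4] eq_commute[of "- 1"])
  ultimately show ?thesis unfolding True quad_params_def using i by auto
next
  case False
  hence A: "A = (1 + a') / (2 * (2 - a)) \<longleftrightarrow> 1 + a' = 2 * (2 - a) * A"
    by (auto simp: field_simps)
  have "a\<^sup>2 * (1 - a')\<^sup>2 - 16 * (1 - a) * a' = 0 \<longleftrightarrow> a' = A\<^sup>2 * a\<^sup>2" if "1 + a' = 2 * (2 - a) * A"
  proof -
    have "a\<^sup>2 * (1 - a')\<^sup>2 - 16 * (1 - a) * a' = 4 * (2 - a)\<^sup>2 * (A\<^sup>2 * a\<^sup>2 - a')"
      using that by algebra
    thus ?thesis using False by auto
  qed
  with A show ?thesis using False by (auto simp: quad_params_def)
qed

text \<open>
  The quadratic map with its critical points \<open>e, f\<close> as primary data. By Vieta they are the roots of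
  \<open>x\<^sup>2 - 2 x + a\<close>, which is the numerator of the derivative up to the factor \<open>A\<close>, and \<open>A e\<^sup>2\<close>, \<open>A f\<^sup>2\<close> are the critical values.
\<close>

locale quad_map =
  fixes a a' A e f :: complex
  assumes nz: "A \<noteq> 0" "a \<noteq> 0" "a \<noteq> 1" and ef: "e + f = 2" "e * f = a" "A * e\<^sup>2 = 1" "A * f\<^sup>2 = a'"
begin

definition R :: "complex \<Rightarrow> complex" where "R x = A * (x * (a - x) / (1 - x))"
definition R1 :: "complex \<Rightarrow> complex" where "R1 x = A * ((x - e) * (x - f)) / (1 - x)\<^sup>2"
definition R2 :: "complex \<Rightarrow> complex" where "R2 x = 2 * A * (a - 1) / (1 - x) ^ 3"

lemma ef_nz: "e \<noteq> 0" "f \<noteq> 0" "e \<noteq> 1" "f \<noteq> 1" "e \<noteq> a" "f \<noteq> a" "e \<noteq> f"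
  using nz ef by (auto simp: algebra_simps)

lemma R_derivs:
  assumes "x \<noteq> 1"
  shows "(R has_field_derivative R1 x) (at x)" "(R1 has_field_derivative R2 x) (at x)"
proof -
  have y: "1 - x \<noteq> 0" using assms by auto
  have "(R has_field_derivative A * ((((a - x) - x) * (1 - x) - x * (a - x) * (- 1)) / ((1 - x) * (1 - x)))) (at x)"
    unfolding R_def using y by (intro DERIV_cmult DERIV_divide) (auto intro!: derivative_eq_intros)
  also have "((a - x) - x) * (1 - x) - x * (a - x) * (- 1) = (x - e) * (x - f)"
  proof -
    have "(x - e) * (x - f) = x * x - (e + f) * x + e * f" by (simp add: algebra_simps)
    thus ?thesis unfolding ef by (simp add: algebra_simps)
  qed
  finally show "(R has_field_derivative R1 x) (at x)" by (simp add: R1_def power2_eq_square)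
  have "(R1 has_field_derivative ((A * ((x - e) + (x - f))) * (1 - x)\<^sup>2 - A * ((x - e) * (x - f)) * (2 * (1 - x) * (- 1)))
      / ((1 - x)\<^sup>2 * (1 - x)\<^sup>2)) (at x)"
    unfolding R1_def using y by (intro DERIV_divide) (auto intro!: derivative_eq_intros simp: algebra_simps)
  also have "((A * ((x - e) + (x - f))) * (1 - x)\<^sup>2 - A * ((x - e) * (x - f)) * (2 * (1 - x) * (- 1)))
      = 2 * A * (a - 1) * (1 - x)"
  proof -
    have s: "(x - e) * (x - f) = x * x - (e + f) * x + e * f" "(x - e) + (x - f) = 2 * x - (e + f)"
      by (simp_all add: algebra_simps)
    show ?thesis unfolding s ef by (simp add: algebra_simps power2_eq_square)
  qed
  also have "2 * A * (a - 1) * (1 - x) / ((1 - x)\<^sup>2 * (1 - x)\<^sup>2) = R2 x"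
    using y by (simp add: R2_def power2_eq_square power3_eq_cube mult.assoc)
  finally show "(R1 has_field_derivative R2 x) (at x)" .
qed

lemma deriv_R:
  assumes "x \<noteq> 1"
  shows "deriv R x = R1 x" and "deriv (deriv R) x = R2 x"
proof -
  have d: "deriv R x = R1 x" if "x \<noteq> 1" for x
    using R_derivs(1)[OF that] by (rule DERIV_imp_deriv)
  show "deriv R x = R1 x" using d assms by blast
  have "\<forall>\<^sub>F s in nhds x. s \<in> - {1}" using assms by (intro eventually_nhds_in_open) auto
  hence "deriv (deriv R) x = deriv R1 x"
    by (intro deriv_cong_ev refl, elim eventually_mono) (simp add: d)
  thus "deriv (deriv R) x = R2 x" using R_derivs(2)[OF assms] by (simp add: DERIV_imp_deriv)
qed

text \<open>
  The logarithmic derivatives of \<open>R\<close>, \<open>R - 1\<close>, \<open>R - a'\<close> and \<open>R'\<close> have simple partial fractions, because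
  \<open>R - 1\<close> and \<open>R - a'\<close> have double zeros at \<open>e\<close> and \<open>f\<close>. The residue of the first coefficient at \<open>e\<close> is
  \<open>2 \<delta> - 1\<close>, which vanishes for \<open>\<delta> = 1/2\<close>, and the second coefficient has no pole at \<open>e\<close> or \<open>f\<close> at all.
\<close>

lemma pullback_coeffs:
  assumes x: "x \<noteq> 0" "x \<noteq> 1" "x \<noteq> a" "x \<noteq> e" "x \<noteq> f" and p: "h_a p = a'"
  shows "fst (heun_ode p) (R x) * R1 x - R2 x / R1 x =
      h_ga p / x + h_ga p / (x - a) + (2 - h_ga p - h_de p - h_ep p) / (x - 1)
      + (2 * h_de p - 1) / (x - e) + (2 * h_ep p - 1) / (x - f)" (is ?th1)
    and "snd (heun_ode p) (R x) * (R1 x)\<^sup>2 =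
      h_al p * h_be p / (x - 1)\<^sup>2 - h_q p / (A * (x * (x - a) * (x - 1)))" (is ?th2)
proof -
  have d: "x - 1 \<noteq> 0" "x - a \<noteq> 0" "x - e \<noteq> 0" "x - f \<noteq> 0" "1 - x \<noteq> 0" using x by auto
  have R: "R x = A * (x * (x - a)) / (x - 1)"
    using d by (simp add: R_def divide_simps) algebra
  have R1: "R1 x = A * ((x - e) * (x - f)) / (x - 1)\<^sup>2"
    unfolding R1_def by (simp add: power2_commute)
  have R2: "R2 x = - 2 * A * (a - 1) / (x - 1) ^ 3"
  proof -
    have "(1 - x) ^ 3 = - ((x - 1) ^ 3)" by algebra
    thus ?thesis unfolding R2_def by simp
  qed
  have m1: "R x - 1 = A * (x - e)\<^sup>2 / (x - 1)"
    unfolding R using d ef by (simp add: divide_simps) algebra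
  have m2: "R x - a' = A * (x - f)\<^sup>2 / (x - 1)"
    unfolding R using d ef by (simp add: divide_simps) algebra
  have 1: "R1 x / R x = 1 / x + 1 / (x - a) - 1 / (x - 1)"
    unfolding R R1 using d x(1) nz ef(1,2) by (simp add: divide_simps power2_eq_square) algebra
  have 2: "R1 x / (R x - 1) = 2 / (x - e) - 1 / (x - 1)"
    unfolding m1 R1 using d x(1) nz ef(1,2) by (simp add: divide_simps power2_eq_square) algebra
  have 3: "R1 x / (R x - a') = 2 / (x - f) - 1 / (x - 1)"
    unfolding m2 R1 using d x(1) nz ef(1,2) by (simp add: divide_simps power2_eq_square) algebra
  have 4: "R2 x / R1 x = 1 / (x - e) + 1 / (x - f) - 2 / (x - 1)"
    unfolding R2 R1 using d x(1) nz ef(1,2) by (simp add: divide_simps power2_eq_square power3_eq_cube) algebra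
  have "fst (heun_ode p) (R x) * R1 x = h_ga p * (R1 x / R x) + h_de p * (R1 x / (R x - 1)) + h_ep p * (R1 x / (R x - a'))"
    by (simp add: heun_ode_def p distrib_right)
  thus ?th1 unfolding 1 2 3 4 by (simp add: diff_divide_distrib add_divide_distrib algebra_simps)
  show ?th2
    unfolding heun_ode_def snd_conv p m1 m2 unfolding R1 R
    using d x(1) nz by (simp add: divide_simps power2_eq_square)
qed

text \<open>
  The lift of the right-hand equation of \<open>quad_hl\<close> has exponents \<open>\<alpha>, \<gamma> - \<alpha>\<close> at \<open>x = 1\<close>, and the prefactor
  \<open>(1 - x) powr (- \<alpha>)\<close>, of logarithmic derivative \<open>- \<alpha> / (x - 1)\<close>, makes the first of them zero.
\<close>

lemma lifted_coeffs:
  fixes \<alpha> \<gamma> q :: complex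
  assumes x: "x \<noteq> 0" "x \<noteq> 1" "x \<noteq> a" "x \<noteq> e" "x \<noteq> f"
  defines "p \<equiv> Heun a q (2 * \<alpha>) \<gamma> \<gamma> (2 * \<alpha> - \<gamma> + 1)"
    and "r \<equiv> Heun a' (A * (q - \<gamma> * \<alpha> * a)) \<alpha> (\<gamma> - \<alpha>) \<gamma> (1 / 2)"
  shows "fst (heun_ode r) (R x) * R1 x = fst (heun_ode p) x + R2 x / R1 x + 2 * (- \<alpha> / (x - 1))" (is ?th1)
    and "snd (heun_ode r) (R x) * (R1 x)\<^sup>2
       = snd (heun_ode p) x + fst (heun_ode p) x * (- \<alpha> / (x - 1)) + \<alpha> / (x - 1)\<^sup>2 + (- \<alpha> / (x - 1))\<^sup>2" (is ?th2)
proof -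
  have r: "h_a r = a'" "h_ep r = 1 / 2"
    by (simp_all add: h_ep_def r_def)
  note c = pullback_coeffs[OF x r(1), unfolded r(2)]
  have d: "x - 1 \<noteq> 0" "x - a \<noteq> 0" using x by auto
  have 1: "fst (heun_ode p) x = \<gamma> / x + (2 * \<alpha> - \<gamma> + 1) / (x - 1) + \<gamma> / (x - a)"
    by (simp add: heun_ode_def h_ep_def p_def)
  show ?th1
    unfolding 1 using c(1) by (simp add: diff_eq_eq r_def) (use d x in \<open>simp add: divide_simps\<close>)
  show ?th2
    unfolding 1 c(2) unfolding heun_ode_def snd_conv heun.sel r_def p_def
    using d nz(1) x(1) by (simp add: divide_simps power2_eq_square) algebra
qed

end

text \<open>
  The critical points are the double roots of \<open>A x (a - x) - v (1 - x)\<close> for \<open>v = 1\<close> and \<open>v = a'\<close>.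
\<close>

lemma quad_params_quad_map:
  assumes "quad_params a a' A"
  shows "quad_map a a' A ((A * a + 1) / (2 * A)) ((A * a + a') / (2 * A))"
proof -
  have q: "a \<notin> {0, 1}" "a' \<noteq> 0" "a' = A\<^sup>2 * a\<^sup>2" "1 + a' = 2 * (2 - a) * A"
    using assms by (auto simp: quad_params_iff)
  hence A: "A \<noteq> 0" by auto
  show ?thesis
  proof unfold_locales
    show "(A * a + 1) / (2 * A) + (A * a + a') / (2 * A) = 2"
      using A q(4) by (simp add: divide_simps) (simp add: algebra_simps)
    have e: "(A * a + 1)\<^sup>2 = 4 * A" "(A * a + a')\<^sup>2 = 4 * A * a'" "(A * a + 1) * (A * a + a') = 4 * A\<^sup>2 * a"
      using q(3,4) by algebra+
    show "(A * a + 1) / (2 * A) * ((A * a + a') / (2 * A)) = a"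
      using A e(3) by (simp add: divide_simps power2_eq_square)
    show "A * ((A * a + 1) / (2 * A))\<^sup>2 = 1" "A * ((A * a + a') / (2 * A))\<^sup>2 = a'"
      unfolding power_divide e using A by (simp_all add: power2_eq_square)
  qed (use A q in auto)
qed

lemma local_lift_quad_hl:
  assumes q: "quad_params a a' A"
  shows "local_lift (quad_hl a a' A q \<alpha> \<gamma>)"
proof -
  define e f where "e = (A * a + 1) / (2 * A)" and "f = (A * a + a') / (2 * A)"
  interpret quad_map a a' A e f unfolding e_def f_def by (rule quad_params_quad_map[OF q])
  have "local_lift (HlTr (Heun a q (2 * \<alpha>) \<gamma> \<gamma> (2 * \<alpha> - \<gamma> + 1)) (\<lambda>x. (1 - x) powr (- \<alpha>))
          (Heun a' (A * (q - \<gamma> * \<alpha> * a)) \<alpha> (\<gamma> - \<alpha>) \<gamma> (1 / 2)) R)"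
  proof (rule local_liftI[of _ R1 _ R2 "\<lambda>x. - \<alpha> / (x - 1)" "\<lambda>x. \<alpha> / (x - 1)\<^sup>2"])
    show "R 0 = 0" by (simp add: R_def)
    show "R1 0 \<noteq> 0" using ef_nz nz by (simp add: R1_def)
    show "(1 - 0) powr - \<alpha> = 1" by simp
    show "\<forall>\<^sub>F x in nhds 0. (R has_field_derivative R1 x) (at x) \<and> (R1 has_field_derivative R2 x) (at x) \<and>
      ((\<lambda>x. (1 - x) powr - \<alpha>) has_field_derivative - \<alpha> / (x - 1) * (1 - x) powr - \<alpha>) (at x) \<and>
      ((\<lambda>x. - \<alpha> / (x - 1)) has_field_derivative \<alpha> / (x - 1)\<^sup>2) (at x) \<and> (1 - x) powr - \<alpha> \<noteq> 0"
      using eventually_norm_less[OF zero_less_one]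
    proof eventually_elim
      case (elim x)
      hence nz: "x - 1 \<noteq> 0" "1 - x \<noteq> 0" "x \<noteq> 1" by auto
      have "((\<lambda>x. - \<alpha> / (x - 1)) has_field_derivative \<alpha> / (x - 1)\<^sup>2) (at x)"
        using nz by (auto intro!: derivative_eq_intros simp: power2_eq_square)
      thus ?case using has_field_derivative_linear_factor_powr[of x 1 "- \<alpha>"] R_derivs[OF nz(3)] elim nz
        by simp
    qed
    show "\<forall>\<^sub>F x in at 0. fst (heun_ode (Heun a' (A * (q - \<gamma> * \<alpha> * a)) \<alpha> (\<gamma> - \<alpha>) \<gamma> (1 / 2))) (R x) * R1 x
       = fst (heun_ode (Heun a q (2 * \<alpha>) \<gamma> \<gamma> (2 * \<alpha> - \<gamma> + 1))) x + R2 x / R1 x + 2 * (- \<alpha> / (x - 1)) \<and>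
      snd (heun_ode (Heun a' (A * (q - \<gamma> * \<alpha> * a)) \<alpha> (\<gamma> - \<alpha>) \<gamma> (1 / 2))) (R x) * (R1 x)\<^sup>2
       = snd (heun_ode (Heun a q (2 * \<alpha>) \<gamma> \<gamma> (2 * \<alpha> - \<gamma> + 1))) x
        + fst (heun_ode (Heun a q (2 * \<alpha>) \<gamma> \<gamma> (2 * \<alpha> - \<gamma> + 1))) x * (- \<alpha> / (x - 1)) + \<alpha> / (x - 1)\<^sup>2 + (- \<alpha> / (x - 1))\<^sup>2"
      using eventually_at_0_generic[OF nz(2)] eventually_at_0_generic[OF ef_nz(1)] eventually_at_0_generic[OF ef_nz(2)]
      by eventually_elim (intro conjI lifted_coeffs; blast)
  qed
  thus ?thesis by (simp add: quad_hl_def R_def[abs_def])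
qed

section \<open>Inverses, and gauge-equivalent Heun equations\<close>

lemma moebius_F_arg_lim: "moebius_F T \<Longrightarrow> filterlim (arg T) (nhds 0) (nhds 0)"
  by (rule local_lift_filterlim(2)[OF local_lift_moebius_F])

text \<open>
  The generators are involutions on parameters and, as germs, on the variable.
\<close>

lemma moebius_F_inverse:
  assumes "moebius_F T"
  shows "\<exists>U. moebius_F U \<and> lhs U = rhs T \<and> rhs U = lhs T \<and>
     (\<forall>\<^sub>F x in nhds 0. arg U (arg T x) = x) \<and> (\<forall>\<^sub>F x in nhds 0. arg T (arg U x) = x)"
  using assms
proof (induction rule: moebius_F.induct)
  case (ident p)
  thus ?case by (intro exI[of _ "HlTr p (\<lambda>x. 1) p (\<lambda>x. x)"]) (auto intro: moebius_F.ident)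
next
  case (swap a q \<alpha> \<beta> \<gamma> \<delta>)
  hence "heun_ok (Heun a q \<beta> \<alpha> \<gamma> \<delta>)" by (simp add: heun_ok_def)
  from moebius_F.swap[OF this] show ?case
    by - (rule exI, rule conjI, assumption, auto)
next
  case (moebius1 a q \<alpha> \<beta> \<gamma> \<delta>)
  hence a: "a \<noteq> 0" "a - 1 \<noteq> 0" by (auto simp: heun_ok_def)
  have p: "a / (a - 1) / (a / (a - 1) - 1) = a" 
    "(- ((- q + \<gamma> * \<alpha> * a) / (a - 1)) + \<gamma> * \<alpha> * (a / (a - 1))) / (a / (a - 1) - 1) = q"
    using a by (simp_all add: divide_simps)
  define T where "T = HlTr (Heun a q \<alpha> \<beta> \<gamma> \<delta>) (\<lambda>x. (1 - x) powr (- \<alpha>))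
      (Heun (a / (a - 1)) ((- q + \<gamma> * \<alpha> * a) / (a - 1)) \<alpha> (\<alpha> - \<delta> + 1) \<gamma> (\<alpha> - \<beta> + 1)) (\<lambda>x. x / (x - 1))"
  have "heun_ok (rhs T)" unfolding T_def using moebius_F_heun_ok[OF moebius_F.moebius1[OF moebius1]] by simp
  hence ok: "heun_ok (Heun (a / (a - 1)) ((- q + \<gamma> * \<alpha> * a) / (a - 1)) \<alpha> (\<alpha> - \<delta> + 1) \<gamma> (\<alpha> - \<beta> + 1))"
    by (simp add: T_def)
  have "\<forall>\<^sub>F x in nhds 0. x / (x - 1) / (x / (x - 1) - 1) = (x :: complex)"
    using eventually_norm_less[OF zero_less_one]
  proof eventually_elim
    case (elim x)
    hence "x - 1 \<noteq> 0" by auto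
    thus ?case by (simp add: divide_simps)
  qed
  with moebius_F.moebius1[OF ok] show ?case
    unfolding p by - (rule exI, rule conjI, assumption, auto)
next
  case (moebius2 a q \<alpha> \<beta> \<gamma> \<delta>)
  hence a: "a \<noteq> 0" by (auto simp: heun_ok_def)
  have ok: "heun_ok (Heun (1 / a) (q / a) \<alpha> \<beta> \<gamma> (\<alpha> + \<beta> - \<gamma> - \<delta> + 1))"
    using moebius_F_heun_ok[OF moebius_F.moebius2[OF moebius2]] by simp
  from moebius_F.moebius2[OF ok] show ?case
    using a by - (rule exI, rule conjI, assumption, auto)
next
  case (F_homotopic a q \<alpha> \<beta> \<gamma> \<delta>)
  have ok: "heun_ok (Heun a (q - (\<delta> - 1) * \<gamma> * a) (\<beta> - \<delta> + 1) (\<alpha> - \<delta> + 1) \<gamma> (2 - \<delta>))"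
    using moebius_F_heun_ok[OF moebius_F.F_homotopic[OF F_homotopic]] by simp
  from moebius_F.F_homotopic[OF ok] show ?case
    by - (rule exI, rule conjI, assumption, auto simp: algebra_simps)
next
  case (comp T1 T2)
  then obtain U1 U2 where U: "moebius_F U1" "lhs U1 = rhs T1" "rhs U1 = lhs T1"
    "\<forall>\<^sub>F x in nhds 0. arg U1 (arg T1 x) = x" "\<forall>\<^sub>F x in nhds 0. arg T1 (arg U1 x) = x"
    "moebius_F U2" "lhs U2 = rhs T2" "rhs U2 = lhs T2"
    "\<forall>\<^sub>F x in nhds 0. arg U2 (arg T2 x) = x" "\<forall>\<^sub>F x in nhds 0. arg T2 (arg U2 x) = x"
    by blast
  have "\<forall>\<^sub>F x in nhds 0. arg U1 (arg U2 (arg T2 (arg T1 x))) = x"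
    using U(4) eventually_compose_filterlim[OF U(9) moebius_F_arg_lim[OF comp.hyps(1)]]
    by eventually_elim simp
  moreover have "\<forall>\<^sub>F x in nhds 0. arg T2 (arg T1 (arg U1 (arg U2 x))) = x"
    using U(10) eventually_compose_filterlim[OF U(5) moebius_F_arg_lim[OF U(6)]]
    by eventually_elim simp
  ultimately show ?case
    using moebius_F.comp[OF U(6) U(1)] U comp.hyps
    by (intro exI[of _ "hl_comp U2 U1"]) (auto simp: hl_comp_def)
qed

definition germ_id :: "hl_transf \<Rightarrow> bool" where
  "germ_id T \<longleftrightarrow> (\<forall>\<^sub>F x in nhds 0. arg T x = x)"

lemma germ_id_comp:
  assumes "germ_id T" "germ_id U" "moebius_F T"
  shows "germ_id (hl_comp T U)"
proof -
  have "\<forall>\<^sub>F x in nhds 0. arg U (arg T x) = x"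
    using assms(1)[unfolded germ_id_def] 
      eventually_compose_filterlim[OF assms(2)[unfolded germ_id_def] moebius_F_arg_lim[OF assms(3)]]
    by eventually_elim simp
  thus ?thesis by (simp add: germ_id_def hl_comp_def)
qed

lemma moebius_F_rescale:
  assumes "heun_ok p"
  shows "\<exists>U. moebius_F U \<and> lhs U = p \<and> arg U = (\<lambda>x. x / h_a p) \<and> h_a (rhs U) = 1 / h_a p \<and>
    h_ga (rhs U) = h_ga p \<and> h_de (rhs U) = h_ep p \<and> h_ep (rhs U) = h_de p"
proof -
  obtain a q \<alpha> \<beta> \<gamma> \<delta> where p: "p = Heun a q \<alpha> \<beta> \<gamma> \<delta>" by (cases p)
  from moebius_F.moebius2[OF assms[unfolded p]] show ?thesis
    unfolding p by - (rule exI, rule conjI, assumption, simp add: h_ep_def)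
qed

lemma flip_exponent_at_1:
  assumes "heun_ok p"
  shows "\<exists>U. moebius_F U \<and> germ_id U \<and> lhs U = p \<and> h_a (rhs U) = h_a p \<and> h_ga (rhs U) = h_ga p \<and>
     h_de (rhs U) = 2 - h_de p \<and> h_ep (rhs U) = h_ep p"
proof -
  obtain a q \<alpha> \<beta> \<gamma> \<delta> where p: "p = Heun a q \<alpha> \<beta> \<gamma> \<delta>" by (cases p)
  from moebius_F.F_homotopic[OF assms[unfolded p]] show ?thesis
    unfolding p by - (rule exI, rule conjI, assumption, auto simp: germ_id_def h_ep_def algebra_simps)
qed

text \<open>
  The rescaling \<open>x / a\<close> exchanges the singular points \<open>1\<close> and \<open>a\<close>, so this is the F-homotopic
  transformation at \<open>1\<close> conjugated by it.
\<close>

lemma flip_exponent_at_a: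
  assumes "heun_ok p"
  shows "\<exists>U. moebius_F U \<and> germ_id U \<and> lhs U = p \<and> h_a (rhs U) = h_a p \<and> h_ga (rhs U) = h_ga p \<and>
     h_de (rhs U) = h_de p \<and> h_ep (rhs U) = 2 - h_ep p"
proof -
  obtain U where U: "moebius_F U" "arg U = (\<lambda>x. x / h_a p)" "lhs U = p" "h_a (rhs U) = 1 / h_a p"
      "h_ga (rhs U) = h_ga p" "h_de (rhs U) = h_ep p" "h_ep (rhs U) = h_de p"
    using moebius_F_rescale[OF assms] by blast
  obtain V where V: "moebius_F V" "germ_id V" "lhs V = rhs U" "h_a (rhs V) = h_a (rhs U)"
      "h_ga (rhs V) = h_ga (rhs U)" "h_de (rhs V) = 2 - h_de (rhs U)" "h_ep (rhs V) = h_ep (rhs U)"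
    using flip_exponent_at_1 moebius_F_heun_ok[OF U(1)] by blast
  obtain W where W: "moebius_F W" "arg W = (\<lambda>x. x / h_a (rhs V))" "lhs W = rhs V" "h_a (rhs W) = 1 / h_a (rhs V)"
      "h_ga (rhs W) = h_ga (rhs V)" "h_de (rhs W) = h_ep (rhs V)" "h_ep (rhs W) = h_de (rhs V)"
    using moebius_F_rescale moebius_F_heun_ok[OF V(1)] by blast
  have a: "h_a p \<noteq> 0" using assms by (simp add: heun_ok_def)
  have m: "moebius_F (hl_comp (hl_comp U V) W)"
    using U V W by (intro moebius_F.comp) (auto simp: hl_comp_def)
  have "\<forall>\<^sub>F x in nhds 0. arg V (arg U x) = arg U x"
    using eventually_compose_filterlim[OF V(2)[unfolded germ_id_def] moebius_F_arg_lim[OF U(1)]] .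
  hence "\<forall>\<^sub>F x in nhds 0. arg W (arg V (arg U x)) = x"
    by eventually_elim (use U V W a in simp)
  thus ?thesis using U V W m
    by (intro exI[of _ "hl_comp (hl_comp U V) W"]) (simp add: germ_id_def hl_comp_def)
qed

text \<open>
  The exponents at \<open>1\<close> are \<open>0, 1 - \<delta>\<close>, and shifting them so that the second one becomes zero replaces
  \<open>\<delta>\<close> by \<open>2 - \<delta>\<close>; the same holds at \<open>a\<close> with \<open>\<epsilon>\<close>.
\<close>

lemma normalize_exponents:
  assumes p: "heun_ok p" and d: "d \<in> {h_de p, 2 - h_de p}" and e: "e \<in> {h_ep p, 2 - h_ep p}"
  shows "\<exists>U. moebius_F U \<and> germ_id U \<and> lhs U = p \<and> h_a (rhs U) = h_a p \<and> h_ga (rhs U) = h_ga p \<and>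
     h_de (rhs U) = d \<and> h_ep (rhs U) = e"
proof -
  have id: "\<exists>U. moebius_F U \<and> germ_id U \<and> lhs U = p \<and> rhs U = p" if "heun_ok p" for p
    using moebius_F.ident[OF that] by - (rule exI, rule conjI, assumption, auto simp: germ_id_def)
  obtain U where U: "moebius_F U" "germ_id U" "lhs U = p" "h_a (rhs U) = h_a p" "h_ga (rhs U) = h_ga p"
     "h_de (rhs U) = d" "h_ep (rhs U) = h_ep p"
    using d id[OF p] flip_exponent_at_1[OF p] by auto
  have ok: "heun_ok (rhs U)" using moebius_F_heun_ok[OF U(1)] by blast
  obtain V where V: "moebius_F V" "germ_id V" "lhs V = rhs U" "h_a (rhs V) = h_a p" "h_ga (rhs V) = h_ga p"
     "h_de (rhs V) = d" "h_ep (rhs V) = e"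
    using e id[OF ok] flip_exponent_at_a[OF ok] U by auto
  show ?thesis
    using U V moebius_F.comp[OF U(1) V(1)] germ_id_comp[OF U(2) V(2) U(1)]
    by (intro exI[of _ "hl_comp U V"]) (auto simp: hl_comp_def)
qed

text \<open>
  Given \<open>\<gamma>\<close>, \<open>\<delta>\<close> and \<open>\<epsilon>\<close>, the equation determines the sum and the product of \<open>\<alpha>\<close> and \<open>\<beta>\<close>, so only
  their interchange is left.
\<close>

lemma same_heun:
  assumes p: "heun_ok p" and eq: "h_a p = h_a r" "h_q p = h_q r" "h_ga p = h_ga r" "h_de p = h_de r" "h_ep p = h_ep r"
    "h_al p * h_be p = h_al r * h_be r"
  shows "\<exists>U. moebius_F U \<and> germ_id U \<and> lhs U = p \<and> rhs U = r"
proof -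
  obtain a q \<alpha> \<beta> \<gamma> \<delta> where P: "p = Heun a q \<alpha> \<beta> \<gamma> \<delta>" by (cases p)
  obtain a' q' \<alpha>' \<beta>' \<gamma>' \<delta>' where R: "r = Heun a' q' \<alpha>' \<beta>' \<gamma>' \<delta>'" by (cases r)
  have s: "\<alpha> + \<beta> = \<alpha>' + \<beta>'" "\<alpha> * \<beta> = \<alpha>' * \<beta>'" using eq by (auto simp: P R h_ep_def algebra_simps)
  have "(\<alpha>' - \<alpha>) * (\<alpha>' - \<beta>) = 0" using s by algebra
  hence "(\<alpha>' = \<alpha> \<and> \<beta>' = \<beta>) \<or> (\<alpha>' = \<beta> \<and> \<beta>' = \<alpha>)" using s(1) by auto
  hence "r = p \<or> r = Heun a q \<beta> \<alpha> \<gamma> \<delta>" using eq by (auto simp: P R)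
  thus ?thesis
  proof
    assume "r = p" thus ?thesis
      using moebius_F.ident[OF p] by - (rule exI, rule conjI, assumption, auto simp: germ_id_def)
  next
    assume "r = Heun a q \<beta> \<alpha> \<gamma> \<delta>" thus ?thesis
      using moebius_F.swap[OF p[unfolded P]] by - (rule exI, rule conjI, assumption, auto simp: germ_id_def P)
  qed
qed

text \<open>
  A gauge change between two Heun equations with the same singular points that is regular at \<open>0\<close> has
  logarithmic derivative \<open>d / (x - 1) + e / (x - a)\<close>. The absence of double poles in the second
  coefficient leaves \<open>d \<in> {0, \<delta> - 1}\<close> with the \<open>\<delta>\<close> of \<open>r\<close>, and likewise at \<open>a\<close>: these are the shifts made by F-homotopic
  transformations.
\<close>

lemma gauge_equivalent_heun:
  assumes p: "heun_ok p" and r: "heun_ok r" and a: "h_a p = h_a r"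
    and L: "L analytic_on {0}" and eq: "ode_eq_at 0 (twist L (heun_ode r)) (heun_ode p)"
  shows "\<exists>U. moebius_F U \<and> germ_id U \<and> lhs U = p \<and> rhs U = r"
proof -
  have a0: "h_a r \<noteq> 0" "h_a r \<noteq> 1" using r by (auto simp: heun_ok_def)
  define d e where "d = (h_de r - h_de p) / 2" and "e = (h_ep r - h_ep p) / 2"
  have P: "\<forall>\<^sub>F x in at 0. 2 * L x = (h_ga r - h_ga p) / x + 2 * d / (x - 1) + 2 * e / (x - h_a r)"
    using eq unfolding ode_eq_at_def
    by eventually_elim (simp add: twist_def heun_ode_def a d_def e_def diff_divide_distrib algebra_simps)
  have ga: "h_ga r = h_ga p"
  proof -
    have "(L \<longlongrightarrow> L 0) (at 0)" using L analytic_at_imp_isCont isCont_def by blast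
    hence "((\<lambda>x. x * (2 * L x - 2 * d / (x - 1) - 2 * e / (x - h_a r))) \<longlongrightarrow> 0 * (2 * L 0 - 2 * d / (0 - 1) - 2 * e / (0 - h_a r))) (at 0)"
      using a0 by (intro tendsto_intros) auto
    moreover have "\<forall>\<^sub>F x in at 0. x * (2 * L x - 2 * d / (x - 1) - 2 * e / (x - h_a r)) = h_ga r - h_ga p"
      using P eventually_neq_at_within[of 0 0] by eventually_elim simp
    hence "((\<lambda>x. x * (2 * L x - 2 * d / (x - 1) - 2 * e / (x - h_a r))) \<longlongrightarrow> h_ga r - h_ga p) (at 0)"
      by (rule tendsto_eventually)
    ultimately have "h_ga r - h_ga p = 0 * (2 * L 0 - 2 * d / (0 - 1) - 2 * e / (0 - h_a r))"
      using tendsto_unique trivial_limit_at by blast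
    thus ?thesis by simp
  qed
  have Leq: "\<forall>\<^sub>F x in at 0. L x = d / (x - 1) + e / (x - h_a r)"
    using P by eventually_elim (simp add: ga, metis (no_types, opaque_lifting) distrib_left mult_cancel_left times_divide_eq_right zero_neq_numeral)
  \<comment> \<open>The equation between the second coefficients, multiplied by \<open>x (x - 1)\<^sup>2 (x - a)\<^sup>2\<close>; up to nonzero factors, its
    values at \<open>1\<close> and \<open>a\<close> are the coefficients of the double poles.\<close>
  define g where "g = (\<lambda>x. (h_al p * h_be p * x - h_q p) * (x - 1) * (x - h_a r)
    - ((h_al r * h_be r * x - h_q r) * (x - 1) * (x - h_a r)
       - (h_ga r * ((x - 1) * (x - h_a r)) + h_de r * (x * (x - h_a r)) + h_ep r * (x * (x - 1))) * (d * (x - h_a r) + e * (x - 1))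
       + x * (d * (x - h_a r)\<^sup>2 + e * (x - 1)\<^sup>2) + x * (d * (x - h_a r) + e * (x - 1))\<^sup>2))"
  have "\<forall>\<^sub>F x in at 0. g x = 0"
    using eventually_deriv_eq[OF Leq] eq[unfolded ode_eq_at_def] eventually_at_0_generic[OF a0(1)]
  proof eventually_elim
    case (elim x)
    have nz: "x \<noteq> 0" "x - 1 \<noteq> 0" "x - h_a r \<noteq> 0" using elim by auto
    have "((\<lambda>x. d / (x - 1) + e / (x - h_a r)) has_field_derivative (- d / (x - 1)\<^sup>2 - e / (x - h_a r)\<^sup>2)) (at x)"
      using nz by (auto intro!: derivative_eq_intros simp: power2_eq_square)
    hence dL: "deriv L x = - d / (x - 1)\<^sup>2 - e / (x - h_a r)\<^sup>2"
      using elim DERIV_imp_deriv by metis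
    have "snd (twist L (heun_ode r)) x = snd (heun_ode p) x" using elim by blast
    hence "(h_al r * h_be r * x - h_q r) / (x * (x - 1) * (x - h_a r))
        - (h_ga r / x + h_de r / (x - 1) + h_ep r / (x - h_a r)) * (d / (x - 1) + e / (x - h_a r))
        - (- d / (x - 1)\<^sup>2 - e / (x - h_a r)\<^sup>2) + (d / (x - 1) + e / (x - h_a r))\<^sup>2
        = (h_al p * h_be p * x - h_q p) / (x * (x - 1) * (x - h_a r))"
      using elim dL by (simp add: twist_def heun_ode_def a)
    thus "g x = 0" unfolding g_def using nz by (simp add: divide_simps power2_eq_square) algebra
  qed
  moreover have "g holomorphic_on UNIV" unfolding g_def by (intro holomorphic_intros)
  ultimately have g: "g x = 0" for x using entire_eventually_zero by blast
  have "d * (d + 1 - h_de r) * (1 - h_a r)\<^sup>2 = - g 1" by (simp add: g_def algebra_simps power2_eq_square)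
  hence "d * (d + 1 - h_de r) * (1 - h_a r)\<^sup>2 = 0" by (simp only: g minus_zero)
  hence "d = 0 \<or> d + 1 - h_de r = 0" using a0 by simp
  hence d': "h_de r \<in> {h_de p, 2 - h_de p}" unfolding d_def by (auto simp: field_simps)
  have "e * (e + 1 - h_ep r) * (h_a r - 1)\<^sup>2 * h_a r = - g (h_a r)" by (simp add: g_def algebra_simps power2_eq_square)
  hence "e * (e + 1 - h_ep r) * (h_a r - 1)\<^sup>2 * h_a r = 0" by (simp only: g minus_zero)
  hence "e = 0 \<or> e + 1 - h_ep r = 0" using a0 by simp
  hence e': "h_ep r \<in> {h_ep p, 2 - h_ep p}" unfolding e_def by (auto simp: field_simps)
  obtain V where V: "moebius_F V" "germ_id V" "lhs V = p" "h_a (rhs V) = h_a p" "h_ga (rhs V) = h_ga p"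
     "h_de (rhs V) = h_de r" "h_ep (rhs V) = h_ep r"
    using normalize_exponents[OF p d' e'] by blast
  define s where "s = rhs V"
  define M where "M = (\<lambda>x. deriv (pref V) x / pref V x)"
  have lV: "local_lift V" using V(1) local_lift_moebius_F by blast
  have "ode_eq_at 0 (pullback (arg V) (heun_ode s)) (pullback (\<lambda>x. x) (heun_ode s))"
    using V(2) local_lift_filterlim(1)[OF lV] unfolding germ_id_def
    by (intro pullback_cong[OF ode_eq_at_refl]) (auto simp: eventually_nhds_conv_at)
  also have "pullback (\<lambda>x. x) (heun_ode s) = heun_ode s" by (simp add: pullback_def)
  finally have "ode_eq_at 0 (twist M (pullback (arg V) (heun_ode s))) (twist M (heun_ode s))"
    by (rule twist_cong) simp
  hence M: "ode_eq_at 0 (twist M (heun_ode s)) (twist L (heun_ode r))"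
    using lV[unfolded local_lift_def] eq V(3) ode_eq_at_sym ode_eq_at_trans unfolding s_def M_def by metis
  have fst_eq: "fst (heun_ode s) = fst (heun_ode r)"
    using V ga a by (simp add: heun_ode_def s_def)
  have LM: "\<forall>\<^sub>F x in at 0. M x = L x"
    using M unfolding ode_eq_at_def by eventually_elim (simp add: twist_def fst_eq)
  \<comment> \<open>Now the first coefficients agree, so the two gauges agree, and then the second coefficients do.\<close>
  define k where "k = (\<lambda>x. (h_al s * h_be s * x - h_q s) - (h_al r * h_be r * x - h_q r))"
  have "\<forall>\<^sub>F x in at 0. k x = 0"
    using eventually_deriv_eq[OF LM] M[unfolded ode_eq_at_def] eventually_at_0_generic[OF a0(1)]
  proof eventually_elim
    case (elim x)
    have "snd (heun_ode s) x = snd (heun_ode r) x"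
      using elim by (simp add: twist_def fst_eq)
    thus ?case using elim V(4) by (simp add: heun_ode_def k_def s_def a)
  qed
  moreover have "k holomorphic_on UNIV" unfolding k_def by (intro holomorphic_intros)
  ultimately have k: "k x = 0" for x using entire_eventually_zero by blast
  have q: "h_q s = h_q r" using k[of 0] by (simp add: k_def)
  have "h_al s * h_be s = h_al r * h_be r" using k[of 1] q by (simp add: k_def)
  then obtain W where W: "moebius_F W" "germ_id W" "lhs W = s" "rhs W = r"
    using same_heun[of s r] V ga a q moebius_F_heun_ok[OF V(1)] unfolding s_def by auto
  show ?thesis
    using V W moebius_F.comp[OF V(1) W(1)] germ_id_comp[OF V(2) W(2) V(1)]
    by (intro exI[of _ "hl_comp V W"]) (auto simp: hl_comp_def s_def)
qed

section \<open>Fibres of rational maps of degree two\<close>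

text \<open>
  The zeros on the Riemann sphere of a polynomial of degree at most two, viewed as a binary quadratic
  form: \<open>\<infinity>\<close> is a zero if the leading coefficient is missing. The discriminant \<open>qdisc\<close> is that of the
  form, too, and vanishes for a double zero at \<open>\<infinity>\<close>.
\<close>

definition fibre :: "complex poly \<Rightarrow> cpoint set" where
  "fibre F = {z. case z of Fin u \<Rightarrow> poly F u = 0 | Infty \<Rightarrow> coeff F 2 = 0}"

definition qdisc :: "complex poly \<Rightarrow> complex" where
  "qdisc F = (coeff F 1)\<^sup>2 - 4 * coeff F 2 * coeff F 0"

lemma Fin_in_fibre [simp]: "Fin u \<in> fibre F \<longleftrightarrow> poly F u = 0"
  and Infty_in_fibre [simp]: "Infty \<in> fibre F \<longleftrightarrow> coeff F 2 = 0"
  by (simp_all add: fibre_def)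

lemma poly_quadratic:
  assumes "degree (F :: complex poly) \<le> 2"
  shows "poly F x = coeff F 2 * x\<^sup>2 + coeff F 1 * x + coeff F 0"
    and "poly (pderiv F) x = 2 * coeff F 2 * x + coeff F 1"
proof -
  have F: "F = [:coeff F 0, coeff F 1, coeff F 2:]"
  proof (rule poly_eqI)
    fix n show "coeff F n = coeff [:coeff F 0, coeff F 1, coeff F 2:] n"
      using assms by (cases "n \<le> 2") (auto simp: coeff_pCons coeff_eq_0 numeral_2_eq_2 split: nat.splits)
  qed
  show "poly F x = coeff F 2 * x\<^sup>2 + coeff F 1 * x + coeff F 0"
    by (subst F) (simp add: algebra_simps power2_eq_square)
  show "poly (pderiv F) x = 2 * coeff F 2 * x + coeff F 1"
    by (subst F) (simp add: pderiv_pCons algebra_simps)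
qed

lemma degree_fibre_poly:
  "max (degree N) (degree D) = 2 \<Longrightarrow> degree (fibre_poly N D v) \<le> 2"
  by (auto simp: fibre_poly_def split: cpoint.splits
      intro!: degree_diff_le order.trans[OF degree_smult_le])

lemma fibre_two_points:
  assumes "degree F \<le> 2" "qdisc F \<noteq> 0"
  shows "\<exists>p q. p \<noteq> q \<and> fibre F = {p, q}"
proof (cases "coeff F 2 = 0")
  case True
  hence c1: "coeff F 1 \<noteq> 0" using assms by (auto simp: qdisc_def)
  have "fibre F = {Infty, Fin (- coeff F 0 / coeff F 1)}"
  proof (rule set_eqI)
    fix z show "z \<in> fibre F \<longleftrightarrow> z \<in> {Infty, Fin (- coeff F 0 / coeff F 1)}"
      using True c1 by (cases z) (auto simp: poly_quadratic[OF assms(1)] field_simps add_eq_0_iff2)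
  qed
  thus ?thesis by blast
next
  case False
  \<comment> \<open>The quadratic formula: \<open>4 c\<^sub>2 F\<close> is a product of two linear factors.\<close>
  define s where "s = csqrt (qdisc F)"
  have s: "s\<^sup>2 = qdisc F" "s \<noteq> 0" using assms by (auto simp: s_def)
  have *: "4 * coeff F 2 * poly F u = (2 * coeff F 2 * u + coeff F 1 - s) * (2 * coeff F 2 * u + coeff F 1 + s)" for u
    using s(1) unfolding poly_quadratic[OF assms(1)] qdisc_def by algebra
  have "fibre F = {Fin ((s - coeff F 1) / (2 * coeff F 2)), Fin ((- s - coeff F 1) / (2 * coeff F 2))}"
  proof (rule set_eqI)
    fix z show "z \<in> fibre F \<longleftrightarrow> z \<in> {Fin ((s - coeff F 1) / (2 * coeff F 2)), Fin ((- s - coeff F 1) / (2 * coeff F 2))}"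
    proof (cases z)
      case (Fin u)
      have "poly F u = 0 \<longleftrightarrow> 4 * coeff F 2 * poly F u = 0" using False by simp
      also have "\<dots> \<longleftrightarrow> u = (s - coeff F 1) / (2 * coeff F 2) \<or> u = (- s - coeff F 1) / (2 * coeff F 2)"
      proof -
        have "2 * coeff F 2 * u + coeff F 1 - s = 0 \<longleftrightarrow> u = (s - coeff F 1) / (2 * coeff F 2)"
          "2 * coeff F 2 * u + coeff F 1 + s = 0 \<longleftrightarrow> u = (- s - coeff F 1) / (2 * coeff F 2)"
          using False by (simp_all add: eq_divide_eq) algebra+
        thus ?thesis unfolding * mult_eq_0_iff by simp
      qed
      finally show ?thesis by (simp add: Fin)
    qed (use False in simp)
  qed
  moreover have "(s - coeff F 1) / (2 * coeff F 2) \<noteq> (- s - coeff F 1) / (2 * coeff F 2)"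
    using s(2) False by simp
  ultimately show ?thesis by (intro exI conjI) auto
qed

lemma qdisc_nonzero_simple:
  assumes "degree F \<le> 2" "qdisc F \<noteq> 0"
  shows "poly F u = 0 \<Longrightarrow> poly (pderiv F) u \<noteq> 0" and "coeff F 2 = 0 \<Longrightarrow> coeff F 1 \<noteq> 0"
proof -
  assume "poly F u = 0"
  moreover have "qdisc F = (poly (pderiv F) u)\<^sup>2 - 4 * coeff F 2 * poly F u"
    unfolding poly_quadratic[OF assms(1)] qdisc_def by algebra
  ultimately show "poly (pderiv F) u \<noteq> 0" using assms by auto
qed (use assms in \<open>auto simp: qdisc_def\<close>)

text \<open>
  Over \<open>\<infinity>\<close> the coordinate on the target is the inverse of the variable.
\<close>

lemma removable_pullback_pole:
  assumes S: "S analytic_on {z}" "S z = 0" "deriv S z \<noteq> 0" and R: "\<forall>\<^sub>F x in at z. R x = inverse (S x)"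
  shows "removable (pullback R E) z \<longleftrightarrow> removable (pullback inverse E) 0"
proof -
  have "\<forall>\<^sub>F x in at z. S analytic_on {x} \<and> deriv S x \<noteq> 0"
    using analytic_at_eventually[OF S(1)] eventually_deriv_nonzero[OF S(1,3)]
    by (auto simp: eventually_nhds_conv_at intro: eventually_conj)
  moreover have "\<forall>\<^sub>F x in at z. S x \<noteq> 0"
    using analytic_at_filterlim_at[OF S(1,3)] S(2) by (simp add: filterlim_at)
  ultimately have "ode_eq_at z (pullback S (pullback inverse E)) (pullback (\<lambda>x. inverse (S x)) E)"
    unfolding ode_eq_at_def
  proof eventually_elim
    case (elim x)
    have "deriv inverse (S x) = - (inverse (S x) ^ Suc (Suc 0))"
      using DERIV_inverse[of "S x"] elim by (intro DERIV_imp_deriv) simp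
    thus ?case using elim by (intro pullback_compose) (auto intro!: analytic_intros)
  qed
  also have "ode_eq_at z \<dots> (pullback R E)"
    unfolding ode_eq_at_def pullback_def using eventually_deriv_eq[OF R] by eventually_elim simp
  finally have "removable (pullback R E) z \<longleftrightarrow> removable (pullback S (pullback inverse E)) z"
    using removable_cong by metis
  thus ?thesis using removable_pullback[OF S(1,3)] S(2) by simp
qed

lemma rational_deriv:
  assumes "poly D u \<noteq> 0"
  shows "(\<lambda>x. poly N x / poly D x) analytic_on {u :: complex}"
    and "deriv (\<lambda>x. poly N x / poly D x) u
      = (poly (pderiv N) u * poly D u - poly N u * poly (pderiv D) u) / (poly D u)\<^sup>2"
proof -
  have "poly P analytic_on {u}" for P :: "complex poly"
    by (rule holomorphic_on_imp_analytic_at[of _ UNIV]) (auto intro: holomorphic_intros)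
  thus "(\<lambda>x. poly N x / poly D x) analytic_on {u :: complex}"
    using assms by (intro analytic_intros) auto
  show "deriv (\<lambda>x. poly N x / poly D x) u
      = (poly (pderiv N) u * poly D u - poly N u * poly (pderiv D) u) / (poly D u)\<^sup>2"
    unfolding power2_eq_square
    by (rule DERIV_imp_deriv[OF DERIV_divide[OF poly_DERIV poly_DERIV assms]])
qed

text \<open>
  At a simple zero of \<open>N - v D\<close> the map \<open>N / D\<close>, or its reciprocal if \<open>v = \<infinity>\<close>, is a local coordinate.
\<close>

lemma removable_fibre_finite:
  assumes uv: "poly N u \<noteq> 0 \<or> poly D u \<noteq> 0"
    and root: "poly (fibre_poly N D v) u = 0" and simple: "poly (pderiv (fibre_poly N D v)) u \<noteq> 0"
  shows "removable (pullback (\<lambda>x. poly N x / poly D x) E) u \<longleftrightarrow> v \<notin> sing_pts E"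
proof (cases v)
  case (Fin y)
  hence N: "poly N u = y * poly D u" using root by (simp add: fibre_poly_def)
  hence D: "poly D u \<noteq> 0" using uv by auto
  have "(poly (pderiv N) u * poly D u - poly N u * poly (pderiv D) u) / (poly D u)\<^sup>2
      = poly (pderiv (fibre_poly N D v)) u / poly D u"
    using D by (simp add: N Fin fibre_poly_def pderiv_diff pderiv_smult power2_eq_square field_simps)
  hence "deriv (\<lambda>x. poly N x / poly D x) u \<noteq> 0"
    using simple D by (simp add: rational_deriv(2)[OF D])
  from removable_pullback[OF rational_deriv(1)[OF D] this] N D show ?thesis
    by (simp add: Fin sing_pts_iff)
next
  case Infty
  hence D: "poly D u = 0" "poly (pderiv D) u \<noteq> 0" using root simple by (auto simp: fibre_poly_def)
  hence N: "poly N u \<noteq> 0" using uv by auto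
  have "deriv (\<lambda>x. poly D x / poly N x) u \<noteq> 0"
    unfolding rational_deriv(2)[OF N] using D N by simp
  from removable_pullback_pole[OF rational_deriv(1)[OF N] _ this] D show ?thesis
    by (simp add: Infty sing_pts_iff)
qed

text \<open>
  Unramified points: there the map is a local coordinate, once the coordinate \<open>1/x\<close> is used at \<open>\<infinity>\<close>. The point
  \<open>\<infinity>\<close> of the source is reduced to \<open>0\<close> by reversing the coefficients of the two polynomials.
\<close>

lemma sing_pts_fibre:
  assumes cop: "coprime N D" and deg: "max (degree N) (degree D) = 2"
    and z: "z \<in> fibre (fibre_poly N D v)" and disc: "qdisc (fibre_poly N D v) \<noteq> 0"
  shows "z \<in> sing_pts (pullback (\<lambda>x. poly N x / poly D x) E) \<longleftrightarrow> v \<in> sing_pts E"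
proof -
  let ?F = "fibre_poly N D v"
  have dN: "degree N \<le> 2" and dD: "degree D \<le> 2" using deg by auto
  have dF: "degree ?F \<le> 2" by (rule degree_fibre_poly[OF deg])
  note simple = qdisc_nonzero_simple[OF dF disc]
  show ?thesis
  proof (cases z)
    case (Fin u)
    have "poly N u \<noteq> 0 \<or> poly D u \<noteq> 0" using cop coprime_poly_0 by blast
    from removable_fibre_finite[OF this, of v] show ?thesis
      using z simple by (simp add: Fin sing_pts_iff)
  next
    case Infty
    have c: "coeff ?F 2 = 0" "coeff ?F 1 \<noteq> 0" using z simple by (auto simp: Infty)
    have lead: "coeff N 2 \<noteq> 0 \<or> coeff D 2 \<noteq> 0"
      using deg by (metis coeff_0 degree_0 leading_coeff_0_iff max_def zero_neq_numeral)
    define refl where "refl = (\<lambda>P :: complex poly. [:coeff P 2, coeff P 1, coeff P 0:])"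
    have refl: "poly (refl P) t = t\<^sup>2 * poly P (inverse t)" if "degree P \<le> 2" "t \<noteq> 0" for P t
      using that(2) unfolding refl_def poly_quadratic[OF that(1)] by (simp add: field_simps power2_eq_square)
    have reflF: "fibre_poly (refl N) (refl D) v = refl ?F"
      by (auto simp: fibre_poly_def refl_def split: cpoint.splits)
    \<comment> \<open>The numerator of the derivative of \<open>N / D\<close>. It is not the zero polynomial, so the map is
      unramified at all finite points near \<open>\<infinity>\<close>, as the chain rule requires.\<close>
    define W where "W = pderiv N * D - N * pderiv D"
    define B where "B = {x. poly W x = 0} \<union> {x. poly D x = 0}"
    have "coeff W 2 = coeff N 2 * coeff D 1 - coeff N 1 * coeff D 2"
      using dN dD
      by (simp add: W_def coeff_mult coeff_pderiv numeral_2_eq_2 coeff_eq_0)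
    hence "W \<noteq> 0" using c lead
      by (cases v) (auto simp: fibre_poly_def algebra_simps)
    moreover have "D \<noteq> 0"
    proof
      assume "D = 0"
      hence "is_unit N" using cop by simp
      hence "degree N = 0" by (metis is_unit_iff_degree not_is_unit_0)
      thus False using deg \<open>D = 0\<close> by simp
    qed
    ultimately have "finite B" unfolding B_def by (simp add: poly_roots_finite)
    hence "finite (inverse ` B)" by simp
    hence "\<forall>\<^sub>F t in cofinite. t \<notin> inverse ` B" by (simp add: eventually_cofinite)
    hence "\<forall>\<^sub>F t in at 0. t \<notin> inverse ` B" by (rule eventually_cofinite_imp_at)
    hence ev: "\<forall>\<^sub>F t in at 0. inverse t \<notin> B" by eventually_elim (metis imageI inverse_inverse_eq)
    have "ode_eq_at 0 (pullback inverse (pullback (\<lambda>x. poly N x / poly D x) E))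
        (pullback (\<lambda>t. poly N (inverse t) / poly D (inverse t)) E)"
      unfolding ode_eq_at_def using ev eventually_neq_at_within[of 0 0 UNIV]
    proof eventually_elim
      case (elim t)
      have "deriv inverse t = - (inverse t ^ Suc (Suc 0))"
        using DERIV_inverse[of t] elim by (intro DERIV_imp_deriv) simp
      moreover have D: "poly D (inverse t) \<noteq> 0" and W: "poly W (inverse t) \<noteq> 0" using elim by (auto simp: B_def)
      moreover have "deriv (\<lambda>x. poly N x / poly D x) (inverse t) \<noteq> 0"
        using W D unfolding rational_deriv(2)[OF D] by (simp add: W_def)
      ultimately show ?case using elim rational_deriv(1)[OF D]
        by (intro pullback_compose[of inverse t "\<lambda>x. poly N x / poly D x"]) (auto intro!: analytic_intros)
    qed
    also have "ode_eq_at 0 \<dots> (pullback (\<lambda>t. poly (refl N) t / poly (refl D) t) E)"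
    proof -
      have "\<forall>\<^sub>F t in at 0. poly N (inverse t) / poly D (inverse t) = poly (refl N) t / poly (refl D) t"
        using eventually_neq_at_within[of 0 0 UNIV] by eventually_elim (simp add: refl[OF dN] refl[OF dD])
      from eventually_deriv_eq[OF this] show ?thesis
        unfolding ode_eq_at_def pullback_def by eventually_elim simp
    qed
    finally have "removable (pullback inverse (pullback (\<lambda>x. poly N x / poly D x) E)) 0
       \<longleftrightarrow> removable (pullback (\<lambda>t. poly (refl N) t / poly (refl D) t) E) 0"
      using removable_cong by metis
    also have "\<dots> \<longleftrightarrow> v \<notin> sing_pts E"
    proof (rule removable_fibre_finite)
      show "poly (refl N) 0 \<noteq> 0 \<or> poly (refl D) 0 \<noteq> 0" using lead by (simp add: refl_def)
      show "poly (fibre_poly (refl N) (refl D) v) 0 = 0" "poly (pderiv (fibre_poly (refl N) (refl D) v)) 0 \<noteq> 0"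
        unfolding reflF using c by (simp_all add: refl_def pderiv_pCons)
    qed
    finally show ?thesis by (simp add: Infty sing_pts_iff)
  qed
qed

lemma fibres_disjoint:
  assumes cop: "coprime N D" and deg: "max (degree N) (degree D) = 2" and vw: "v \<noteq> w"
  shows "fibre (fibre_poly N D v) \<inter> fibre (fibre_poly N D w) = {}"
proof -
  have lead: "coeff N 2 \<noteq> 0 \<or> coeff D 2 \<noteq> 0"
    using deg by (metis coeff_0 degree_0 leading_coeff_0_iff max_def zero_neq_numeral)
  have "\<not> (z \<in> fibre (fibre_poly N D v) \<and> z \<in> fibre (fibre_poly N D w))" for z
  proof (cases z)
    case (Fin u)
    have "poly N u \<noteq> 0 \<or> poly D u \<noteq> 0" using cop coprime_poly_0 by blast
    thus ?thesis using vw by (auto simp: Fin fibre_poly_def split: cpoint.splits)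
  next
    case Infty
    thus ?thesis using vw lead by (auto simp: fibre_poly_def split: cpoint.splits)
  qed
  thus ?thesis by blast
qed

section \<open>The lift by the quadratic map\<close>

text \<open>
  With \<open>g\<close> and \<open>k\<close> as leading coefficients, the indicial equation at \<open>z\<close> is \<open>s\<^sup>2 + (g - 1) s + k = 0\<close>. Exponents
  that differ by \<open>1\<close>, as removability requires, mean that its discriminant \<open>(g - 1)\<^sup>2 - 4 k\<close> is \<open>1\<close>.
\<close>

lemma removable_indicial:
  assumes rem: "removable E z"
    and P: "((\<lambda>x. (x - z) * fst E x) \<longlongrightarrow> g) (at z)" and Q: "((\<lambda>x. (x - z)\<^sup>2 * snd E x) \<longlongrightarrow> k) (at z)"
  shows "4 * k + 2 * g - g\<^sup>2 = 0"
proof -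
  obtain c where "ordinary_at (twist (\<lambda>x. c / (x - z)) E) z" using rem by (auto simp: removable_def)
  then obtain P0 Q0 where PQ: "P0 analytic_on {z}" "Q0 analytic_on {z}"
    and ev: "\<forall>\<^sub>F x in at z. fst (twist (\<lambda>x. c / (x - z)) E) x = P0 x \<and> snd (twist (\<lambda>x. c / (x - z)) E) x = Q0 x"
    unfolding ordinary_at_def by blast
  have lim: "(P0 \<longlongrightarrow> P0 z) (at z)" "(Q0 \<longlongrightarrow> Q0 z) (at z)"
    using PQ analytic_at_imp_isCont isCont_def by blast+
  have "((\<lambda>x. (x - z) * P0 x + 2 * c) \<longlongrightarrow> (z - z) * P0 z + 2 * c) (at z)"
    by (intro tendsto_intros lim)
  moreover have "\<forall>\<^sub>F x in at z. (x - z) * P0 x + 2 * c = (x - z) * fst E x"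
    using ev eventually_neq_at_within[of z z UNIV]
  proof eventually_elim
    case (elim x)
    hence "fst E x = P0 x + 2 * c / (x - z)" by (simp add: twist_def diff_eq_eq)
    thus ?case using elim by (simp add: distrib_left)
  qed
  ultimately have "((\<lambda>x. (x - z) * fst E x) \<longlongrightarrow> (z - z) * P0 z + 2 * c) (at z)"
    by (rule Lim_transform_eventually)
  hence g: "g = 2 * c" using tendsto_unique[OF _ P] by simp
  have "((\<lambda>x. (x - z)\<^sup>2 * Q0 x + (x - z) * fst E x * c - c - c\<^sup>2) \<longlongrightarrow> (z - z)\<^sup>2 * Q0 z + g * c - c - c\<^sup>2) (at z)"
    by (intro tendsto_intros lim P)
  moreover have "\<forall>\<^sub>F x in at z. (x - z)\<^sup>2 * Q0 x + (x - z) * fst E x * c - c - c\<^sup>2 = (x - z)\<^sup>2 * snd E x"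
    using ev eventually_neq_at_within[of z z UNIV]
  proof eventually_elim
    case (elim x)
    hence xz: "x - z \<noteq> 0" by simp
    have "((\<lambda>x. c / (x - z)) has_field_derivative - c / (x - z)\<^sup>2) (at x)"
      using xz by (auto intro!: derivative_eq_intros simp: power2_eq_square)
    hence "deriv (\<lambda>x. c / (x - z)) x = - c / (x - z)\<^sup>2" by (rule DERIV_imp_deriv)
    hence "Q0 x = snd E x - fst E x * (c / (x - z)) + c / (x - z)\<^sup>2 + (c / (x - z))\<^sup>2"
      using elim by (simp add: twist_def)
    moreover have "y\<^sup>2 * (s - p * (c / y) + c / y\<^sup>2 + (c / y)\<^sup>2) = y\<^sup>2 * s - y * p * c + c + c\<^sup>2"
      if "y \<noteq> 0" for y s p :: complex
      using that by (simp add: divide_simps power2_eq_square) algebra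
    ultimately show ?case using xz by simp
  qed
  ultimately have "((\<lambda>x. (x - z)\<^sup>2 * snd E x) \<longlongrightarrow> (z - z)\<^sup>2 * Q0 z + g * c - c - c\<^sup>2) (at z)"
    by (rule Lim_transform_eventually)
  hence "k = g * c - c - c\<^sup>2" using tendsto_unique[OF _ Q] by simp
  with g show ?thesis by algebra
qed

lemma heun_ordinary_at:
  assumes "z \<notin> {0, 1, h_a p}"
  shows "ordinary_at (heun_ode p) z"
  unfolding ordinary_at_def
proof (intro exI conjI)
  show "fst (heun_ode p) analytic_on {z}" "snd (heun_ode p) analytic_on {z}"
    unfolding heun_ode_def fst_conv snd_conv using assms by (auto intro!: analytic_intros)
qed simp

lemma sing_pts_heun_subset: "sing_pts (heun_ode p) \<subseteq> {Fin 0, Fin 1, Fin (h_a p), Infty}"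
proof
  fix v assume v: "v \<in> sing_pts (heun_ode p)"
  show "v \<in> {Fin 0, Fin 1, Fin (h_a p), Infty}"
  proof (cases v)
    case (Fin z)
    have "z \<in> {0, 1, h_a p}"
    proof (rule ccontr)
      assume "z \<notin> {0, 1, h_a p}"
      from ordinary_at_imp_removable[OF heun_ordinary_at[OF this]] show False
        using v by (simp add: Fin sing_pts_iff)
    qed
    thus ?thesis by (auto simp: Fin)
  qed auto
qed

text \<open>
  All four exponent differences are \<open>1/2\<close> up to sign, while a removable point has exponent difference \<open>1\<close> up to sign.
\<close>

lemma four_singular_example:
  assumes "a \<noteq> 0" "a \<noteq> 1"
  shows "four_singular (Heun a q (1 / 2) 0 (1 / 2) (1 / 2))"
proof -
  define E where "E = heun_ode (Heun a q (1 / 2) 0 (1 / 2) (1 / 2))"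
  have E: "fst E = (\<lambda>x. (1 / 2) / x + (1 / 2) / (x - 1) + (1 / 2) / (x - a))"
     "snd E = (\<lambda>x. - q / (x * (x - 1) * (x - a)))"
    by (simp_all add: E_def heun_ode_def h_ep_def fun_eq_iff)
  have no: "\<not> removable F z" if "((\<lambda>x. (x - z) * fst F x) \<longlongrightarrow> 1 / 2) (at z)"
     "((\<lambda>x. (x - z)\<^sup>2 * snd F x) \<longlongrightarrow> 0) (at z)" for F z
    using removable_indicial[OF _ that] by (auto simp: power2_eq_square)
  have split: "(f \<longlongrightarrow> g z) (at z)" if "isCont g z" "\<And>x. x \<noteq> z \<Longrightarrow> x \<notin> B \<Longrightarrow> f x = g x" "finite B" "z \<notin> B"
    for f g :: "complex \<Rightarrow> complex" and z B
  proof -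
    have "\<forall>\<^sub>F x in at z. x \<notin> B"
      using that(3) by (intro eventually_cofinite_imp_at) (simp add: eventually_cofinite)
    hence "\<forall>\<^sub>F x in at z. g x = f x"
      using eventually_neq_at_within[of z z UNIV] by eventually_elim (use that(2) in auto)
    from tendsto_cong[OF this] show ?thesis using that(1) by (simp add: isCont_def)
  qed
  have 0: "\<not> removable E 0"
  proof (rule no)
    show "((\<lambda>x. (x - 0) * fst E x) \<longlongrightarrow> 1 / 2) (at 0)"
      using split[of 0 "\<lambda>x. 1 / 2 + x * ((1 / 2) / (x - 1) + (1 / 2) / (x - a))" "{}" "\<lambda>x. (x - 0) * fst E x"] assms
      by (auto simp: E distrib_left intro!: continuous_intros)
    show "((\<lambda>x. (x - 0)\<^sup>2 * snd E x) \<longlongrightarrow> 0) (at 0)"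
      using split[of 0 "\<lambda>x. x * (- q / ((x - 1) * (x - a)))" "{}" "\<lambda>x. (x - 0)\<^sup>2 * snd E x"] assms
      by (auto simp: E power2_eq_square intro!: continuous_intros)
  qed
  have 1: "\<not> removable E 1"
  proof (rule no)
    show "((\<lambda>x. (x - 1) * fst E x) \<longlongrightarrow> 1 / 2) (at 1)"
      using split[of 1 "\<lambda>x. 1 / 2 + (x - 1) * ((1 / 2) / x + (1 / 2) / (x - a))" "{}" "\<lambda>x. (x - 1) * fst E x"] assms
      by (auto simp: E distrib_left intro!: continuous_intros)
    show "((\<lambda>x. (x - 1)\<^sup>2 * snd E x) \<longlongrightarrow> 0) (at 1)"
      using split[of 1 "\<lambda>x. (x - 1) * (- q / (x * (x - a)))" "{}" "\<lambda>x. (x - 1)\<^sup>2 * snd E x"] assms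
      by (auto simp: E power2_eq_square intro!: continuous_intros)
  qed
  have a: "\<not> removable E a"
  proof (rule no)
    show "((\<lambda>x. (x - a) * fst E x) \<longlongrightarrow> 1 / 2) (at a)"
      using split[of a "\<lambda>x. 1 / 2 + (x - a) * ((1 / 2) / x + (1 / 2) / (x - 1))" "{}" "\<lambda>x. (x - a) * fst E x"] assms
      by (auto simp: E distrib_left intro!: continuous_intros)
    show "((\<lambda>x. (x - a)\<^sup>2 * snd E x) \<longlongrightarrow> 0) (at a)"
      using split[of a "\<lambda>x. (x - a) * (- q / (x * (x - 1)))" "{}" "\<lambda>x. (x - a)\<^sup>2 * snd E x"] assms
      by (auto simp: E power2_eq_square intro!: continuous_intros)
  qed
  have inv: "deriv inverse t = - 1 / t\<^sup>2 \<and> deriv (deriv inverse) t = 2 / t ^ 3" if "t \<noteq> 0" for t :: complex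
  proof -
    have d: "deriv inverse t = - 1 / t\<^sup>2" if "t \<noteq> 0" for t :: complex
      using DERIV_imp_deriv[OF DERIV_inverse[OF that]] by (simp add: power2_eq_square divide_inverse)
    have "\<forall>\<^sub>F s in nhds t. s \<in> - {0}" using that by (intro eventually_nhds_in_open) auto
    hence "deriv (deriv inverse) t = deriv (\<lambda>t. - 1 / t\<^sup>2) t"
      by (intro deriv_cong_ev refl, elim eventually_mono) (simp add: d)
    also have "((\<lambda>t. - 1 / t\<^sup>2) has_field_derivative (0 * t\<^sup>2 - - 1 * (2 * t)) / (t\<^sup>2 * t\<^sup>2)) (at t)"
      using that by (intro DERIV_divide) (auto intro!: derivative_eq_intros)
    hence "deriv (\<lambda>t. - 1 / t\<^sup>2) t = (0 * t\<^sup>2 - - 1 * (2 * t)) / (t\<^sup>2 * t\<^sup>2)" by (rule DERIV_imp_deriv)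
    also have "\<dots> = 2 / t ^ 3" using that by (simp add: power2_eq_square power3_eq_cube)
    finally show ?thesis using d that by simp
  qed
  have Inf: "\<not> removable (pullback inverse E) 0"
  proof (rule no)
    have c: "t * fst (pullback inverse E) t = 2 - (1 + 1 / (1 - t) + 1 / (1 - a * t)) / 2 \<and>
       t\<^sup>2 * snd (pullback inverse E) t = t * (- q / ((1 - t) * (1 - a * t)))"
      if "t \<noteq> 0" "t \<notin> {1, 1 / a}" for t
    proof -
      have nz: "1 - t \<noteq> 0" "1 - a * t \<noteq> 0" using that assms by (auto simp: field_simps)
      have i: "1 / t - 1 = (1 - t) / t" "1 / t - a = (1 - a * t) / t" "inverse t = 1 / t"
        using that by (simp_all add: field_simps)
      have "fst E (inverse t) = (t / 2) * (1 + 1 / (1 - t) + 1 / (1 - a * t))"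
      proof -
        have "(1 / 2) / (1 / t) = (t / 2) * 1" "(1 / 2) / (s / t) = (t / 2) * (1 / s)" for s
          by simp_all
        thus ?thesis unfolding E i by (simp only: distrib_left)
      qed
      moreover have "- (t * (- 1 / t\<^sup>2)) * ((t / 2) * c) = c / 2" for c
        using that by (simp add: power2_eq_square)
      ultimately have f1: "t * (fst E (inverse t) * (- 1 / t\<^sup>2)) = - (1 + 1 / (1 - t) + 1 / (1 - a * t)) / 2"
        using that by (simp add: power2_eq_square)
      have f2: "t * (2 / t ^ 3 / (- 1 / t\<^sup>2)) = - 2"
        using that by (simp add: power2_eq_square power3_eq_cube)
      have gen: "- c / 2 - - 2 = 2 - c / 2" for c :: complex by simp
      have 1: "t * fst (pullback inverse E) t = 2 - (1 + 1 / (1 - t) + 1 / (1 - a * t)) / 2"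
        unfolding pullback_def fst_conv inv[OF that(1), THEN conjunct1] inv[OF that(1), THEN conjunct2]
        by (simp only: right_diff_distrib f1 f2) (rule gen)
      have "snd E (inverse t) = - q * t ^ 3 / ((1 - t) * (1 - a * t))"
        unfolding E i using that nz by (simp add: power3_eq_cube)
      hence "t\<^sup>2 * snd (pullback inverse E) t = t * (- q / ((1 - t) * (1 - a * t)))"
        unfolding pullback_def snd_conv inv[OF that(1), THEN conjunct1]
        using that(1) by (simp add: power2_eq_square power3_eq_cube)
      with 1 show ?thesis by simp
    qed
    show "((\<lambda>x. (x - 0) * fst (pullback inverse E) x) \<longlongrightarrow> 1 / 2) (at 0)"
      using split[of 0 "\<lambda>t. 2 - (1 + 1 / (1 - t) + 1 / (1 - a * t)) / 2" "{1, 1 / a}" "\<lambda>x. (x - 0) * fst (pullback inverse E) x"] assms c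
      by (auto intro!: continuous_intros)
    show "((\<lambda>x. (x - 0)\<^sup>2 * snd (pullback inverse E) x) \<longlongrightarrow> 0) (at 0)"
      using split[of 0 "\<lambda>t. t * (- q / ((1 - t) * (1 - a * t)))" "{1, 1 / a}" "\<lambda>x. (x - 0)\<^sup>2 * snd (pullback inverse E) x"] assms c
      by (auto intro!: continuous_intros)
  qed
  show ?thesis
    unfolding four_singular_def using sing_pts_heun_subset[of "Heun a q (1 / 2) 0 (1 / 2) (1 / 2)"] 0 1 a Inf
    by (auto simp: sing_pts_iff E_def)
qed

text \<open>
  Links the multiplicity in \<open>fibre_mult\<close> to the discriminant.
\<close>

lemma order_ge_2_imp_qdisc:
  assumes "degree F \<le> 2" "F \<noteq> 0" "order u F \<ge> 2"
  shows "qdisc F = 0"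
proof -
  have "[:- u, 1:] ^ 2 dvd F" using assms order_divides by blast
  then obtain G where F: "F = [:- u, 1:]\<^sup>2 * G" by blast
  have "poly F u = 0" "poly (pderiv F) u = 0"
    unfolding F power2_eq_square
    by (simp_all add: pderiv_mult pderiv_pCons mult.assoc del: mult_pCons_left mult_pCons_right)
  thus ?thesis using qdisc_nonzero_simple(1)[OF assms(1)] by blast
qed

text \<open>
  The singular points of the lift are the unramified fibres \<open>{0, a}\<close> and \<open>{1, \<infinity>}\<close> over \<open>0\<close> and \<open>\<infinity>\<close>; at all other
  points, the critical ones included, the coefficients of the lift are analytic.
\<close>

lemma quadratic_transformation_quad_hl:
  assumes q: "quad_params a a' A" and g: "\<gamma> \<notin> \<int>\<^sub>\<le>\<^sub>0" and four: "four_singular (rhs (quad_hl a a' A q \<alpha> \<gamma>))"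
  shows "quadratic_transformation (quad_hl a a' A q \<alpha> \<gamma>)"
proof -
  define e f where "e = (A * a + 1) / (2 * A)" and "f = (A * a + a') / (2 * A)"
  interpret quad_map a a' A e f unfolding e_def f_def by (rule quad_params_quad_map[OF q])
  have a': "a' \<noteq> 0" "a' \<noteq> 1" "a' = A\<^sup>2 * a\<^sup>2" "1 + a' = 2 * (2 - a) * A" using q by (auto simp: quad_params_iff)
  define r where "r = Heun a' (A * (q - \<gamma> * \<alpha> * a)) \<alpha> (\<gamma> - \<alpha>) \<gamma> (1 / 2)"
  define p where "p = Heun a q (2 * \<alpha>) \<gamma> \<gamma> (2 * \<alpha> - \<gamma> + 1)"
  have rp: "rhs (quad_hl a a' A q \<alpha> \<gamma>) = r" "lhs (quad_hl a a' A q \<alpha> \<gamma>) = p" by (simp_all add: quad_hl_def r_def p_def)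
  have hr: "h_a r = a'" "h_ep r = 1 / 2" by (simp_all add: r_def h_ep_def)
  define N D where "N = [:0, A * a, - A:]" and "D = [:1, - 1 :: complex:]"
  have Req: "poly N x / poly D x = R x" for x
    by (simp add: N_def D_def R_def algebra_simps power2_eq_square diff_divide_distrib)
  have degN: "degree N = 2" "degree D = 1" using nz by (simp_all add: N_def D_def)
  have cop: "coprime N D"
  proof (rule coprimeI)
    fix c assume c: "c dvd N" "c dvd D"
    \<comment> \<open>Division with remainder: the remainder is a nonzero constant.\<close>
    have "N - D * [:A * (1 - a), A:] = [:A * (a - 1):]"
      by (simp add: N_def D_def algebra_simps)
    moreover have "c dvd N - D * [:A * (1 - a), A:]" using c by (intro dvd_diff dvd_mult2)
    ultimately have "c dvd [:A * (a - 1):]" by simp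
    moreover have "is_unit [:A * (a - 1):]" using nz by (simp add: is_unit_iff_degree)
    ultimately show "is_unit c" by (rule dvd_unit_imp_unit)
  qed
  have deg: "max (degree N) (degree D) = 2" using degN by simp
  have crit: "critical_values N D \<subseteq> {Fin 0, Fin 1, Fin (h_a r), Infty}"
  proof
    fix v assume "v \<in> critical_values N D"
    then obtain z where z: "fibre_mult N D v z \<ge> 2" by (auto simp: critical_values_def)
    show "v \<in> {Fin 0, Fin 1, Fin (h_a r), Infty}"
    proof (cases v)
      case (Fin w)
      have F: "fibre_poly N D v = [:- w, A * a + w, - A:]" by (simp add: Fin fibre_poly_def N_def D_def)
      show ?thesis
      proof (cases z)
        case (Fin u)
        have "qdisc (fibre_poly N D v) = 0"
          using z nz unfolding F Fin fibre_mult_def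
          by (intro order_ge_2_imp_qdisc[of _ u]) (simp_all add: F)
        moreover have "qdisc (fibre_poly N D v) = (A * a + w)\<^sup>2 - 4 * A * w"
          unfolding F qdisc_def by (simp add: coeff_pCons numeral_2_eq_2) 
        ultimately have "(A * a + w)\<^sup>2 - 4 * A * w = 0" by simp
        hence "(w - 1) * (w - a') = 0" using a'(3,4) by algebra
        thus ?thesis by (auto simp: \<open>v = Fin w\<close> hr)
      next
        case Infty
        thus ?thesis using z nz degN by (simp add: fibre_mult_def F)
      qed
    qed simp
  qed
  define E where "E = pullback (\<lambda>x. poly N x / poly D x) (heun_ode r)"
  have ER: "E = pullback R (heun_ode r)" unfolding E_def Req ..
  have four': "sing_pts (heun_ode r) = {Fin 0, Fin 1, Fin a', Infty}"
    using four by (simp add: four_singular_def rp hr)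
  have sing: "sing_pts E = {Fin 0, Fin a, Fin 1, Infty}"
  proof
    show "{Fin 0, Fin a, Fin 1, Infty} \<subseteq> sing_pts E"
    proof -
      have 0: "fibre_poly N D (Fin 0) = N" "fibre_poly N D Infty = D" by (simp_all add: fibre_poly_def)
      have "qdisc N \<noteq> 0" "qdisc D \<noteq> 0"
        using nz by (simp_all add: qdisc_def N_def D_def numeral_2_eq_2)
      hence "z \<in> sing_pts E" if "z \<in> fibre N \<or> z \<in> fibre D" for z
        using that four' sing_pts_fibre[OF cop deg, of z "Fin 0" "heun_ode r", unfolded 0]
          sing_pts_fibre[OF cop deg, of z "Infty" "heun_ode r", unfolded 0] by (auto simp: E_def)
      moreover have "Fin 0 \<in> fibre N" "Fin a \<in> fibre N" "Fin 1 \<in> fibre D" "Infty \<in> fibre D"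
        by (simp_all add: N_def D_def numeral_2_eq_2)
      ultimately show ?thesis by blast
    qed
    show "sing_pts E \<subseteq> {Fin 0, Fin a, Fin 1, Infty}"
    proof
      fix v assume v: "v \<in> sing_pts E"
      show "v \<in> {Fin 0, Fin a, Fin 1, Infty}"
      proof (rule ccontr)
        assume nv: "v \<notin> {Fin 0, Fin a, Fin 1, Infty}"
        then obtain u where u: "v = Fin u" "u \<noteq> 0" "u \<noteq> a" "u \<noteq> 1" by (cases v) auto
        have "ordinary_at E u"
          unfolding ordinary_at_def
        proof (intro exI conjI)
          show "(\<lambda>x. \<gamma> / x + \<gamma> / (x - a) + (1 - \<gamma>) / (x - 1)) analytic_on {u}"
            "(\<lambda>x. \<alpha> * (\<gamma> - \<alpha>) / (x - 1)\<^sup>2 - h_q r / (A * (x * (x - a) * (x - 1)))) analytic_on {u}"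
            using u nz by (auto intro!: analytic_intros)
          have "\<forall>\<^sub>F x in at u. x \<notin> {0, 1, a, e, f}"
            by (intro eventually_cofinite_imp_at) (simp add: eventually_cofinite)
          thus "\<forall>\<^sub>F x in at u. fst E x = \<gamma> / x + \<gamma> / (x - a) + (1 - \<gamma>) / (x - 1) \<and>
             snd E x = \<alpha> * (\<gamma> - \<alpha>) / (x - 1)\<^sup>2 - h_q r / (A * (x * (x - a) * (x - 1)))"
          proof eventually_elim
            case (elim x)
            hence x: "x \<noteq> 0" "x \<noteq> 1" "x \<noteq> a" "x \<noteq> e" "x \<noteq> f" by auto
            show ?case
              unfolding ER pullback_def fst_conv snd_conv deriv_R[OF x(2)] pullback_coeffs[OF x hr(1)] hr(2)
              by (simp add: r_def)
          qed
        qed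
        thus False using v u(1) ordinary_at_imp_removable[of E u] by (simp add: sing_pts_iff)
      qed
    qed
  qed
  have card: "card (sing_pts E) = 4" unfolding sing using nz by simp
  have ode: "ode_eq (twist (\<lambda>x. \<Sum>z\<in>{1}. - \<alpha> / (x - z)) E) (heun_ode p)"
    unfolding ode_eq_def
  proof -
    have "\<forall>\<^sub>F x in cofinite. x \<notin> {0, 1, a, e, f}" by (simp add: eventually_cofinite)
    thus "\<forall>\<^sub>F x in cofinite. fst (twist (\<lambda>x. \<Sum>z\<in>{1}. - \<alpha> / (x - z)) E) x = fst (heun_ode p) x \<and>
       snd (twist (\<lambda>x. \<Sum>z\<in>{1}. - \<alpha> / (x - z)) E) x = snd (heun_ode p) x"
    proof eventually_elim
      case (elim x)
      hence x: "x \<noteq> 0" "x \<noteq> 1" "x \<noteq> a" "x \<noteq> e" "x \<noteq> f" by auto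
      note c = lifted_coeffs[OF x, where \<alpha> = \<alpha> and q = q and \<gamma> = \<gamma>, folded r_def p_def]
      have "((\<lambda>x. - \<alpha> / (x - 1)) has_field_derivative \<alpha> / (x - 1)\<^sup>2) (at x)"
        using x by (auto intro!: derivative_eq_intros simp: power2_eq_square)
      hence dL: "deriv (\<lambda>x. - \<alpha> / (x - 1)) x = \<alpha> / (x - 1)\<^sup>2" by (rule DERIV_imp_deriv)
      have s: "(\<lambda>x. \<Sum>z\<in>{1}. - \<alpha> / (x - z)) = (\<lambda>x. - \<alpha> / (x - 1))" by simp
      have P: "fst E x = fst (heun_ode p) x + 2 * (- \<alpha> / (x - 1))"
        unfolding ER pullback_def fst_conv deriv_R[OF x(2)] c(1) by simp
      have Q: "snd E x = snd (heun_ode p) x + fst (heun_ode p) x * (- \<alpha> / (x - 1)) + \<alpha> / (x - 1)\<^sup>2 + (- \<alpha> / (x - 1))\<^sup>2"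
        unfolding ER pullback_def snd_conv deriv_R[OF x(2)] c(2) ..
      show ?case
        unfolding s twist_def fst_conv snd_conv dL P Q by (simp add: algebra_simps power2_eq_square)
    qed
  qed
  have ok: "heun_ok p" "heun_ok r" using g nz a' by (simp_all add: p_def r_def heun_ok_def)
  have arg: "arg (quad_hl a a' A q \<alpha> \<gamma>) x = poly N x / poly D x"
    "pref (quad_hl a a' A q \<alpha> \<gamma>) x = (\<Prod>z\<in>{1}. (1 - x / z) powr - \<alpha>)" for x
    unfolding Req by (simp_all add: quad_hl_def R_def)
  show ?thesis
    unfolding quadratic_transformation_def rp Let_def
  proof (intro conjI ok, goal_cases)
    case 2
    show ?case
    proof (rule exI[of _ N], rule exI[of _ D], rule exI[of _ "{1}"], rule exI[of _ "\<lambda>_. - \<alpha>"], intro conjI)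
    show "card (sing_pts (pullback (\<lambda>x. poly N x / poly D x) (heun_ode r))) = 4" using card E_def by simp
    show "ode_eq (twist (\<lambda>x. \<Sum>z\<in>{1}. - \<alpha> / (x - z)) (pullback (\<lambda>x. poly N x / poly D x) (heun_ode r))) (heun_ode p)"
      using ode E_def by simp
    show "\<forall>\<^sub>F x in nhds 0. arg (quad_hl a a' A q \<alpha> \<gamma>) x = poly N x / poly D x \<and>
      pref (quad_hl a a' A q \<alpha> \<gamma>) x = (\<Prod>z\<in>{1}. (1 - x / z) powr - \<alpha>)"
      using arg by simp
    qed (use cop deg crit in \<open>auto simp: N_def\<close>)
  qed (use four rp in simp)
qed

lemma quadratic_transformation_example:
  assumes q: "quad_params a a' A"
  shows "\<exists>q \<alpha> \<gamma>. quadratic_transformation (quad_hl a a' A q \<alpha> \<gamma>)"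
proof (intro exI)
  have "a' \<noteq> 0" "a' \<noteq> 1" using q by (auto simp: quad_params_iff)
  hence "four_singular (rhs (quad_hl a a' A 0 (1 / 2) (1 / 2)))"
    using four_singular_example by (simp add: quad_hl_def)
  moreover have "(1 / 2 :: complex) \<notin> \<int>\<^sub>\<le>\<^sub>0"
  proof
    assume "(1 / 2 :: complex) \<in> \<int>\<^sub>\<le>\<^sub>0"
    hence "Re (1 / 2) \<le> 0" by (elim nonpos_Ints_cases) (metis Re_complex_of_real of_int_le_0_iff of_real_of_int_eq)
    thus False by simp
  qed
  ultimately show "quadratic_transformation (quad_hl a a' A 0 (1 / 2) (1 / 2))"
    by (intro quadratic_transformation_quad_hl[OF q])
qed

section \<open>Critical values and singular fibres of a quadratic transformation\<close>

lemma eventually_linear_factor_product: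
  fixes S :: "complex set" and c :: "complex \<Rightarrow> complex"
  assumes "finite S" "0 \<notin> S"
  shows "\<forall>\<^sub>F x in nhds 0. ((\<lambda>x. \<Prod>z\<in>S. (1 - x / z) powr c z) has_field_derivative
      (\<Sum>z\<in>S. c z / (x - z)) * (\<Prod>z\<in>S. (1 - x / z) powr c z)) (at x) \<and> (\<Prod>z\<in>S. (1 - x / z) powr c z) \<noteq> 0"
  using assms
proof (induction S rule: finite_induct)
  case (insert z S)
  have "\<forall>\<^sub>F x :: complex in nhds 0. norm x < norm z" by (rule eventually_norm_less) (use insert in auto)
  moreover have "\<forall>\<^sub>F x in nhds 0. ((\<lambda>x. \<Prod>z\<in>S. (1 - x / z) powr c z) has_field_derivative
      (\<Sum>z\<in>S. c z / (x - z)) * (\<Prod>z\<in>S. (1 - x / z) powr c z)) (at x) \<and> (\<Prod>z\<in>S. (1 - x / z) powr c z) \<noteq> 0"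
    using insert by simp
  ultimately show ?case
  proof eventually_elim
    case (elim x)
    have "1 - x / z \<noteq> 0" using elim(1) by auto
    moreover have "((\<lambda>x. (1 - x / z) powr c z * (\<Prod>z\<in>S. (1 - x / z) powr c z)) has_field_derivative
       (c z / (x - z) * (1 - x / z) powr c z) * (\<Prod>z\<in>S. (1 - x / z) powr c z) 
       + ((\<Sum>z\<in>S. c z / (x - z)) * (\<Prod>z\<in>S. (1 - x / z) powr c z)) * (1 - x / z) powr c z) (at x)"
      using elim by (intro DERIV_mult has_field_derivative_linear_factor_powr) auto
    ultimately show ?case using insert elim by (simp add: algebra_simps)
  qed
qed simp

text \<open>
  Gauge changes by powers of linear factors preserve removability at finite points, and away from
  \<open>0, 1, a\<close> the finite points are ordinary for the Heun equation.
\<close>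

lemma sing_pts_gauge_subset:
  assumes "finite S" and eq: "ode_eq (twist (\<lambda>x. \<Sum>z\<in>S. c z / (x - z)) E) (heun_ode p)"
  shows "sing_pts E \<subseteq> {Fin 0, Fin 1, Fin (h_a p), Infty}"
proof
  fix v assume v: "v \<in> sing_pts E"
  show "v \<in> {Fin 0, Fin 1, Fin (h_a p), Infty}"
  proof (cases v)
    case (Fin u)
    have "u \<in> {0, 1, h_a p}"
    proof (rule ccontr)
      assume "u \<notin> {0, 1, h_a p}"
      hence rem: "removable (heun_ode p) u" by (intro ordinary_at_imp_removable heun_ordinary_at)
      define g where "g = (\<lambda>x. \<Sum>z\<in>S - {u}. c z / (x - z))"
      define k where "k = (if u \<in> S then c u else 0)"
      have g: "g analytic_on {u}" "(\<lambda>x. - g x) analytic_on {u}" 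
        unfolding g_def by (auto intro!: analytic_intros)
      have L: "(\<lambda>x. \<Sum>z\<in>S. c z / (x - z)) = (\<lambda>x. k / (x - u) + g x)"
        using assms(1) by (auto simp: k_def g_def sum.remove)
      have "ode_eq_at u (twist (\<lambda>x. (- k) / (x - u) + - g x) (heun_ode p))
         (twist (\<lambda>x. (- k) / (x - u) + - g x) (twist (\<lambda>x. k / (x - u) + g x) E))"
        by (intro twist_cong ode_eq_at_sym[OF ode_eq_imp_ode_eq_at] eq[unfolded L]) simp
      also have "ode_eq_at u \<dots> (twist (\<lambda>x. ((- k) / (x - u) + - g x) + (k / (x - u) + g x)) E)"
        by (intro twist_twist_at eventually_differentiable_pole g)
      also have "twist (\<lambda>x. ((- k) / (x - u) + - g x) + (k / (x - u) + g x)) E = E" by (simp add: twist_def)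
      finally have "removable E u" using removable_twist[OF g(2) rem] removable_cong by metis
      thus False using v by (simp add: Fin sing_pts_iff)
    qed
    thus ?thesis by (auto simp: Fin)
  qed auto
qed

text \<open>
  As a function of the value, the discriminant of the fibre is itself a binary quadratic form, whose
  zeros are the critical values.
\<close>

lemma qdisc_fibre_poly:
  "qdisc (fibre_poly N D Infty) = (coeff D 1)\<^sup>2 - 4 * coeff D 2 * coeff D 0"
  "qdisc (fibre_poly N D (Fin y)) = ((coeff D 1)\<^sup>2 - 4 * coeff D 2 * coeff D 0) * y\<^sup>2
     + (4 * (coeff N 2 * coeff D 0 + coeff N 0 * coeff D 2) - 2 * coeff N 1 * coeff D 1) * y
     + (coeff N 1)\<^sup>2 - 4 * coeff N 2 * coeff N 0"
  by (simp_all add: qdisc_def fibre_poly_def algebra_simps power2_eq_square)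

text \<open>
  The four points are distinct, and three zeros would force all coefficients of the form to vanish.
\<close>

lemma binary_quadratic_form_zeros:
  fixes l k m a' :: complex
  assumes "l \<noteq> 0 \<or> k \<noteq> 0 \<or> m \<noteq> 0" "a' \<noteq> 0" "a' \<noteq> 1"
  defines "Z \<equiv> {v. case v of Fin y \<Rightarrow> l * y\<^sup>2 + k * y + m = 0 | Infty \<Rightarrow> l = 0}"
  shows "card (Z \<inter> {Fin 0, Fin 1, Fin a', Infty}) \<le> 2"
proof -
  have Z: "Fin y \<in> Z \<longleftrightarrow> l * y\<^sup>2 + k * y + m = 0" "Infty \<in> Z \<longleftrightarrow> l = 0" for y
    by (simp_all add: Z_def)
  have no: "\<not> (Fin 0 \<in> Z \<and> Fin 1 \<in> Z \<and> Fin a' \<in> Z)" "\<not> (Fin 0 \<in> Z \<and> Fin 1 \<in> Z \<and> Infty \<in> Z)"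
    "\<not> (Fin 0 \<in> Z \<and> Fin a' \<in> Z \<and> Infty \<in> Z)" "\<not> (Fin 1 \<in> Z \<and> Fin a' \<in> Z \<and> Infty \<in> Z)"
  proof -
    show "\<not> (Fin 0 \<in> Z \<and> Fin 1 \<in> Z \<and> Fin a' \<in> Z)"
    proof
      assume *: "Fin 0 \<in> Z \<and> Fin 1 \<in> Z \<and> Fin a' \<in> Z"
      hence m: "m = 0" and k: "k = - l" by (auto simp: Z add_eq_0_iff)
      have "l * a' * (a' - 1) = 0" using * m k by (simp add: Z algebra_simps power2_eq_square)
      thus False using assms(1-3) m k by auto
    qed
    show "\<not> (Fin 0 \<in> Z \<and> Fin 1 \<in> Z \<and> Infty \<in> Z)" "\<not> (Fin 0 \<in> Z \<and> Fin a' \<in> Z \<and> Infty \<in> Z)"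
      using assms(1-3) by (auto simp: Z)
    show "\<not> (Fin 1 \<in> Z \<and> Fin a' \<in> Z \<and> Infty \<in> Z)"
    proof
      assume *: "Fin 1 \<in> Z \<and> Fin a' \<in> Z \<and> Infty \<in> Z"
      hence l: "l = 0" and k: "m = - k" by (auto simp: Z add_eq_0_iff)
      have "k * (a' - 1) = 0" using * l k by (simp add: Z algebra_simps)
      thus False using assms(1-3) l k by auto
    qed
  qed
  thus ?thesis using assms(2,3)
    by (cases "Fin 0 \<in> Z"; cases "Fin 1 \<in> Z"; cases "Fin a' \<in> Z"; cases "Infty \<in> Z")
       (simp_all add: Int_insert_right card_insert_if)
qed

text \<open>
  Each uncritical singular value contributes two points to the four singular points of the lift, so at
  most two of the four singular values are uncritical; at most two are critical, as zeros of the discriminant form.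
  So exactly two are uncritical, and their fibres are all the singular points. As \<open>0\<close> is one of
  these points and lies over \<open>0\<close>, one of the two values is \<open>0\<close>.
\<close>

lemma quadratic_map_structure:
  assumes cop: "coprime N D" and deg: "max (degree N) (degree D) = 2" and N0: "poly N 0 = 0"
    and a': "a' \<noteq> 0" "a' \<noteq> 1" and r: "sing_pts E = {Fin 0, Fin 1, Fin a', Infty}"
    and card: "card (sing_pts (pullback (\<lambda>x. poly N x / poly D x) E)) = 4"
    and S: "Fin 0 \<in> sing_pts (pullback (\<lambda>x. poly N x / poly D x) E)"
  shows "qdisc N \<noteq> 0 \<and> (\<exists>w s. w \<in> {Fin 1, Fin a', Infty} \<and> s \<noteq> Fin 0 \<and> fibre N = {Fin 0, s} \<and>
     fibre (fibre_poly N D w) = sing_pts (pullback (\<lambda>x. poly N x / poly D x) E) - {Fin 0, s} \<and>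
     (\<forall>v \<in> {Fin 1, Fin a', Infty} - {w}. qdisc (fibre_poly N D v) = 0))"
proof -
  define V where "V = {Fin 0, Fin 1, Fin a', Infty}"
  define F where "F = (\<lambda>v. fibre (fibre_poly N D v))"
  define SE where "SE = sing_pts (pullback (\<lambda>x. poly N x / poly D x) E)"
  define NC where "NC = {v \<in> V. qdisc (fibre_poly N D v) \<noteq> 0}"
  have cV: "card V = 4" "finite V" using a' by (auto simp: V_def)
  have finSE: "finite SE" using card by (metis SE_def card.infinite zero_neq_numeral)
  have dN: "degree N \<le> 2" using deg by auto
  have dF: "degree (fibre_poly N D v) \<le> 2" for v by (rule degree_fibre_poly[OF deg])
  have two: "card (F v) = 2" "finite (F v)" if "v \<in> NC" for v
    using fibre_two_points[OF dF, of v] that by (auto simp: NC_def F_def)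
  have sub: "F v \<subseteq> SE" if "v \<in> NC" for v
    using sing_pts_fibre[OF cop deg, of _ v E] that r by (auto simp: NC_def F_def SE_def V_def)
  have disj: "F v \<inter> F w = {}" if "v \<noteq> w" for v w
    using fibres_disjoint[OF cop deg that] by (simp add: F_def)
  have Fin0: "Fin 0 \<in> F (Fin 0)" using N0 by (simp add: F_def fibre_poly_def)
  have finNC: "finite NC" using cV by (simp add: NC_def)
  have "card (\<Union>v\<in>NC. F v) = (\<Sum>v\<in>NC. card (F v))"
    using disj two by (intro card_UN_disjoint finNC) auto
  hence cU: "card (\<Union>v\<in>NC. F v) = 2 * card NC" using two by simp
  have "card (\<Union>v\<in>NC. F v) \<le> 4"
    using card_mono[OF finSE, of "\<Union>v\<in>NC. F v"] sub card by (auto simp: SE_def)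
  hence le2: "card NC \<le> 2" using cU by simp
  \<comment> \<open>The coefficients of the discriminant form. If all of them vanished, so would \<open>N\<close>.\<close>
  define l k m where "l = (coeff D 1)\<^sup>2 - 4 * coeff D 2 * coeff D 0"
    and "k = 4 * (coeff N 2 * coeff D 0 + coeff N 0 * coeff D 2) - 2 * coeff N 1 * coeff D 1"
    and "m = (coeff N 1)\<^sup>2 - 4 * coeff N 2 * coeff N 0"
  have n0: "coeff N 0 = 0" using N0 by (simp add: poly_0_coeff_0)
  have d0: "coeff D 0 \<noteq> 0" using cop N0 coprime_poly_0[of N D 0] by (simp add: poly_0_coeff_0)
  have nz: "l \<noteq> 0 \<or> k \<noteq> 0 \<or> m \<noteq> 0"
  proof (rule ccontr)
    assume *: "\<not> ?thesis"
    hence "coeff N 1 = 0" "coeff N 2 = 0" using n0 d0 by (auto simp: m_def k_def)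
    hence "poly N x = 0" for x using n0 by (simp add: poly_quadratic[OF dN])
    hence "N = 0" using poly_all_0_iff_0 by blast
    hence "is_unit D" using cop by simp
    hence "degree D = 0" by (metis is_unit_iff_degree not_is_unit_0)
    thus False using deg \<open>N = 0\<close> by simp
  qed
  have "V - NC = {v. case v of Fin y \<Rightarrow> l * y\<^sup>2 + k * y + m = 0 | Infty \<Rightarrow> l = 0} \<inter> V"
  proof -
    have "qdisc (fibre_poly N D v) = 0 \<longleftrightarrow> (case v of Fin y \<Rightarrow> l * y\<^sup>2 + k * y + m = 0 | Infty \<Rightarrow> l = 0)" for v
      by (cases v) (simp_all only: qdisc_fibre_poly l_def k_def m_def cpoint.case add_diff_eq)
    thus ?thesis by (auto simp: NC_def)
  qed
  hence "card (V - NC) \<le> 2" using binary_quadratic_form_zeros[OF nz a'] by (simp add: V_def)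
  moreover have "card (V - NC) = card V - card NC" using finNC by (intro card_Diff_subset) (auto simp: NC_def)
  ultimately have c2: "card NC = 2" using le2 cV by simp
  hence "card (\<Union>v\<in>NC. F v) = card SE" using cU card by (simp add: SE_def)
  hence U: "(\<Union>v\<in>NC. F v) = SE" using sub finSE by (intro card_subset_eq) auto
  have "Fin 0 \<in> SE" using S by (simp add: SE_def)
  then obtain v where v: "v \<in> NC" "Fin 0 \<in> F v" unfolding U[symmetric] by blast
  have "v = Fin 0" using disj[of v "Fin 0"] Fin0 v(2) by (metis IntI empty_iff)
  hence 0: "Fin 0 \<in> NC" using v(1) by simp
  then obtain w where w: "NC = {Fin 0, w}" "w \<noteq> Fin 0"
    using c2 by (auto simp: card_2_iff doubleton_eq_iff)
  have "w \<in> V" using w by (auto simp: NC_def)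
  hence wV: "w \<in> {Fin 1, Fin a', Infty}" using w by (auto simp: V_def)
  have FN: "fibre_poly N D (Fin 0) = N" by (simp add: fibre_poly_def)
  have "card (fibre N) = 2" using two(1)[OF 0] by (simp add: F_def FN)
  moreover have "Fin 0 \<in> fibre N" using N0 by simp
  ultimately obtain s where s: "fibre N = {Fin 0, s}" "s \<noteq> Fin 0"
    by (metis card_2_iff insert_commute insertE singletonD)
  have c1: "F w = SE - {Fin 0, s}"
    using U w disj[of w "Fin 0"] s by (auto simp: F_def FN)
  have c2: "qdisc (fibre_poly N D v) = 0" if "v \<in> {Fin 1, Fin a', Infty} - {w}" for v
  proof -
    have "v \<in> V" "v \<notin> NC" using that w a' by (auto simp: V_def)
    thus ?thesis by (simp add: NC_def)
  qed
  have c3: "qdisc N \<noteq> 0" using 0 by (simp add: NC_def FN)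
  show ?thesis
    by (rule conjI[OF c3], rule exI[of _ w], rule exI[of _ s], intro conjI ballI wV s c2 c1[unfolded F_def SE_def])
qed

lemma local_lift_linear_factors:
  fixes S :: "complex set" and c :: "complex \<Rightarrow> complex"
  assumes prod: "\<forall>\<^sub>F x in nhds 0. ((\<lambda>x. \<Prod>z\<in>S. (1 - x / z) powr c z) has_field_derivative
      (\<Sum>z\<in>S. c z / (x - z)) * (\<Prod>z\<in>S. (1 - x / z) powr c z)) (at x) \<and> (\<Prod>z\<in>S. (1 - x / z) powr c z) \<noteq> 0"
    and D: "poly D 0 \<noteq> 0" and N: "poly N 0 = 0" "poly (pderiv N) 0 \<noteq> 0"
    and ode: "ode_eq (twist (\<lambda>x. \<Sum>z\<in>S. c z / (x - z)) (pullback (\<lambda>x. poly N x / poly D x) (heun_ode (rhs T)))) (heun_ode (lhs T))"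
    and T: "\<forall>\<^sub>F x in nhds 0. arg T x = poly N x / poly D x \<and> pref T x = (\<Prod>z\<in>S. (1 - x / z) powr c z)"
  shows "local_lift T"
proof -
  define R where "R = (\<lambda>x. poly N x / poly D x)"
  define h where "h = (\<lambda>x. \<Prod>z\<in>S. (1 - x / z) powr c z)"
  define L where "L = (\<lambda>x. \<Sum>z\<in>S. c z / (x - z))"
  have Th: "\<forall>\<^sub>F x in nhds 0. arg T x = R x" "\<forall>\<^sub>F x in nhds 0. pref T x = h x"
    using T unfolding R_def h_def by (auto elim: eventually_mono)
  have h: "\<forall>\<^sub>F x in nhds 0. (h has_field_derivative L x * h x) (at x) \<and> h x \<noteq> 0"
    using prod unfolding h_def L_def .
  have R: "R analytic_on {0}" "deriv R 0 \<noteq> 0" "R 0 = 0"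
    using rational_deriv[OF D, of N] D N by (auto simp: R_def)
  have T0: "arg T 0 = R 0" "pref T 0 = h 0" using eventually_nhds_x_imp_x[OF Th(1)] eventually_nhds_x_imp_x[OF Th(2)] by simp_all
  have dT: "deriv (arg T) 0 = deriv R 0" by (rule deriv_cong_ev[OF Th(1) refl])
  have aT: "arg T analytic_on {0}" using R(1) analytic_at_cong[OF Th(1) refl] by blast
  obtain U where U: "open U" "0 \<in> U" "\<And>x. x \<in> U \<Longrightarrow> (h has_field_derivative L x * h x) (at x) \<and> h x \<noteq> 0"
    using h unfolding eventually_nhds by blast
  have "h holomorphic_on U" using U(3) by (auto simp: holomorphic_on_open[OF U(1)])
  hence "h analytic_on {0}" using U analytic_at by blast
  hence hT: "pref T analytic_on {0}" using analytic_at_cong[OF Th(2) refl] by blast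
  have lim: "filterlim R (at 0) (at 0)" using analytic_at_filterlim_at[OF R(1,2)] R(3) by simp
  have "\<forall>\<^sub>F x in at 0. pref T x = h x" using Th(2) by (simp add: eventually_nhds_conv_at)
  from eventually_deriv_eq[OF this] have "\<forall>\<^sub>F x in at 0. pref T x = h x \<and> deriv (pref T) x = deriv h x"
    by eventually_elim simp
  moreover have "\<forall>\<^sub>F x in at 0. (h has_field_derivative L x * h x) (at x) \<and> h x \<noteq> 0"
    using h by (simp add: eventually_nhds_conv_at)
  ultimately have L: "\<forall>\<^sub>F x in at 0. deriv (pref T) x / pref T x = L x"
    by eventually_elim (auto simp: DERIV_imp_deriv)
  have "ode_eq_at 0 (twist (\<lambda>x. deriv (pref T) x / pref T x) (pullback (arg T) (heun_ode (rhs T))))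
      (twist L (pullback R (heun_ode (rhs T))))"
  proof (rule twist_cong[OF ode_eq_at_sym L])
    show "ode_eq_at 0 (pullback R (heun_ode (rhs T))) (pullback (arg T) (heun_ode (rhs T)))"
      using Th(1) by (intro pullback_cong[OF ode_eq_at_refl _ lim]) (auto simp: eventually_nhds_conv_at elim: eventually_mono)
  qed
  also have "ode_eq_at 0 \<dots> (heun_ode (lhs T))"
    using ode_eq_imp_ode_eq_at[OF ode] by (simp add: R_def L_def)
  finally have "ode_eq_at 0 (twist (\<lambda>x. deriv (pref T) x / pref T x) (pullback (arg T) (heun_ode (rhs T)))) (heun_ode (lhs T))" .
  moreover have "h 0 = 1" by (simp add: h_def)
  ultimately show ?thesis unfolding local_lift_def using aT hT T0 dT R by simp
qed

section \<open>Exponents at the critical values\<close>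

context quad_map
begin

text \<open>
  The lift is gauge equivalent to a Heun equation for which the critical point \<open>e\<close> is ordinary. With
  \<open>k = \<delta> - 1/2\<close>, the first coefficient of the lift has residue \<open>2 k\<close> at \<open>e\<close>, so the gauge must remove it and
  has residue \<open>k\<close> there; the double pole \<open>k (1 - k)\<close> that this produces in the second coefficient has to vanish.
  At \<open>f\<close> the same happens with \<open>\<epsilon>\<close>.
\<close>

lemma exponents_at_critical_values:
  assumes T: "local_lift T" and arg: "\<forall>\<^sub>F x in nhds 0. arg T x = R x"
    and a': "h_a (rhs T) = a'" and a: "h_a (lhs T) = a"
  shows "h_de (rhs T) \<in> {1 / 2, 3 / 2}" and "h_ep (rhs T) \<in> {1 / 2, 3 / 2}"
proof -
  define r p where "r = rhs T" and "p = lhs T"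
  note rp = r_def p_def
  define L where "L = (\<lambda>x. deriv (pref T) x / pref T x)"
  define d g where "d = h_de r - 1 / 2" and "g = h_ep r - 1 / 2"
  define PE where "PE = (\<lambda>x. h_ga r / x + h_ga r / (x - a) + (2 - h_ga r - h_de r - h_ep r) / (x - 1)
      + 2 * d / (x - e) + 2 * g / (x - f))"
  define QE where "QE = (\<lambda>x. h_al r * h_be r / (x - 1)\<^sup>2 - h_q r / (A * (x * (x - a) * (x - 1))))"
  define l0 l1 la where "l0 = (h_ga r - h_ga p) / 2" and "l1 = (2 - h_ga r - h_de r - h_ep r - h_de p) / 2"
     and "la = (h_ga r - h_ep p) / 2"
  have l: "2 * l0 = h_ga r - h_ga p" "2 * l1 = 2 - h_ga r - h_de r - h_ep r - h_de p" "2 * la = h_ga r - h_ep p"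
    by (simp_all add: l0_def l1_def la_def)
  \<comment> \<open>Near the origin the logarithmic derivative of the prefactor is the rational function \<open>M\<close>, half the
    difference of the first coefficients, and \<open>G = 0\<close> is the equation between the second coefficients.\<close>
  define M where "M = (\<lambda>x. l0 / x + l1 / (x - 1) + la / (x - a) + d / (x - e) + g / (x - f))"
  define M1 where "M1 = (\<lambda>x. - l0 / x\<^sup>2 - l1 / (x - 1)\<^sup>2 - la / (x - a)\<^sup>2 - d / (x - e)\<^sup>2 - g / (x - f)\<^sup>2)"
  define G where "G = (\<lambda>x. QE x - snd (heun_ode p) x - PE x * M x - M1 x + (M x)\<^sup>2)"
  define B where "B = {0, 1, a, e, f}"
  have evB: "\<forall>\<^sub>F x in at z. x \<notin> B" for z
    by (intro eventually_cofinite_imp_at) (simp add: B_def eventually_cofinite)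
  have "\<forall>\<^sub>F x in at 0. arg T x = R x" using arg by (simp add: eventually_nhds_conv_at)
  note ev = eventually_deriv_eq[OF this]
  have E: "\<forall>\<^sub>F x in at 0. fst (pullback (arg T) (heun_ode r)) x = PE x \<and> snd (pullback (arg T) (heun_ode r)) x = QE x"
    using ev evB[of 0]
  proof eventually_elim
    case (elim x)
    hence x: "x \<noteq> 0" "x \<noteq> 1" "x \<noteq> a" "x \<noteq> e" "x \<noteq> f" by (auto simp: B_def)
    have "h_a r = a'" using a' by (simp add: rp)
    note c = pullback_coeffs[OF x this]
    have "deriv (arg T) x = R1 x" "deriv (deriv (arg T)) x = R2 x" "arg T x = R x"
      using elim deriv_R[OF x(2)] by auto
    thus ?case using c by (simp add: pullback_def PE_def QE_def d_def g_def algebra_simps)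
  qed
  have ode: "ode_eq_at 0 (twist L (pullback (arg T) (heun_ode r))) (heun_ode p)"
    using T by (simp add: local_lift_def L_def rp)
  have pa: "h_a p = a" using a by (simp add: rp)
  have LM: "\<forall>\<^sub>F x in at 0. L x = M x"
    using ode[unfolded ode_eq_at_def] E
  proof eventually_elim
    case (elim x)
    hence "PE x - 2 * L x = h_ga p / x + h_de p / (x - 1) + h_ep p / (x - a)"
      by (simp add: twist_def heun_ode_def pa)
    hence "2 * L x = PE x - (h_ga p / x + h_de p / (x - 1) + h_ep p / (x - a))" by (simp add: algebra_simps)
    also have "\<dots> = (2 * l0) / x + (2 * l1) / (x - 1) + (2 * la) / (x - a) + 2 * d / (x - e) + 2 * g / (x - f)"
      unfolding l by (simp add: PE_def diff_divide_distrib)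
    also have "\<dots> = 2 * M x" by (simp add: M_def distrib_left)
    finally show ?case by simp
  qed
  have G0: "\<forall>\<^sub>F x in at 0. G x = 0"
    using eventually_deriv_eq[OF LM] ode[unfolded ode_eq_at_def] E evB[of 0]
  proof eventually_elim
    case (elim x)
    hence x: "x \<noteq> 0" "x - 1 \<noteq> 0" "x - a \<noteq> 0" "x - e \<noteq> 0" "x - f \<noteq> 0" by (auto simp: B_def)
    have "(M has_field_derivative M1 x) (at x)"
      unfolding M_def M1_def using x by (auto intro!: derivative_eq_intros simp: power2_eq_square)
    hence "deriv L x = M1 x" using elim by (simp add: DERIV_imp_deriv)
    hence "snd (heun_ode p) x = QE x - PE x * M x - M1 x + (M x)\<^sup>2"
      using elim by (simp add: twist_def)
    thus ?case by (simp add: G_def)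
  qed
  have "G holomorphic_on - B"
    unfolding G_def QE_def PE_def M_def M1_def heun_ode_def snd_conv pa B_def
    using nz by (intro holomorphic_intros) auto
  hence G: "G z = 0" if "z \<notin> B" for z
    using analytic_continuation_cofinite[OF _ _ G0 that] by (simp add: B_def)
  have key: "k = 0 \<or> k = 1" if z: "z \<in> {e, f}" 
     and PE: "\<And>x. PE x = 2 * k / (x - z) + P0 x" and M: "\<And>x. M x = k / (x - z) + M0 x" 
     and M1: "\<And>x. M1 x = - k / (x - z)\<^sup>2 + M10 x"
     and c: "isCont P0 z" "isCont M0 z" "isCont M10 z" for z k P0 M0 M10
  proof -
    have z': "z \<noteq> 0" "z \<noteq> 1" "z \<noteq> a" using z ef_nz by auto
    \<comment> \<open>\<open>H\<close> is \<open>(x - z)\<^sup>2 G x\<close> with the pole at \<open>z\<close> cancelled.\<close>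
    define H where "H = (\<lambda>x. (x - z)\<^sup>2 * (QE x - snd (heun_ode p) x) - (2 * k + (x - z) * P0 x) * (k + (x - z) * M0 x)
        + k - (x - z)\<^sup>2 * M10 x + (k + (x - z) * M0 x)\<^sup>2)"
    have "isCont H z"
      unfolding H_def QE_def heun_ode_def snd_conv pa using z' nz by (intro continuous_intros c) auto
    hence "(H \<longlongrightarrow> H z) (at z)" by (simp add: isCont_def)
    moreover have "\<forall>\<^sub>F x in at z. H x = 0"
      using evB[of z] eventually_neq_at_within[of z z UNIV]
    proof eventually_elim
      case (elim x)
      have xz: "x - z \<noteq> 0" using elim by simp
      have "H x = (x - z)\<^sup>2 * G x"
        unfolding G_def PE M M1 H_def using xz by (simp add: divide_simps power2_eq_square) (simp add: algebra_simps)
      thus ?case using G elim by simp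
    qed
    hence "(H \<longlongrightarrow> 0) (at z)" by (rule tendsto_eventually)
    ultimately have "H z = 0" using tendsto_unique trivial_limit_at by blast
    hence "k * (1 - k) = 0" by (simp add: H_def algebra_simps power2_eq_square)
    thus ?thesis by auto
  qed
  have "d = 0 \<or> d = 1"
  proof (rule key)
    show "PE x = 2 * d / (x - e) + (h_ga r / x + h_ga r / (x - a) + (2 - h_ga r - h_de r - h_ep r) / (x - 1) + 2 * g / (x - f))"
      "M x = d / (x - e) + (l0 / x + l1 / (x - 1) + la / (x - a) + g / (x - f))"
      "M1 x = - d / (x - e)\<^sup>2 + (- l0 / x\<^sup>2 - l1 / (x - 1)\<^sup>2 - la / (x - a)\<^sup>2 - g / (x - f)\<^sup>2)" for x
      by (simp_all add: PE_def M_def M1_def)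
  qed (use ef_nz in \<open>auto intro!: continuous_intros\<close>)
  thus "h_de (rhs T) \<in> {1 / 2, 3 / 2}" by (auto simp: d_def rp field_simps)
  have "g = 0 \<or> g = 1"
  proof (rule key)
    show "PE x = 2 * g / (x - f) + (h_ga r / x + h_ga r / (x - a) + (2 - h_ga r - h_de r - h_ep r) / (x - 1) + 2 * d / (x - e))"
      "M x = g / (x - f) + (l0 / x + l1 / (x - 1) + la / (x - a) + d / (x - e))"
      "M1 x = - g / (x - f)\<^sup>2 + (- l0 / x\<^sup>2 - l1 / (x - 1)\<^sup>2 - la / (x - a)\<^sup>2 - d / (x - e)\<^sup>2)" for x
      by (simp_all add: PE_def M_def M1_def)
  qed (use ef_nz in \<open>auto intro!: continuous_intros\<close>)
  thus "h_ep (rhs T) \<in> {1 / 2, 3 / 2}" by (auto simp: g_def rp field_simps)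
qed

end

section \<open>Moebius normalization of the map\<close>

lemma moebius_F_pole_to_infinity:
  assumes "heun_ok p"
  shows "\<exists>U. moebius_F U \<and> lhs U = p \<and> arg U = (\<lambda>x. x / (x - 1)) \<and> h_a (rhs U) = h_a p / (h_a p - 1)"
proof -
  obtain a q \<alpha> \<beta> \<gamma> \<delta> where p: "p = Heun a q \<alpha> \<beta> \<gamma> \<delta>" by (cases p)
  from moebius_F.moebius1[OF assms[unfolded p]] show ?thesis
    unfolding p by - (rule exI, rule conjI, assumption, simp)
qed

lemma moebius_F_rescale_pole_to_infinity:
  assumes "heun_ok p"
  shows "\<exists>U. moebius_F U \<and> lhs U = p \<and> arg U = (\<lambda>x. x / h_a p / (x / h_a p - 1)) \<and> h_a (rhs U) = 1 / (1 - h_a p)"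
proof -
  obtain U where U: "moebius_F U" "lhs U = p" "arg U = (\<lambda>x. x / h_a p)" "h_a (rhs U) = 1 / h_a p"
    using moebius_F_rescale[OF assms] by blast
  obtain V where V: "moebius_F V" "lhs V = rhs U" "arg V = (\<lambda>x. x / (x - 1))" "h_a (rhs V) = h_a (rhs U) / (h_a (rhs U) - 1)"
    using moebius_F_pole_to_infinity moebius_F_heun_ok[OF U(1)] by blast
  have "h_a p \<noteq> 0" "1 - h_a p \<noteq> 0" using assms by (auto simp: heun_ok_def)
  hence "h_a (rhs V) = 1 / (1 - h_a p)" unfolding V(4) U(4) by (simp add: divide_simps)
  thus ?thesis using U V moebius_F.comp[OF U(1) V(1)]
    by (intro exI[of _ "hl_comp U V"]) (simp add: hl_comp_def)
qed

lemma moebius_F_pole_to_infinity_rescale: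
  assumes "heun_ok p"
  shows "\<exists>U. moebius_F U \<and> lhs U = p \<and> arg U = (\<lambda>x. x / (x - 1) / (h_a p / (h_a p - 1))) \<and>
     h_a (rhs U) = (h_a p - 1) / h_a p"
proof -
  obtain U where U: "moebius_F U" "lhs U = p" "arg U = (\<lambda>x. x / (x - 1))" "h_a (rhs U) = h_a p / (h_a p - 1)"
    using moebius_F_pole_to_infinity[OF assms] by blast
  obtain V where V: "moebius_F V" "lhs V = rhs U" "arg V = (\<lambda>x. x / h_a (rhs U))" "h_a (rhs V) = 1 / h_a (rhs U)"
    using moebius_F_rescale moebius_F_heun_ok[OF U(1)] by blast
  thus ?thesis using U V moebius_F.comp[OF U(1) V(1)]
    by (intro exI[of _ "hl_comp U V"]) (simp add: hl_comp_def)
qed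

lemma qdisc_smult: "qdisc (smult k F) = k\<^sup>2 * qdisc F"
  by (simp add: qdisc_def power2_eq_square algebra_simps)

lemma eventually_poly_nonzero:
  "poly F 0 \<noteq> 0 \<Longrightarrow> \<forall>\<^sub>F x in nhds (0 :: complex). poly F x \<noteq> 0"
  by (rule eventually_mono[OF eventually_analytic_nonzero[of "poly F" 0]])
     (auto intro!: holomorphic_on_imp_analytic_at[of _ UNIV] holomorphic_intros)

text \<open>
  The Moebius transformation \<open>y / (y - w)\<close> sends the finite value \<open>w\<close> to \<open>\<infinity>\<close>, and turns \<open>N / D\<close> into
  \<open>N / (N - w D)\<close>; for \<open>w = \<infinity>\<close> the identity serves. It sends the two critical values to \<open>1\<close> and to the new parameter \<open>a'\<close>, whence the two
  discriminants.
\<close>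

lemma normalize_target:
  assumes r: "heun_ok r" and w: "w \<in> {Fin 1, Fin (h_a r), Infty}" and D0: "poly D 0 \<noteq> 0" and N0: "poly N 0 = 0"
    and crit: "\<forall>v \<in> {Fin 1, Fin (h_a r), Infty} - {w}. qdisc (fibre_poly N D v) = 0"
  defines "D2 \<equiv> fibre_poly N D w"
  shows "\<exists>U. moebius_F U \<and> lhs U = r \<and> (\<forall>\<^sub>F x in nhds 0. arg U (poly N x / poly D x) = poly N x / poly D2 x) \<and>
    qdisc (N - D2) = 0 \<and> qdisc (N - smult (h_a (rhs U)) D2) = 0"
proof -
  define b where "b = h_a r"
  have b: "b \<noteq> 0" "b \<noteq> 1" using r by (auto simp: heun_ok_def b_def)
  have fp: "fibre_poly N D (Fin y) = N - smult y D" "fibre_poly N D Infty = D" for y by (simp_all add: fibre_poly_def)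
  note crit' = crit[folded b_def]
  have arg_y: "\<forall>\<^sub>F x in nhds 0. poly N x / poly D x / y / (poly N x / poly D x / y - 1) = poly N x / poly D2 x"
    if "D2 = N - smult y D" "y \<noteq> 0" for y
  proof -
    have "poly D2 0 \<noteq> 0" using that N0 D0 by simp
    from eventually_poly_nonzero[OF this] eventually_poly_nonzero[OF D0] show ?thesis
    proof eventually_elim
      case (elim x)
      thus ?case using that by (simp add: divide_simps mult.commute)
    qed
  qed
  consider "w = Infty" | "w = Fin 1" | "w = Fin b" using w by (auto simp: b_def)
  thus ?thesis
  proof cases
    case 1
    have c: "qdisc (fibre_poly N D (Fin 1)) = 0" "qdisc (fibre_poly N D (Fin b)) = 0" using crit' 1 by auto
    show ?thesis using moebius_F.ident[OF r] c 1 unfolding D2_def fp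
      by (intro exI[of _ "HlTr r (\<lambda>x. 1) r (\<lambda>x. x)"]) (simp add: fp b_def)
  next
    case 2
    have D2: "D2 = N - smult 1 D" using 2 by (simp add: D2_def fp)
    have "qdisc (fibre_poly N D Infty) = 0" "qdisc (fibre_poly N D (Fin b)) = 0" using crit' b 2 by auto
    hence c: "qdisc D = 0" "qdisc (N - smult b D) = 0" unfolding fp .
    obtain U where U: "moebius_F U" "lhs U = r" "arg U = (\<lambda>x. x / (x - 1))" "h_a (rhs U) = b / (b - 1)"
      using moebius_F_pole_to_infinity[OF r] by (auto simp: b_def)
    have "N - smult (b / (b - 1)) D2 = smult (- 1 / (b - 1)) (N - smult b D)"
    proof (rule poly_eqI)
      fix n
      have "b - 1 \<noteq> 0" using b by simp
      thus "coeff (N - smult (b / (b - 1)) D2) n = coeff (smult (- 1 / (b - 1)) (N - smult b D)) n"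
        by (simp add: D2 divide_simps) (simp add: algebra_simps)
    qed
    hence "qdisc (N - smult (b / (b - 1)) D2) = 0" using c(2) by (simp only: qdisc_smult mult_zero_right)
    moreover have "N - D2 = D" by (simp add: D2)
    ultimately show ?thesis using U arg_y[OF D2] c by (intro exI[of _ U]) simp
  next
    case 3
    have D2: "D2 = N - smult b D" using 3 by (simp add: D2_def fp)
    have "qdisc (fibre_poly N D Infty) = 0" "qdisc (fibre_poly N D (Fin 1)) = 0" using crit' b 3 by auto
    hence c: "qdisc D = 0" "qdisc (N - smult 1 D) = 0" unfolding fp .
    obtain U where U: "moebius_F U" "lhs U = r" "arg U = (\<lambda>x. x / b / (x / b - 1))" "h_a (rhs U) = 1 / (1 - b)"
      using moebius_F_rescale_pole_to_infinity[OF r] by (auto simp: b_def)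
    have "N - smult (1 / (1 - b)) D2 = smult (- b / (1 - b)) (N - smult 1 D)"
    proof (rule poly_eqI)
      fix n
      have "1 - b \<noteq> 0" using b by simp
      thus "coeff (N - smult (1 / (1 - b)) D2) n = coeff (smult (- b / (1 - b)) (N - smult 1 D)) n"
        by (simp add: D2 divide_simps) (simp add: algebra_simps)
    qed
    hence "qdisc (N - smult (1 / (1 - b)) D2) = 0" using c(2) by (simp only: qdisc_smult mult_zero_right)
    moreover have "N - D2 = smult b D" by (simp add: D2)
    hence "qdisc (N - D2) = 0" using c(1) by (simp add: qdisc_smult)
    moreover have "\<forall>\<^sub>F x in nhds 0. arg U (poly N x / poly D x) = poly N x / poly D2 x"
      unfolding U(3) by (rule arg_y[OF D2 b(1)])
    ultimately show ?thesis using U(1,2) unfolding U(4)[symmetric] by blast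
  qed
qed

lemma vieta_monic:
  assumes "1 + k + m = (0 :: complex)" "b\<^sup>2 + k * b + m = 0" "b \<noteq> 1"
  shows "m = b" "1 + b = - k"
proof -
  have "(b - 1) * (b + 1 + k) = 0" using assms(1,2) by algebra
  hence "b + 1 + k = 0" using assms(3) by simp
  thus "1 + b = - k" by algebra
  thus "m = b" using assms(1) by algebra
qed

text \<open>
  \<open>N\<close> has the zeros \<open>0, s\<close> and \<open>D2\<close> has the other two of \<open>1, a, \<infinity>\<close>, so \<open>N / D2\<close> is known up to a factor
  \<open>\<kappa>\<close> in each of the three cases. The transformation \<open>V\<close> is the identity for \<open>s = a\<close>, the rescaling
  \<open>x / a\<close> for \<open>s = 1\<close>, and for \<open>s = \<infinity>\<close> the map \<open>x / (x - 1)\<close> followed by a rescaling. The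
  two vanishing discriminants are a quadratic equation with roots \<open>1\<close> and \<open>b\<close>, and Vieta gives the relation
  in \<open>quad_params\<close>.
\<close>

lemma normalize_source:
  assumes p: "heun_ok p" and s: "s \<in> {Fin 1, Fin (h_a p), Infty}"
    and dN: "degree N \<le> 2" and dD: "degree D2 \<le> 2"
    and fN: "fibre N = {Fin 0, s}" and fD: "fibre D2 = {Fin 1, Fin (h_a p), Infty} - {s}"
    and b: "b \<noteq> 0" "b \<noteq> 1" and crit: "qdisc (N - D2) = 0" "qdisc (N - smult b D2) = 0"
  shows "\<exists>V A. moebius_F V \<and> lhs V = p \<and> quad_params (h_a (rhs V)) b A \<and>
    (\<forall>\<^sub>F x in nhds 0. poly N x / poly D2 x = A * (arg V x * (h_a (rhs V) - arg V x) / (1 - arg V x)))"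
proof -
  define a where "a = h_a p"
  have a: "a \<noteq> 0" "a \<noteq> 1" "a - 1 \<noteq> 0" using p by (auto simp: heun_ok_def a_def)
  have ev: "\<forall>\<^sub>F x in nhds 0. x \<noteq> 1 \<and> x \<noteq> a"
  proof -
    have "\<forall>\<^sub>F x in nhds 0. x \<in> - {1, a}" using a by (intro eventually_nhds_in_open) auto
    thus ?thesis by eventually_elim auto
  qed
  define n2 n1 d2 d1 d0 where "n2 = coeff N 2" and "n1 = coeff N 1"
    and "d2 = coeff D2 2" and "d1 = coeff D2 1" and "d0 = coeff D2 0"
  have "Fin 0 \<in> fibre N" using fN by simp
  hence n0: "coeff N 0 = 0" by (simp add: poly_0_coeff_0)
  have N: "poly N x = n2 * x\<^sup>2 + n1 * x" for x
    by (simp add: poly_quadratic[OF dN] n0 n2_def n1_def)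
  have D: "poly D2 x = d2 * x\<^sup>2 + d1 * x + d0" for x
    by (simp add: poly_quadratic[OF dD] d2_def d1_def d0_def)
  have q: "(n1 - d1)\<^sup>2 + 4 * (n2 - d2) * d0 = 0" "(n1 - b * d1)\<^sup>2 + 4 * (n2 - b * d2) * (b * d0) = 0"
    using crit n0 unfolding qdisc_def n2_def n1_def d2_def d1_def d0_def by simp_all
  have memN: "Fin u \<in> fibre N \<longleftrightarrow> n2 * u\<^sup>2 + n1 * u = 0" "Infty \<in> fibre N \<longleftrightarrow> n2 = 0" for u
    by (simp_all add: N n2_def)
  have memD: "Fin u \<in> fibre D2 \<longleftrightarrow> d2 * u\<^sup>2 + d1 * u + d0 = 0" "Infty \<in> fibre D2 \<longleftrightarrow> d2 = 0" for u
    by (simp_all add: D d2_def)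
  note fD' = fD[folded a_def]
  consider "s = Fin a" | "s = Fin 1" | "s = Infty" using s by (auto simp: a_def)
  thus ?thesis
  proof cases
    case 1
    have "Fin a \<in> fibre N" "Infty \<notin> fibre N" using fN 1 by auto
    hence "a * (n2 * a + n1) = 0" "n2 \<noteq> 0" unfolding memN by (simp_all add: algebra_simps power2_eq_square)
    hence n: "n1 = - n2 * a" "n2 \<noteq> 0" using a by (simp_all add: add_eq_0_iff)
    have "Infty \<in> fibre D2" "Fin 1 \<in> fibre D2" "Fin a \<notin> fibre D2" using fD' 1 a by auto
    hence "d2 = 0" "d1 + d0 = 0" "d2 * a\<^sup>2 + d1 * a + d0 \<noteq> 0" unfolding memD by simp_all
    hence d: "d2 = 0" "d0 = - d1" "d1 \<noteq> 0" by (auto simp: add_eq_0_iff)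
    define \<kappa> where "\<kappa> = n2 / d1"
    have \<kappa>: "n2 = \<kappa> * d1" "\<kappa> \<noteq> 0" using d n by (simp_all add: \<kappa>_def)
    have "d1\<^sup>2 * (1 + (2 * \<kappa> * a - 4 * \<kappa>) + \<kappa>\<^sup>2 * a\<^sup>2) = 0" "d1\<^sup>2 * (b\<^sup>2 + (2 * \<kappa> * a - 4 * \<kappa>) * b + \<kappa>\<^sup>2 * a\<^sup>2) = 0"
      using q d n \<kappa>(1) by algebra+
    hence "1 + (2 * \<kappa> * a - 4 * \<kappa>) + \<kappa>\<^sup>2 * a\<^sup>2 = 0" "b\<^sup>2 + (2 * \<kappa> * a - 4 * \<kappa>) * b + \<kappa>\<^sup>2 * a\<^sup>2 = 0" using d by auto
    note v = vieta_monic[OF this b(2)]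
    have qp: "quad_params a b \<kappa>" using v a b by (simp add: quad_params_iff algebra_simps)
    have "\<forall>\<^sub>F x in nhds 0. poly N x / poly D2 x = \<kappa> * (x * (a - x) / (1 - x))"
      using ev
    proof eventually_elim
      case (elim x)
      hence "x - 1 \<noteq> 0" "1 - x \<noteq> 0" by auto
      thus ?case unfolding N D n d(1,2) \<kappa>(1) using d(3)
        by (simp add: divide_simps) algebra
    qed
    with qp moebius_F.ident[OF p] show ?thesis
      by (intro exI[of _ "HlTr p (\<lambda>x. 1) p (\<lambda>x. x)"] exI[of _ \<kappa>]) (simp add: a_def)
  next
    case 2
    have "Fin 1 \<in> fibre N" "Infty \<notin> fibre N" using fN 2 by auto
    hence n: "n1 = - n2" "n2 \<noteq> 0" unfolding memN by (simp_all add: add_eq_0_iff)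
    have "Infty \<in> fibre D2" "Fin a \<in> fibre D2" "Fin 1 \<notin> fibre D2" using fD' 2 a by auto
    hence "d2 = 0" "d1 * a + d0 = 0" "d2 + d1 + d0 \<noteq> 0" unfolding memD by simp_all
    hence d: "d2 = 0" "d0 = - d1 * a" "d1 \<noteq> 0" by (auto simp: add_eq_0_iff)
    define \<kappa> where "\<kappa> = n2 / d1"
    have \<kappa>: "n2 = \<kappa> * d1" "\<kappa> \<noteq> 0" using d n by (simp_all add: \<kappa>_def)
    have "d1\<^sup>2 * (1 + (2 * \<kappa> - 4 * \<kappa> * a) + \<kappa>\<^sup>2) = 0" "d1\<^sup>2 * (b\<^sup>2 + (2 * \<kappa> - 4 * \<kappa> * a) * b + \<kappa>\<^sup>2) = 0"
      using q d n \<kappa>(1) by algebra+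
    hence "1 + (2 * \<kappa> - 4 * \<kappa> * a) + \<kappa>\<^sup>2 = 0" "b\<^sup>2 + (2 * \<kappa> - 4 * \<kappa> * a) * b + \<kappa>\<^sup>2 = 0" using d by auto
    note v = vieta_monic[OF this b(2)]
    have qp: "quad_params (1 / a) b (\<kappa> * a)" using v a b by (simp add: quad_params_iff power_mult_distrib power_divide) (simp add: field_simps)
    obtain V where V: "moebius_F V" "lhs V = p" "arg V = (\<lambda>x. x / a)" "h_a (rhs V) = 1 / a"
      using moebius_F_rescale[OF p] by (auto simp: a_def)
    have "\<forall>\<^sub>F x in nhds 0. poly N x / poly D2 x = \<kappa> * a * (x / a * (1 / a - x / a) / (1 - x / a))"
      using ev
    proof eventually_elim
      case (elim x)
      hence "x - a \<noteq> 0" "a - x \<noteq> 0" by auto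
      thus ?case unfolding N D n d(1,2) \<kappa>(1) using d(3) a
        by (simp add: divide_simps) (simp add: algebra_simps power2_eq_square)
    qed
    with qp V show ?thesis by (intro exI[of _ V] exI[of _ "\<kappa> * a"]) simp
  next
    case 3
    have "Infty \<in> fibre N" "Fin 1 \<notin> fibre N" using fN 3 by auto
    hence n: "n2 = 0" "n1 \<noteq> 0" unfolding memN by simp_all
    have "Fin 1 \<in> fibre D2" "Fin a \<in> fibre D2" "Infty \<notin> fibre D2" using fD' 3 a by auto
    hence d': "d2 + d1 + d0 = 0" "d2 * a\<^sup>2 + d1 * a + d0 = 0" "d2 \<noteq> 0" unfolding memD by simp_all
    have "(a - 1) * (d2 * (a + 1) + d1) = 0" using d'(1,2) by algebra
    hence "d1 = - d2 * (a + 1)" using a by (simp add: add_eq_0_iff)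
    moreover from this have "d0 = d2 * a" using d'(1) by algebra
    ultimately have d: "d1 = - d2 * (a + 1)" "d0 = d2 * a" "d2 \<noteq> 0" using d'(3) by auto
    define \<kappa> where "\<kappa> = n1 / d2"
    have \<kappa>: "n1 = \<kappa> * d2" "\<kappa> \<noteq> 0" using d n by (simp_all add: \<kappa>_def)
    define m k where "m = \<kappa>\<^sup>2 / (a - 1)\<^sup>2" and "k = 2 * \<kappa> * (1 + a) / (a - 1)\<^sup>2"
    have mk: "m * (a - 1)\<^sup>2 = \<kappa>\<^sup>2" "k * (a - 1)\<^sup>2 = 2 * \<kappa> * (1 + a)" using a by (simp_all add: m_def k_def)
    have "(d2 * (a - 1))\<^sup>2 * (1 + k + m) = 0" "(d2 * (a - 1))\<^sup>2 * (b\<^sup>2 + k * b + m) = 0"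
      using q d n(1) \<kappa>(1) mk by algebra+
    hence "1 + k + m = 0" "b\<^sup>2 + k * b + m = 0" using d a by auto
    note v = vieta_monic[OF this b(2)]
    define A where "A = - \<kappa> * a / (a - 1)\<^sup>2"
    have qp: "quad_params ((a - 1) / a) b A"
      unfolding quad_params_iff
    proof (intro conjI)
      show "b = A\<^sup>2 * ((a - 1) / a)\<^sup>2"
        unfolding v(1)[symmetric] m_def A_def using a by (simp add: divide_simps power2_eq_square)
      show "1 + b = 2 * (2 - (a - 1) / a) * A"
        unfolding v(2) k_def A_def using a by (simp add: divide_simps)
    qed (use a b in auto)
    obtain V where V: "moebius_F V" "lhs V = p" "arg V = (\<lambda>x. x / (x - 1) / (a / (a - 1)))" "h_a (rhs V) = (a - 1) / a"
      using moebius_F_pole_to_infinity_rescale[OF p] by (auto simp: a_def)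
    have "\<forall>\<^sub>F x in nhds 0. poly N x / poly D2 x = A * (arg V x * (h_a (rhs V) - arg V x) / (1 - arg V x))"
      using ev
    proof eventually_elim
      case (elim x)
      hence x: "x - 1 \<noteq> 0" "x - a \<noteq> 0" by auto
      have 1: "arg V x = x * (a - 1) / (a * (x - 1))" by (simp add: V)
      have 2: "1 - x * (a - 1) / (a * (x - 1)) = (x - a) / (a * (x - 1))"
        using x a by (simp add: divide_simps) (simp add: algebra_simps)
      have 3: "(a - 1) / a - x * (a - 1) / (a * (x - 1)) = - (a - 1) / (a * (x - 1))"
        using x a by (simp add: divide_simps) (simp add: algebra_simps)
      have D: "poly D2 x = d2 * ((x - 1) * (x - a))" unfolding D d(1,2) by algebra
      have N: "poly N x = \<kappa> * d2 * x" unfolding N n(1) \<kappa>(1) by simp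
      show ?case unfolding 1 V(4) 2 3 D N A_def using x a d(3)
        by (simp add: divide_simps power2_eq_square) (simp add: algebra_simps)
    qed
    with qp V show ?thesis by (intro exI[of _ V] exI[of _ A]) simp
  qed
qed

section \<open>Uniqueness of the quadratic transformation\<close>

text \<open>
  Once the map is the quadratic map, both equations are determined up to F-homotopic transformations: the right
  one by its exponents at the critical values, the left one because it is gauge equivalent to
  the left equation of \<open>quad_hl\<close>.
\<close>

lemma local_lift_quadratic_normal_form:
  assumes T: "local_lift T" and qp: "quad_params (h_a (lhs T)) (h_a (rhs T)) A"
    and ok: "heun_ok (lhs T)" "heun_ok (rhs T)"
    and arg: "\<forall>\<^sub>F x in nhds 0. arg T x = A * (x * (h_a (lhs T) - x) / (1 - x))"
  shows "\<exists>q \<alpha> \<gamma> M W. \<gamma> \<notin> \<int>\<^sub>\<le>\<^sub>0 \<and> moebius_F M \<and> moebius_F W \<and> germ_id M \<and> germ_id W \<and>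
     lhs M = lhs T \<and> rhs M = lhs (quad_hl (h_a (lhs T)) (h_a (rhs T)) A q \<alpha> \<gamma>) \<and>
     lhs W = rhs T \<and> rhs W = rhs (quad_hl (h_a (lhs T)) (h_a (rhs T)) A q \<alpha> \<gamma>)"
proof -
  define a b where "a = h_a (lhs T)" and "b = h_a (rhs T)"
  note qp' = qp[folded a_def b_def]
  define e f where "e = (A * a + 1) / (2 * A)" and "f = (A * a + b) / (2 * A)"
  interpret quad_map a b A e f unfolding e_def f_def by (rule quad_params_quad_map[OF qp'])
  have "\<forall>\<^sub>F x in nhds 0. arg T x = R x" using arg unfolding a_def[symmetric] R_def .
  note half = exponents_at_critical_values[OF T this b_def[symmetric] a_def[symmetric]]
  have "1 / 2 \<in> {h_de (rhs T), 2 - h_de (rhs T)}" "1 / 2 \<in> {h_ep (rhs T), 2 - h_ep (rhs T)}"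
    using half by auto
  then obtain W where W: "moebius_F W" "germ_id W" "lhs W = rhs T" "h_a (rhs W) = b"
     "h_de (rhs W) = 1 / 2" "h_ep (rhs W) = 1 / 2"
    using normalize_exponents[OF ok(2)] b_def by metis
  obtain q' \<alpha> \<beta> \<gamma> where rW: "rhs W = Heun b q' \<alpha> \<beta> \<gamma> (1 / 2)"
    using W by (cases "rhs W") auto
  have \<beta>: "\<beta> = \<gamma> - \<alpha>" 
  proof -
    have "\<alpha> + \<beta> - \<gamma> - 1 / 2 + 1 = 1 / 2" using W(6) unfolding rW by (simp add: h_ep_def)
    thus ?thesis by algebra
  qed
  have okW: "heun_ok (rhs W)" using moebius_F_heun_ok[OF W(1)] by blast
  hence \<gamma>: "\<gamma> \<notin> \<int>\<^sub>\<le>\<^sub>0" by (simp add: rW heun_ok_def)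
  \<comment> \<open>The accessory parameter on the left that corresponds to \<open>q'\<close> on the right.\<close>
  define q where "q = q' / A + \<gamma> * \<alpha> * a"
  define Q where "Q = quad_hl a b A q \<alpha> \<gamma>"
  have rQ: "rhs Q = rhs W" using nz by (simp add: Q_def quad_hl_def rW \<beta> q_def)
  have lQ: "local_lift Q" unfolding Q_def by (rule local_lift_quad_hl[OF qp'])
  have okQ: "heun_ok (lhs Q)" "h_a (lhs Q) = a" using \<gamma> nz by (simp_all add: Q_def quad_hl_def heun_ok_def)
  define T2 where "T2 = hl_comp T W"
  have lT2: "local_lift T2" unfolding T2_def using local_lift_comp T local_lift_moebius_F[OF W(1)] W(3) by simp
  have T2: "lhs T2 = lhs T" "rhs T2 = rhs Q" by (simp_all add: T2_def hl_comp_def rQ)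
  have argT2: "\<forall>\<^sub>F x in nhds 0. arg T2 x = arg Q x"
    using arg eventually_compose_filterlim[OF W(2)[unfolded germ_id_def] local_lift_filterlim(2)[OF T]]
    by eventually_elim (simp add: T2_def hl_comp_def Q_def quad_hl_def a_def)
  define E where "E = pullback (arg Q) (heun_ode (rhs Q))"
  define L1 L2 where "L1 = (\<lambda>x. deriv (pref T2) x / pref T2 x)" and "L2 = (\<lambda>x. deriv (pref Q) x / pref Q x)"
  have an: "(\<lambda>x. deriv (pref S) x / pref S x) analytic_on {0}" if "local_lift S" for S
    using that analytic_deriv[of "pref S" "{0}"] unfolding local_lift_def by (auto intro!: analytic_intros)
  have L: "L1 analytic_on {0}" "L2 analytic_on {0}" unfolding L1_def L2_def using an lT2 lQ by blast+
  have eQ: "ode_eq_at 0 (twist L2 E) (heun_ode (lhs Q))"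
    using lQ unfolding local_lift_def L2_def E_def by blast
  have "ode_eq_at 0 (pullback (arg T2) (heun_ode (rhs T2))) E"
    unfolding E_def T2 using argT2 local_lift_filterlim(1)[OF lT2]
    by (intro pullback_cong[OF ode_eq_at_refl]) (auto simp: eventually_nhds_conv_at)
  hence "ode_eq_at 0 (twist L1 E) (twist L1 (pullback (arg T2) (heun_ode (rhs T2))))"
    by (intro twist_cong ode_eq_at_sym[of _ _ E]) simp_all
  also have "ode_eq_at 0 \<dots> (heun_ode (lhs T))"
    using lT2 T2(1) unfolding local_lift_def L1_def by simp
  finally have eT: "ode_eq_at 0 (twist L1 E) (heun_ode (lhs T))" .
  have diff: "\<forall>\<^sub>F x in at 0. g field_differentiable (at x)" if "g analytic_on {0}" for g :: "complex \<Rightarrow> complex"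
    using eventually_differentiable_pole[OF that, of 0] by simp
  have L12: "(\<lambda>x. L1 x - L2 x) analytic_on {0}" using L by (intro analytic_intros)
  have "ode_eq_at 0 (twist (\<lambda>x. L1 x - L2 x) (heun_ode (lhs Q))) (twist (\<lambda>x. L1 x - L2 x) (twist L2 E))"
    using ode_eq_at_sym[OF eQ] by (rule twist_cong) simp
  also have "ode_eq_at 0 \<dots> (twist (\<lambda>x. (L1 x - L2 x) + L2 x) E)"
    by (intro twist_twist_at diff L12 L)
  also have "(\<lambda>x. (L1 x - L2 x) + L2 x) = L1" by simp
  also note eT
  finally have "ode_eq_at 0 (twist (\<lambda>x. L1 x - L2 x) (heun_ode (lhs Q))) (heun_ode (lhs T))" .
  then obtain M where M: "moebius_F M" "germ_id M" "lhs M = lhs T" "rhs M = lhs Q"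
    using gauge_equivalent_heun[OF ok(1) okQ(1) _ L12] okQ(2) a_def by auto
  show ?thesis
    using \<gamma> M W rQ unfolding a_def[symmetric] b_def[symmetric] Q_def
    by - (rule exI[of _ q], rule exI[of _ \<alpha>], rule exI[of _ \<gamma>], rule exI[of _ M], rule exI[of _ W], simp)
qed

text \<open>
  The transformation is conjugated to normal form by \<open>V\<close> on the left and \<open>U\<close> on the right, and the resulting
  factorization is recovered from the uniqueness of lifts.
\<close>

lemma quadratic_transformation_unique:
  assumes T: "quadratic_transformation T"
  shows "\<exists>a a' A q \<alpha> \<gamma> M N. quad_params a a' A \<and> \<gamma> \<notin> \<int>\<^sub>\<le>\<^sub>0 \<and> moebius_F M \<and> moebius_F N \<and>
     rhs M = lhs (quad_hl a a' A q \<alpha> \<gamma>) \<and> lhs N = rhs (quad_hl a a' A q \<alpha> \<gamma>) \<and>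
     hl_eq T (hl_comp (hl_comp M (quad_hl a a' A q \<alpha> \<gamma>)) N)"
proof -
  define p r where "p = lhs T" and "r = rhs T"
  define b where "b = h_a r"
  obtain N D S c where ok: "heun_ok p" "heun_ok r" "four_singular r"
    and cop: "coprime N D" and deg: "max (degree N) (degree D) = 2" and N0: "poly N 0 = 0"
    and card: "card (sing_pts (pullback (\<lambda>x. poly N x / poly D x) (heun_ode r))) = 4"
    and S: "finite S" "0 \<notin> S"
    and ode: "ode_eq (twist (\<lambda>x. \<Sum>z\<in>S. c z / (x - z)) (pullback (\<lambda>x. poly N x / poly D x) (heun_ode r))) (heun_ode p)"
    and germ: "\<forall>\<^sub>F x in nhds 0. arg T x = poly N x / poly D x \<and> pref T x = (\<Prod>z\<in>S. (1 - x / z) powr c z)"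
    using T unfolding quadratic_transformation_def Let_def p_def r_def by blast
  define SE where "SE = sing_pts (pullback (\<lambda>x. poly N x / poly D x) (heun_ode r))"
  have b: "b \<noteq> 0" "b \<noteq> 1" using ok(2) by (auto simp: heun_ok_def b_def)
  have sub: "SE \<subseteq> {Fin 0, Fin 1, Fin (h_a p), Infty}"
    unfolding SE_def by (rule sing_pts_gauge_subset[OF S(1) ode])
  have "card {Fin 0, Fin 1, Fin (h_a p), Infty} = 4" using ok(1) by (auto simp: heun_ok_def)
  hence SE: "SE = {Fin 0, Fin 1, Fin (h_a p), Infty}"
    using sub card by (intro card_subset_eq) (auto simp: SE_def)
  have r4: "sing_pts (heun_ode r) = {Fin 0, Fin 1, Fin b, Infty}"
    using ok(3) by (simp add: four_singular_def b_def)
  obtain w s where qN: "qdisc N \<noteq> 0" and w: "w \<in> {Fin 1, Fin b, Infty}" and s: "s \<noteq> Fin 0" "fibre N = {Fin 0, s}"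
     and fD: "fibre (fibre_poly N D w) = SE - {Fin 0, s}"
     and crit: "\<forall>v \<in> {Fin 1, Fin b, Infty} - {w}. qdisc (fibre_poly N D v) = 0"
    using quadratic_map_structure[OF cop deg N0 b r4 card] SE unfolding SE_def by auto
  have D0: "poly D 0 \<noteq> 0" using cop N0 coprime_poly_0[of N D 0] by auto
  define D2 where "D2 = fibre_poly N D w"
  have dN: "degree N \<le> 2" using deg by auto
  have dD2: "degree D2 \<le> 2" unfolding D2_def by (rule degree_fibre_poly[OF deg])
  have N1: "poly (pderiv N) 0 \<noteq> 0" using qdisc_nonzero_simple(1)[OF dN qN N0] .
  have lT: "local_lift T"
    using eventually_linear_factor_product[OF S] D0 N0 N1 ode germ unfolding p_def r_def
    by (rule local_lift_linear_factors)
  obtain U where U: "moebius_F U" "lhs U = r" "\<forall>\<^sub>F x in nhds 0. arg U (poly N x / poly D x) = poly N x / poly D2 x"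
     "qdisc (N - D2) = 0" "qdisc (N - smult (h_a (rhs U)) D2) = 0"
    using normalize_target[OF ok(2) w[unfolded b_def] D0 N0 crit[unfolded b_def]] unfolding D2_def by blast
  have okU: "heun_ok (rhs U)" using moebius_F_heun_ok[OF U(1)] by blast
  hence bU: "h_a (rhs U) \<noteq> 0" "h_a (rhs U) \<noteq> 1" by (auto simp: heun_ok_def)
  have "s \<in> {Fin 1, Fin (h_a p), Infty}"
  proof -
    have "s \<in> fibre (fibre_poly N D (Fin 0))" using s by (simp add: fibre_poly_def)
    hence "s \<in> SE" using sing_pts_fibre[OF cop deg, of s "Fin 0" "heun_ode r"] qN r4
      by (simp add: SE_def fibre_poly_def)
    thus ?thesis using SE s by auto
  qed
  moreover have "fibre D2 = {Fin 1, Fin (h_a p), Infty} - {s}"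
    unfolding D2_def fD SE using ok(1) by (auto simp: heun_ok_def)
  ultimately obtain V A where V: "moebius_F V" "lhs V = p" and qp: "quad_params (h_a (rhs V)) (h_a (rhs U)) A"
    and argV: "\<forall>\<^sub>F x in nhds 0. poly N x / poly D2 x = A * (arg V x * (h_a (rhs V) - arg V x) / (1 - arg V x))"
    using normalize_source[OF ok(1) _ dN dD2 s(2) _ bU U(4,5)] by blast
  obtain V' where V': "moebius_F V'" "lhs V' = rhs V" "rhs V' = lhs V" "\<forall>\<^sub>F x in nhds 0. arg V (arg V' x) = x"
      "\<forall>\<^sub>F x in nhds 0. arg V' (arg V x) = x"
    using moebius_F_inverse[OF V(1)] by blast
  \<comment> \<open>\<open>V\<^sup>-\<^sup>1\<close>, then \<open>T\<close>, then \<open>U\<close>: a lift whose change of variable is the quadratic map.\<close>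
  define T1 where "T1 = hl_comp (hl_comp V' T) U"
  have lT1: "local_lift T1"
    unfolding T1_def using V' V U lT local_lift_moebius_F
    by (intro local_lift_comp) (auto simp: hl_comp_def p_def r_def)
  have T1: "lhs T1 = rhs V" "rhs T1 = rhs U" using V' by (simp_all add: T1_def hl_comp_def)
  have argU: "\<forall>\<^sub>F x in nhds 0. arg U (arg T x) = A * (arg V x * (h_a (rhs V) - arg V x) / (1 - arg V x))"
    using germ U(3) argV by eventually_elim simp
  have argT1: "\<forall>\<^sub>F x in nhds 0. arg T1 x = A * (x * (h_a (rhs V) - x) / (1 - x))"
    using V'(4) eventually_compose_filterlim[OF argU moebius_F_arg_lim[OF V'(1)]]
    by eventually_elim (simp add: T1_def hl_comp_def)
  have okV: "heun_ok (rhs V)" using moebius_F_heun_ok[OF V(1)] by blast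
  obtain q \<alpha> \<gamma> M W where MW: "\<gamma> \<notin> \<int>\<^sub>\<le>\<^sub>0" "moebius_F M" "moebius_F W" "germ_id M" "germ_id W"
     "lhs M = rhs V" "rhs M = lhs (quad_hl (h_a (rhs V)) (h_a (rhs U)) A q \<alpha> \<gamma>)"
     "lhs W = rhs U" "rhs W = rhs (quad_hl (h_a (rhs V)) (h_a (rhs U)) A q \<alpha> \<gamma>)"
    using local_lift_quadratic_normal_form[OF lT1, unfolded T1, OF qp okV okU argT1] by blast
  define Q where "Q = quad_hl (h_a (rhs V)) (h_a (rhs U)) A q \<alpha> \<gamma>"
  define M' where "M' = hl_comp V M"
  have M': "moebius_F M'" "lhs M' = p" "rhs M' = lhs Q"
    using moebius_F.comp[OF V(1) MW(2)] V MW by (simp_all add: M'_def hl_comp_def Q_def)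
  have "moebius_F (hl_comp U W)" using moebius_F.comp[OF U(1) MW(3)] MW by simp
  from moebius_F_inverse[OF this] obtain K where K: "moebius_F K" "lhs K = rhs W" "rhs K = r"
     "\<forall>\<^sub>F x in nhds 0. arg K (arg (hl_comp U W) x) = x"
    using U by (auto simp: hl_comp_def)
  have K': "lhs K = rhs Q" using K MW by (simp add: Q_def)
  \<comment> \<open>\<open>T\<close> and \<open>T3\<close> are lifts between the same equations along the same map, hence equal as germs.\<close>
  define T3 where "T3 = hl_comp (hl_comp M' Q) K"
  have lQ: "local_lift Q" unfolding Q_def by (rule local_lift_quad_hl[OF qp])
  have lT3: "local_lift T3"
    unfolding T3_def using M' K K' lQ local_lift_moebius_F
    by (intro local_lift_comp) (auto simp: hl_comp_def)
  have limT: "filterlim (arg T) (nhds 0) (nhds 0)" by (rule local_lift_filterlim(2)[OF lT])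
  have limU: "filterlim (arg U) (nhds 0) (nhds 0)" by (rule moebius_F_arg_lim[OF U(1)])
  have limUT: "filterlim (\<lambda>x. arg U (arg T x)) (nhds 0) (nhds 0)" using filterlim_compose[OF limU limT] .
  have "\<forall>\<^sub>F x in nhds 0. arg T x = arg T3 x"
    using argU eventually_compose_filterlim[OF MW(4)[unfolded germ_id_def] moebius_F_arg_lim[OF V(1)]]
      eventually_compose_filterlim[OF MW(5)[unfolded germ_id_def] limUT]
      eventually_compose_filterlim[OF K(4) limT]
    by eventually_elim (simp add: T3_def hl_comp_def M'_def Q_def quad_hl_def)
  hence "hl_eq T T3"
    using lT lT3 K(3) M'(2) by (intro local_lift_unique) (auto simp: T3_def hl_comp_def p_def r_def)
  thus ?thesis
    using qp MW(1) M'(1,3) K(1) K' unfolding T3_def Q_def by blast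
qed

theorem theorem4p1:
  shows "(\<forall>a a' A q \<alpha> \<gamma>. quad_params a a' A \<and> \<gamma> \<notin> \<int>\<^sub>\<le>\<^sub>0 \<longrightarrow>
            (\<forall>\<^sub>F x in nhds 0.
               Hl (Heun a q (2 * \<alpha>) \<gamma> \<gamma> (2 * \<alpha> - \<gamma> + 1)) x =
               (1 - x) powr (- \<alpha>) *
               Hl (Heun a' (A * (q - \<gamma> * \<alpha> * a)) \<alpha> (\<gamma> - \<alpha>) \<gamma> (1 / 2))
                  (A * (x * (a - x) / (1 - x))))) \<and>
         (\<forall>a a' A q \<alpha> \<gamma>. quad_params a a' A \<and> \<gamma> \<notin> \<int>\<^sub>\<le>\<^sub>0 \<and>
            four_singular (rhs (quad_hl a a' A q \<alpha> \<gamma>)) \<longrightarrow>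
            quadratic_transformation (quad_hl a a' A q \<alpha> \<gamma>)) \<and>
         (\<forall>a a' A. quad_params a a' A \<longrightarrow>
            (\<exists>q \<alpha> \<gamma>. quadratic_transformation (quad_hl a a' A q \<alpha> \<gamma>))) \<and>
         (\<forall>T. quadratic_transformation T \<longrightarrow>
            (\<exists>a a' A q \<alpha> \<gamma> M N. quad_params a a' A \<and> \<gamma> \<notin> \<int>\<^sub>\<le>\<^sub>0 \<and>
               moebius_F M \<and> moebius_F N \<and>
               rhs M = lhs (quad_hl a a' A q \<alpha> \<gamma>) \<and>
               lhs N = rhs (quad_hl a a' A q \<alpha> \<gamma>) \<and>
               hl_eq T (hl_comp (hl_comp M (quad_hl a a' A q \<alpha> \<gamma>)) N)))"
proof (intro conjI allI impI)
  fix a a' A q \<alpha> \<gamma> :: complex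
  assume *: "quad_params a a' A \<and> \<gamma> \<notin> \<int>\<^sub>\<le>\<^sub>0"
  hence "heun_ok (lhs (quad_hl a a' A q \<alpha> \<gamma>))" "heun_ok (rhs (quad_hl a a' A q \<alpha> \<gamma>))"
    by (auto simp: quad_hl_def heun_ok_def quad_params_def)
  from Hl_local_lift[OF local_lift_quad_hl this] *
  show "\<forall>\<^sub>F x in nhds 0. Hl (Heun a q (2 * \<alpha>) \<gamma> \<gamma> (2 * \<alpha> - \<gamma> + 1)) x =
     (1 - x) powr (- \<alpha>) * Hl (Heun a' (A * (q - \<gamma> * \<alpha> * a)) \<alpha> (\<gamma> - \<alpha>) \<gamma> (1 / 2)) (A * (x * (a - x) / (1 - x)))"
    by (simp add: quad_hl_def)
qed (use quadratic_transformation_quad_hl quadratic_transformation_example quadratic_transformation_unique in blast)+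

end
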